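(* Let $\phi=k_1\wedge\dots\wedge k_m$ be a CNF in variables $x_1,\dots,x_n$, and let $Q^\phi_1,\dots,Q^\phi_m$ be the non-commutative formulas over $GF(2)$ given by $Q^\phi_i=\mathrm{tr}'(k_i)$. If there is a non-commutative IPS refutation over $GF(2)$ of size $s$ of $Q^\phi_1,\dots,Q^\phi_m$, then there is a Frege proof of $\neg\phi$ of size $s^{O(\log s)}$.
   Context: Translation $\mathrm{tr}'$: for a variable $x$, $\mathrm{tr}'(x)=1-x$ and $\mathrm{tr}'(\neg x)=x$; for a clause, $\mathrm{tr}'(f_1\lor\dots\lor f_r)=\mathrm{tr}'(f_1)\cdots\mathrm{tr}'(f_r)$, a tree of product gates with the $\mathrm{tr}'(f_i)$ as leaves (over $GF(2)$, $1-x$ is $1+x$). A non-commutative formula over $\mathbb{F}$ is a fan-in-two rooted tree whose leaves are labeled by variables or field elements and whose internal nodes are $+$ or $\times$ gates, with children of $\times$ gates ordered; it computes an element of $\mathbb{F}\langle x_1,x_2,\dots\rangle$; its size is its number of nodes. Non-commutative IPS refutation over $GF(2)$ of $Q_1,\dots,Q_m$: the system is $Q_1,\dots,Q_m$ together with the Boolean axioms $x_i(1-x_i)$ and commutator axioms $x_ix_j-x_jx_i$ ($i<j$), say $F_1,\dots,F_{m'}$; a refutation is $\mathfrak{F}(\bar x,y_1,\dots,y_{m'})\in GF(2)\langle\bar x,\bar y\rangle$ with $\mathfrak{F}(\bar x,\bar 0)=0$ and $\mathfrak{F}(\bar x,F_1,\dots,F_{m'})=1$ as identities; its size is the minimal size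 of a non-commutative formula computing it. Frege: a fixed propositional proof system with finitely many sound axiom schemes and rules, implicationally complete, whose lines are Boolean formulas; size is total number of symbols.
   Formalization: The bound is N^{O(log N)} with N = s + |φ| (|φ| the symbol size of φ) instead of s^{O(log s)}, since a CNF with clauses x₁, ¬x₁ and arbitrarily many others has a refutation of size 3 while every Frege proof of ¬φ has size at least |φ|. *)

theory Defs
  imports Complex_Main "HOL-Library.Z2"
begin

text \<open>GF(2) is the field bit from HOL-Library.Z2. A non-commutative polynomial over GF(2)
in variables of type 'v is represented by its coefficient function on words (monomials),
i.e. a map 'v list to bit. Formulas compute finitely supported such maps.\<close>

type_synonym 'v ncpoly = "'v list \<Rightarrow> bit"

definition nc_const :: "bit \<Rightarrow> 'v ncpoly" where
  "nc_const c = (\<lambda>w. if w = [] then c else 0)"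

definition nc_var :: "'v \<Rightarrow> 'v ncpoly" where
  "nc_var v = (\<lambda>w. if w = [v] then 1 else 0)"

definition nc_add :: "'v ncpoly \<Rightarrow> 'v ncpoly \<Rightarrow> 'v ncpoly" where
  "nc_add p q = (\<lambda>w. p w + q w)"

definition nc_mul :: "'v ncpoly \<Rightarrow> 'v ncpoly \<Rightarrow> 'v ncpoly" where
  "nc_mul p q = (\<lambda>w. \<Sum>i\<in>{0..length w}. p (take i w) * q (drop i w))"

definition nc_sum_list :: "'v ncpoly list \<Rightarrow> 'v ncpoly" where
  "nc_sum_list ps = foldr nc_add ps (nc_const 0)"

definition nc_prod_list :: "'v ncpoly list \<Rightarrow> 'v ncpoly" where
  "nc_prod_list ps = foldr nc_mul ps (nc_const 1)"

datatype 'v ncformula =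
    NVar 'v
  | NConst bit
  | NAdd "'v ncformula" "'v ncformula"
  | NMul "'v ncformula" "'v ncformula"

fun nc_eval :: "'v ncformula \<Rightarrow> 'v ncpoly" where
  "nc_eval (NVar v) = nc_var v"
| "nc_eval (NConst c) = nc_const c"
| "nc_eval (NAdd f g) = nc_add (nc_eval f) (nc_eval g)"
| "nc_eval (NMul f g) = nc_mul (nc_eval f) (nc_eval g)"

fun nc_size :: "'v ncformula \<Rightarrow> nat" where
  "nc_size (NVar v) = 1"
| "nc_size (NConst c) = 1"
| "nc_size (NAdd f g) = 1 + nc_size f + nc_size g"
| "nc_size (NMul f g) = 1 + nc_size f + nc_size g"

fun nc_monoprod :: "('v \<Rightarrow> 'u ncpoly) \<Rightarrow> 'v list \<Rightarrow> 'u ncpoly" where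
  "nc_monoprod \<sigma> [] = nc_const 1"
| "nc_monoprod \<sigma> (v # w) = nc_mul (\<sigma> v) (nc_monoprod \<sigma> w)"

definition nc_subst :: "'v ncpoly \<Rightarrow> ('v \<Rightarrow> 'u ncpoly) \<Rightarrow> 'u ncpoly" where
  "nc_subst P \<sigma> = (\<lambda>u. \<Sum>w\<in>{w. P w \<noteq> 0}. P w * nc_monoprod \<sigma> w u)"

text \<open>Variables of a refutation: the x-variables X i (i < n, standing for x_(i+1))
and the placeholder variables Y j (standing for y_(j+1)).\<close>
datatype ipsvar = X nat | Y nat

text \<open>A literal is (i, True) for x_i and (i, False) for the negation of x_i.
A clause is a list of literals (a disjunction), a CNF a list of clauses (a conjunction).\<close>
type_synonym literal = "nat \<times> bool"
type_synonym clause = "literal list"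
type_synonym cnf = "clause list"

definition cnf_vars :: "cnf \<Rightarrow> nat set" where
  "cnf_vars \<phi> = {i. \<exists>k\<in>set \<phi>. \<exists>b. (i, b) \<in> set k}"

text \<open>tr'(x) = 1 - x = 1 + x over GF(2), tr'(not x) = x.\<close>
fun tr_lit :: "literal \<Rightarrow> ipsvar ncpoly" where
  "tr_lit (i, True) = nc_add (nc_const 1) (nc_var (X i))"
| "tr_lit (i, False) = nc_var (X i)"

definition tr_clause :: "clause \<Rightarrow> ipsvar ncpoly" where
  "tr_clause k = nc_prod_list (map tr_lit k)"

definition bool_axioms :: "nat \<Rightarrow> ipsvar ncpoly list" where
  "bool_axioms n = map (\<lambda>i. nc_mul (nc_var (X i)) (nc_add (nc_const 1) (nc_var (X i)))) [0..<n]"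

definition comm_axioms :: "nat \<Rightarrow> ipsvar ncpoly list" where
  "comm_axioms n = concat (map (\<lambda>i. map (\<lambda>j.
       nc_add (nc_mul (nc_var (X i)) (nc_var (X j))) (nc_mul (nc_var (X j)) (nc_var (X i))))
     [Suc i..<n]) [0..<n])"

definition ips_system :: "nat \<Rightarrow> ipsvar ncpoly list \<Rightarrow> ipsvar ncpoly list" where
  "ips_system n Qs = Qs @ bool_axioms n @ comm_axioms n"

definition nc_ips_refutation :: "ipsvar ncpoly list \<Rightarrow> ipsvar ncpoly \<Rightarrow> bool" where
  "nc_ips_refutation Fs P \<longleftrightarrow>
     (\<forall>w. P w \<noteq> 0 \<longrightarrow> (\<forall>j. Y j \<in> set w \<longrightarrow> j < length Fs)) \<and>
     nc_subst P (\<lambda>v. case v of X i \<Rightarrow> nc_var (X i) | Y j \<Rightarrow> nc_const 0) = nc_const 0 \<and>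
     nc_subst P (\<lambda>v. case v of X i \<Rightarrow> nc_var (X i) | Y j \<Rightarrow> Fs ! j) = nc_const 1"

datatype pform =
    PVar nat
  | PTrue
  | PFalse
  | PNot pform
  | PAnd pform pform
  | POr pform pform
  | PImp pform pform

fun peval :: "(nat \<Rightarrow> bool) \<Rightarrow> pform \<Rightarrow> bool" where
  "peval a (PVar i) = a i"
| "peval a PTrue = True"
| "peval a PFalse = False"
| "peval a (PNot f) = (\<not> peval a f)"
| "peval a (PAnd f g) = (peval a f \<and> peval a g)"
| "peval a (POr f g) = (peval a f \<or> peval a g)"
| "peval a (PImp f g) = (peval a f \<longrightarrow> peval a g)"

fun psize :: "pform \<Rightarrow> nat" where
  "psize (PVar i) = 1"
| "psize PTrue = 1"
| "psize PFalse = 1"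
| "psize (PNot f) = 1 + psize f"
| "psize (PAnd f g) = 1 + psize f + psize g"
| "psize (POr f g) = 1 + psize f + psize g"
| "psize (PImp f g) = 1 + psize f + psize g"

fun psubst :: "(nat \<Rightarrow> pform) \<Rightarrow> pform \<Rightarrow> pform" where
  "psubst \<sigma> (PVar i) = \<sigma> i"
| "psubst \<sigma> PTrue = PTrue"
| "psubst \<sigma> PFalse = PFalse"
| "psubst \<sigma> (PNot f) = PNot (psubst \<sigma> f)"
| "psubst \<sigma> (PAnd f g) = PAnd (psubst \<sigma> f) (psubst \<sigma> g)"
| "psubst \<sigma> (POr f g) = POr (psubst \<sigma> f) (psubst \<sigma> g)"
| "psubst \<sigma> (PImp f g) = PImp (psubst \<sigma> f) (psubst \<sigma> g)"

text \<open>A rule (scheme) is a list of premises and a conclusion; an axiom scheme has no premises.\<close>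
type_synonym frule = "pform list \<times> pform"

definition sound_rule :: "frule \<Rightarrow> bool" where
  "sound_rule r \<longleftrightarrow> (\<forall>a. (\<forall>p\<in>set (fst r). peval a p) \<longrightarrow> peval a (snd r))"

definition derivation :: "frule set \<Rightarrow> pform set \<Rightarrow> pform list \<Rightarrow> bool" where
  "derivation R H ls \<longleftrightarrow>
     (\<forall>k < length ls. ls ! k \<in> H \<or>
        (\<exists>r\<in>R. \<exists>\<sigma>. ls ! k = psubst \<sigma> (snd r) \<and>
                   (\<forall>p\<in>set (fst r). psubst \<sigma> p \<in> set (take k ls))))"

definition derives :: "frule set \<Rightarrow> pform set \<Rightarrow> pform \<Rightarrow> bool" where
  "derives R H f \<longleftrightarrow> (\<exists>ls. derivation R H ls \<and> ls \<noteq> [] \<and> last ls = f)"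

definition frege_system :: "frule set \<Rightarrow> bool" where
  "frege_system R \<longleftrightarrow> finite R \<and> (\<forall>r\<in>R. sound_rule r) \<and>
     (\<forall>H f. finite H \<longrightarrow> (\<forall>a. (\<forall>h\<in>H. peval a h) \<longrightarrow> peval a f) \<longrightarrow> derives R H f)"

definition frege_proof :: "frule set \<Rightarrow> pform list \<Rightarrow> pform \<Rightarrow> bool" where
  "frege_proof R ls f \<longleftrightarrow> derivation R {} ls \<and> ls \<noteq> [] \<and> last ls = f"

definition proof_size :: "pform list \<Rightarrow> nat" where
  "proof_size ls = (\<Sum>f\<leftarrow>ls. psize f)"

fun lit_form :: "literal \<Rightarrow> pform" where
  "lit_form (i, True) = PVar i"
| "lit_form (i, False) = PNot (PVar i)"

definition clause_form :: "clause \<Rightarrow> pform" where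
  "clause_form k = (case k of [] \<Rightarrow> PFalse
                    | l # ls \<Rightarrow> foldl (\<lambda>f l'. POr f (lit_form l')) (lit_form l) ls)"

definition cnf_form :: "cnf \<Rightarrow> pform" where
  "cnf_form \<phi> = (case \<phi> of [] \<Rightarrow> PTrue
                  | k # ks \<Rightarrow> foldl (\<lambda>f k'. PAnd f (clause_form k')) (clause_form k) ks)"

end

theory Submission
  imports Defs
begin

text \<open>
  A non-commutative formula is a linear straight-line program
  \<open>p\<^sub>0 = 1\<close>, \<open>p\<^sub>i = v\<^sub>i \<cdot> (\<Sum>j<i. S\<^sub>i\<^sub>j p\<^sub>j)\<close> over \<open>GF(2)\<close>, i.e. an acyclic weighted automaton.
  For Boolean inputs its values solve a triangular linear system with 0/1 coefficients, and repeated
  squaring gives quasi-polynomial size formulas \<open>z\<^sub>i\<close> that provably satisfy the recurrence; this is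
  the only source of the exponent \<open>O(log s)\<close>. In such a program every linear relation
  \<open>\<Sum>i. u\<^sub>i p\<^sub>i = 0\<close> between the non-commutative polynomials has a Frege proof for the \<open>z\<^sub>i\<close> with
  polynomially many lines: stripping the first letter of a relation leads to a relation with smaller
  support, and only a basis of the relations has to be recorded.

  Take the program of the refutation and let the placeholders \<open>Y\<close> have value false. The same formulas
  \<open>z\<^sub>i\<close> solve the program after substituting \<open>0\<close> for the placeholders, and, under the hypothesis \<open>\<phi>\<close>,
  also the one obtained by substituting the axioms, which are then false. The two identities of the
  refutation thus prove that the output is both false and true.
\<close>

section \<open>Derivations and rule simulation\<close>

text \<open>What makes relations provable is that words with different first letters never cancel: a
  relation splits by first letter, and each piece can be divided by its letter. Commuting variables
  offer no such canonical first step. The relations form a vector space with possibly exponentially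
  many members, which is why a stored basis plus a cheap way to reach any single member is needed.

  Size is controlled by two separate numbers. A bound \<open>m\<close>, fixed beforehand, limits
  every formula put into a schema, and \<open>L\<close> counts schema applications; a proof then has
  at most \<open>C * L\<close> lines of size at most \<open>C * m\<close>. Exclusive or is not a
  connective here and its definition writes each argument twice, so long sums must be balanced
  trees; index sets are therefore padded to \<open>2 ^ K\<close>. With \<open>2 ^ K\<close>
  polynomial in the input size \<open>N\<close>, each of the \<open>K = O(log N)\<close> squarings
  multiplies formula sizes and line counts by \<open>2 ^ O(K)\<close>, which gives
  \<open>2 ^ O(K * K)\<close> for both.\<close>

definition pxor :: "pform \<Rightarrow> pform \<Rightarrow> pform" where
  "pxor a b = POr (PAnd a (PNot b)) (PAnd (PNot a) b)"

definition piff :: "pform \<Rightarrow> pform \<Rightarrow> pform" where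
  "piff a b = PAnd (PImp a b) (PImp b a)"

lemma pxor_simps [simp]:
  "psubst \<sigma> (pxor a b) = pxor (psubst \<sigma> a) (psubst \<sigma> b)"
  "peval v (pxor a b) \<longleftrightarrow> peval v a \<noteq> peval v b"
  "psize (pxor a b) = 2 * psize a + 2 * psize b + 5"
  by (auto simp: pxor_def)

lemma piff_simps [simp]:
  "psubst \<sigma> (piff a b) = piff (psubst \<sigma> a) (psubst \<sigma> b)"
  "peval v (piff a b) \<longleftrightarrow> peval v a = peval v b"
  "psize (piff a b) = 2 * psize a + 2 * psize b + 3"
  by (auto simp: piff_def)

lemma psize_pos: "1 \<le> psize f"
  by (cases f) auto

lemma psubst_psubst: "psubst \<sigma> (psubst \<tau> f) = psubst (\<lambda>i. psubst \<sigma> (\<tau> i)) f"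
  by (induction f) auto

lemma psize_psubst:
  assumes "\<And>i. psize (\<sigma> i) \<le> m"
  shows "psize (psubst \<sigma> f) \<le> psize f * m"
proof -
  have "1 \<le> m"
    using assms[of 0] psize_pos[of "\<sigma> 0"] by linarith
  then show ?thesis
    by (induction f) (auto simp: algebra_simps assms)
qed

text \<open>The one-line condition of \<open>derivation\<close>, with the earlier lines given as a
  set \<open>A\<close> instead of a prefix: enlarging hypotheses or prefix is then plain
  monotonicity.\<close>

definition inferable :: "frule set \<Rightarrow> pform set \<Rightarrow> pform set \<Rightarrow> pform \<Rightarrow> bool" where
  "inferable R H A f \<longleftrightarrow> f \<in> H \<or>
     (\<exists>r\<in>R. \<exists>\<sigma>. f = psubst \<sigma> (snd r) \<and> (\<forall>p\<in>set (fst r). psubst \<sigma> p \<in> A))"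

lemma inferable_mono: "inferable R H A f \<Longrightarrow> H \<subseteq> H' \<Longrightarrow> A \<subseteq> A' \<Longrightarrow> inferable R H' A' f"
  unfolding inferable_def by blast

lemma derivation_iff_inferable:
  "derivation R H ls \<longleftrightarrow> (\<forall>k < length ls. inferable R H (set (take k ls)) (ls ! k))"
  unfolding derivation_def inferable_def ..

lemma derivation_Nil [simp]: "derivation R H []"
  by (simp add: derivation_def)

lemma derivation_snoc:
  "derivation R H (ls @ [f]) \<longleftrightarrow> derivation R H ls \<and> inferable R H (set ls) f"
  unfolding derivation_iff_inferable by (auto simp: nth_append less_Suc_eq)

lemma derivation_member:
  assumes "derivation R H ls" "f \<in> set ls"
  shows "inferable R H (set ls) f"
proof -
  obtain k where k: "k < length ls" "f = ls ! k"
    using assms(2) by (auto simp: in_set_conv_nth)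
  then have "inferable R H (set (take k ls)) f"
    using assms(1) by (simp add: derivation_iff_inferable)
  then show ?thesis
    by (rule inferable_mono) (auto dest: in_set_takeD)
qed

lemma derivation_mono: "derivation R H ls \<Longrightarrow> H \<subseteq> H' \<Longrightarrow> derivation R H' ls"
  unfolding derivation_iff_inferable by (blast intro: inferable_mono)

text \<open>The second list may restate a line of the first as a hypothesis. Such a repetition is
  justified by the rule that produced the line originally, as \<open>derivation_member\<close>
  shows.\<close>

lemma derivation_append:
  assumes "derivation R H ls" "derivation R (H \<union> set ls) ls'"
  shows "derivation R H (ls @ ls')"
  using assms(2)
proof (induction ls' rule: rev_induct)
  case Nil
  then show ?case using assms(1) by simp
next
  case (snoc f ls')
  then have d: "derivation R H (ls @ ls')" and i: "inferable R (H \<union> set ls) (set ls') f"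
    by (simp_all add: derivation_snoc)
  have "inferable R H (set (ls @ ls')) f"
  proof (cases "f \<in> set ls")
    case True
    then show ?thesis using derivation_member[OF d] by simp
  next
    case False
    then show ?thesis using i by (auto simp: inferable_def)
  qed
  then show ?case using d by (simp add: derivation_snoc flip: append_assoc)
qed

lemma derivation_psubst:
  assumes "derivation R H ls"
  shows "derivation R (psubst \<sigma> ` H) (map (psubst \<sigma>) ls)"
  using assms
proof (induction ls rule: rev_induct)
  case (snoc f ls)
  have "inferable R (psubst \<sigma> ` H) (set (map (psubst \<sigma>) ls)) (psubst \<sigma> f)"
  proof (cases "f \<in> H")
    case True
    then show ?thesis by (simp add: inferable_def)
  next
    case False
    then obtain r \<tau> where r: "r \<in> R" "f = psubst \<tau> (snd r)" "\<forall>p\<in>set (fst r). psubst \<tau> p \<in> set ls"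
      using snoc.prems unfolding derivation_snoc inferable_def by blast
    then show ?thesis
      unfolding inferable_def psubst_psubst r(2)
      by (intro disjI2 bexI[of _ r] exI[of _ "\<lambda>i. psubst \<sigma> (\<tau> i)"])
         (auto simp: psubst_psubst[symmetric])
  qed
  then show ?case using snoc by (simp add: derivation_snoc)
qed simp

text \<open>Implicational completeness is invoked once per schema. Every instance is a substitution
  instance of that one fixed derivation, so the number of lines and the factor in their size depend
  on \<open>R\<close> and \<open>Q\<close> alone.\<close>

lemma rule_simulation:
  assumes R: "frege_system R" and fin: "finite Q" and sound: "\<And>r. r \<in> Q \<Longrightarrow> sound_rule r"
  shows "\<exists>C>0. \<forall>r\<in>Q. \<forall>\<sigma> m. (\<forall>i. psize (\<sigma> i) \<le> m) \<longrightarrow>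
    (\<exists>ls. derivation R (psubst \<sigma> ` set (fst r)) ls \<and> psubst \<sigma> (snd r) \<in> set ls \<and>
          length ls \<le> C \<and> (\<forall>l\<in>set ls. psize l \<le> C * m))"
  using fin sound
proof (induction Q)
  case empty
  then show ?case by auto
next
  case (insert r Q)
  then obtain C where C: "C > 0" "\<And>r' \<sigma> m. r' \<in> Q \<Longrightarrow> \<forall>i. psize (\<sigma> i) \<le> m \<Longrightarrow>
    \<exists>ls. derivation R (psubst \<sigma> ` set (fst r')) ls \<and> psubst \<sigma> (snd r') \<in> set ls \<and>
          length ls \<le> C \<and> (\<forall>l\<in>set ls. psize l \<le> C * m)"
    by (auto simp: Ball_def)
  have "sound_rule r" using insert.prems by simp
  then have "derives R (set (fst r)) (snd r)"
    using R by (auto simp: frege_system_def sound_rule_def)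
  then obtain ls where ls: "derivation R (set (fst r)) ls" "ls \<noteq> []" "last ls = snd r"
    by (auto simp: derives_def)
  define C' where "C' = C + length ls + (\<Sum>l\<leftarrow>ls. psize l)"
  have le: "psize l \<le> C'" if "l \<in> set ls" for l
    using member_le_sum_list[of "psize l" "map psize ls"] that by (auto simp: C'_def)
  have "\<exists>ls. derivation R (psubst \<sigma> ` set (fst r')) ls \<and> psubst \<sigma> (snd r') \<in> set ls \<and>
          length ls \<le> C' \<and> (\<forall>l\<in>set ls. psize l \<le> C' * m)"
    if r': "r' \<in> insert r Q" and m: "\<forall>i. psize (\<sigma> i) \<le> m" for r' \<sigma> m
  proof (cases "r' = r")
    case True
    have "psize (psubst \<sigma> l) \<le> C' * m" if "l \<in> set ls" for l
    proof -
      have "psize (psubst \<sigma> l) \<le> psize l * m"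
        using m by (intro psize_psubst) auto
      also have "\<dots> \<le> C' * m" using le[OF that] by simp
      finally show ?thesis .
    qed
    moreover have "psubst \<sigma> (snd r) \<in> set (map (psubst \<sigma>) ls)"
      using ls by (metis image_eqI last_in_set list.set_map)
    ultimately show ?thesis
      using True derivation_psubst[OF ls(1)]
      by (intro exI[of _ "map (psubst \<sigma>) ls"]) (auto simp: C'_def)
  next
    case False
    then have "r' \<in> Q" using r' by simp
    from C(2)[OF this m] obtain ls' where ls': "derivation R (psubst \<sigma> ` set (fst r')) ls'"
      "psubst \<sigma> (snd r') \<in> set ls'" "length ls' \<le> C" "\<forall>l\<in>set ls'. psize l \<le> C * m"
      by blast
    have "C \<le> C'" by (simp add: C'_def)
    then have "length ls' \<le> C'" "\<forall>l\<in>set ls'. psize l \<le> C' * m"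
      using ls'(3,4) by (auto intro: order_trans mult_right_mono)
    then show ?thesis using ls' by blast
  qed
  moreover have "C' > 0" using C(1) by (simp add: C'_def)
  ultimately show ?case by blast
qed

text \<open>Every line of the derivations below has the form \<open>PImp h f\<close>, which makes a deduction
  theorem unnecessary; variable \<open>0\<close> of a schema is instantiated with \<open>h\<close>.\<close>

definition lift_rule :: "frule \<Rightarrow> frule" where
  "lift_rule r = (map (PImp (PVar 0)) (fst r), PImp (PVar 0) (snd r))"

abbreviation (input) "mv \<equiv> PVar"

text \<open>Equality reasoning over \<open>GF(2)\<close>, with \<open>piff\<close> as equality,
  \<open>pxor\<close> as sum and \<open>PAnd\<close> as product. Variable \<open>0\<close> is
  avoided because \<open>lift_rule\<close> reserves it for the hypothesis.\<close>

definition ring_rules :: "frule list" where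
  "ring_rules =
   [([], piff (mv 1) (mv 1)),
    ([piff (mv 1) (mv 2)], piff (mv 2) (mv 1)),
    ([piff (mv 1) (mv 2), piff (mv 2) (mv 3)], piff (mv 1) (mv 3)),
    ([piff (mv 1) (mv 2), piff (mv 3) (mv 4)], piff (PAnd (mv 1) (mv 3)) (PAnd (mv 2) (mv 4))),
    ([piff (mv 1) (mv 2), piff (mv 3) (mv 4)], piff (pxor (mv 1) (mv 3)) (pxor (mv 2) (mv 4))),
    ([], piff (pxor (pxor (mv 1) (mv 2)) (pxor (mv 3) (mv 4)))
              (pxor (pxor (mv 1) (mv 3)) (pxor (mv 2) (mv 4)))),
    ([], piff (PAnd (mv 1) (pxor (mv 2) (mv 3)))
              (pxor (PAnd (mv 1) (mv 2)) (PAnd (mv 1) (mv 3)))),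
    ([], piff (PAnd (pxor (mv 1) (mv 2)) (mv 3))
              (pxor (PAnd (mv 1) (mv 3)) (PAnd (mv 2) (mv 3)))),
    ([], piff (PAnd (mv 1) (PAnd (mv 2) (mv 3))) (PAnd (PAnd (mv 1) (mv 2)) (mv 3))),
    ([], piff (pxor PFalse (mv 1)) (mv 1)),
    ([], piff (pxor (mv 1) PFalse) (mv 1)),
    ([], piff (pxor (mv 1) (mv 1)) PFalse),
    ([], piff (PAnd (mv 1) PFalse) PFalse),
    ([], piff (PAnd PFalse (mv 1)) PFalse),
    ([], piff (PAnd PTrue (mv 1)) (mv 1)),
    ([], piff (pxor (pxor (mv 1) (mv 2)) (pxor (mv 2) (mv 3))) (pxor (mv 1) (mv 3))),
    ([piff (pxor (mv 1) (mv 2)) (mv 3)], piff (mv 1) (pxor (mv 3) (mv 2)))]"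

text \<open>The first schema, once lifted, reads \<open>PImp h h\<close> and so provides the
  hypothesis itself; it is the only one that mentions variable \<open>0\<close>.\<close>

definition clause_rules :: "frule list" where
  "clause_rules =
   [([], mv 0),
    ([PAnd (mv 1) (mv 2)], mv 1),
    ([PAnd (mv 1) (mv 2)], mv 2),
    ([], piff (PAnd (pxor PTrue (mv 1)) (mv 1)) PFalse),
    ([], piff (PAnd (mv 1) (PNot (mv 1))) PFalse),
    ([piff (PAnd (mv 1) (mv 3)) PFalse], piff (PAnd (PAnd (mv 1) (mv 2)) (mv 3)) PFalse),
    ([piff (PAnd (mv 2) (mv 3)) PFalse], piff (PAnd (PAnd (mv 1) (mv 2)) (mv 3)) PFalse),
    ([piff (PAnd (mv 1) (mv 2)) PFalse, piff (PAnd (mv 1) (mv 3)) PFalse],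
       piff (PAnd (mv 1) (POr (mv 2) (mv 3))) PFalse),
    ([piff (PAnd (mv 1) (mv 2)) PFalse, mv 2], piff (mv 1) PFalse),
    ([], piff (PAnd (mv 1) (pxor PTrue (mv 1))) PFalse),
    ([], piff (pxor (PAnd (mv 1) (mv 2)) (PAnd (mv 2) (mv 1))) PFalse)]"

lemma sound_lifted_rules:
  "r \<in> lift_rule ` set (ring_rules @ clause_rules) \<Longrightarrow> sound_rule r"
  unfolding ring_rules_def clause_rules_def by (auto simp: lift_rule_def sound_rule_def)

text \<open>The default \<open>PTrue\<close> has size 1, so variables outside the list never violate
  the bound \<open>m\<close> on substituted formulas.\<close>

definition vals :: "pform list \<Rightarrow> nat \<Rightarrow> pform" where
  "vals fs i = (if i < length fs then fs ! i else PTrue)"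

section \<open>Derivations under a hypothesis, counted in schema applications\<close>

locale short_derivations =
  fixes R :: "frule set" and C m :: nat and h :: pform
  assumes C_pos: "C > 0"
    and simulation: "\<And>r \<sigma>. r \<in> lift_rule ` set (ring_rules @ clause_rules) \<Longrightarrow>
      (\<forall>i. psize (\<sigma> i) \<le> m) \<Longrightarrow>
      \<exists>ls. derivation R (psubst \<sigma> ` set (fst r)) ls \<and> psubst \<sigma> (snd r) \<in> set ls \<and>
          length ls \<le> C \<and> (\<forall>l\<in>set ls. psize l \<le> C * m)"
    and h_size: "psize h \<le> m"
begin

lemma m_pos: "1 \<le> m"
  using h_size psize_pos[of h] by linarith

text \<open>The sets \<open>\<Gamma>\<close> and \<open>\<Delta>\<close> hold facts without the
  prefix \<open>PImp h\<close>, and \<open>L\<close> counts applications of lifted schemas, each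
  worth at most \<open>C\<close> lines. Since every line is bounded by \<open>C * m\<close>, costs
  simply add up and line sizes never have to be summed.\<close>

definition ext :: "pform set \<Rightarrow> nat \<Rightarrow> pform set \<Rightarrow> bool" where
  "ext \<Gamma> L \<Delta> \<longleftrightarrow> (\<exists>ls. derivation R (PImp h ` \<Gamma>) ls \<and> length ls \<le> C * L \<and>
     (\<forall>l\<in>set ls. psize l \<le> C * m) \<and> PImp h ` \<Delta> \<subseteq> PImp h ` \<Gamma> \<union> set ls)"

lemma ext_subset: "\<Delta> \<subseteq> \<Gamma> \<Longrightarrow> ext \<Gamma> L \<Delta>"
  unfolding ext_def by (intro exI[of _ "[]"]) auto

lemma ext_mono:
  assumes "ext \<Gamma> L \<Delta>" "\<Gamma> \<subseteq> \<Gamma>'" "L \<le> L'" "\<Delta>' \<subseteq> \<Delta>"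
  shows "ext \<Gamma>' L' \<Delta>'"
proof -
  obtain ls where ls: "derivation R (PImp h ` \<Gamma>) ls" "length ls \<le> C * L"
     "\<forall>l\<in>set ls. psize l \<le> C * m" "PImp h ` \<Delta> \<subseteq> PImp h ` \<Gamma> \<union> set ls"
    using assms(1) unfolding ext_def by blast
  have "derivation R (PImp h ` \<Gamma>') ls"
    using ls(1) assms(2) by (meson derivation_mono image_mono)
  moreover have "length ls \<le> C * L'"
    using ls(2) assms(3) by (meson mult_le_mono2 order_trans)
  moreover have "PImp h ` \<Delta>' \<subseteq> PImp h ` \<Gamma>' \<union> set ls"
    using ls(4) assms(2,4) by blast
  ultimately show ?thesis using ls(3) unfolding ext_def by blast
qed

lemma ext_trans:
  assumes "ext \<Gamma> L \<Delta>" "ext (\<Gamma> \<union> \<Delta>) L' \<Theta>"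
  shows "ext \<Gamma> (L + L') \<Theta>"
proof -
  obtain ls where ls: "derivation R (PImp h ` \<Gamma>) ls" "length ls \<le> C * L"
     "\<forall>l\<in>set ls. psize l \<le> C * m" "PImp h ` \<Delta> \<subseteq> PImp h ` \<Gamma> \<union> set ls"
    using assms(1) unfolding ext_def by blast
  obtain ls' where ls': "derivation R (PImp h ` (\<Gamma> \<union> \<Delta>)) ls'" "length ls' \<le> C * L'"
     "\<forall>l\<in>set ls'. psize l \<le> C * m" "PImp h ` \<Theta> \<subseteq> PImp h ` (\<Gamma> \<union> \<Delta>) \<union> set ls'"
    using assms(2) unfolding ext_def by blast
  have "derivation R (PImp h ` \<Gamma> \<union> set ls) ls'"
    using ls'(1) by (rule derivation_mono) (use ls(4) in auto)
  then have "derivation R (PImp h ` \<Gamma>) (ls @ ls')"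
    using ls(1) derivation_append by blast
  moreover have "PImp h ` \<Theta> \<subseteq> PImp h ` \<Gamma> \<union> set (ls @ ls')"
    using ls(4) ls'(4) unfolding image_Un set_append by blast
  moreover have "\<forall>l\<in>set (ls @ ls'). psize l \<le> C * m"
    using ls(3) ls'(3) by auto
  moreover have "length (ls @ ls') \<le> C * (L + L')"
    using ls(2) ls'(2) by (simp add: algebra_simps)
  ultimately show ?thesis unfolding ext_def by blast
qed

lemma ext_Un:
  assumes "ext \<Gamma> L \<Delta>" "ext (\<Gamma> \<union> \<Delta>) L' \<Delta>'"
  shows "ext \<Gamma> (L + L') (\<Delta> \<union> \<Delta>')"
proof -
  obtain ls' where ls': "derivation R (PImp h ` (\<Gamma> \<union> \<Delta>)) ls'" "length ls' \<le> C * L'"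
     "\<forall>l\<in>set ls'. psize l \<le> C * m" "PImp h ` \<Delta>' \<subseteq> PImp h ` (\<Gamma> \<union> \<Delta>) \<union> set ls'"
    using assms(2) unfolding ext_def by blast
  then have "ext (\<Gamma> \<union> \<Delta>) L' (\<Delta> \<union> \<Delta>')"
    unfolding ext_def by (intro exI[of _ ls']) auto
  then show ?thesis by (rule ext_trans[OF assms(1)])
qed

lemma ext_family:
  assumes "finite I" "\<And>i. i \<in> I \<Longrightarrow> ext \<Gamma> L {f i}"
  shows "ext \<Gamma> (card I * L) (f ` I)"
  using assms
proof (induction I)
  case empty
  then show ?case by (simp add: ext_subset)
next
  case (insert i I)
  then have "ext \<Gamma> (card I * L) (f ` I)" "ext \<Gamma> L {f i}" by auto
  then have "ext \<Gamma> (card I * L + L) (f ` I \<union> {f i})"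
    by (blast intro: ext_Un ext_mono)
  then show ?case using insert by (simp add: algebra_simps)
qed

lemma ext_rule:
  assumes r: "r \<in> set (ring_rules @ clause_rules)"
    and s: "list_all (\<lambda>f. psize f \<le> m) fs"
    and prems: "psubst (vals (h # fs)) ` set (fst r) \<subseteq> \<Gamma>"
  shows "ext \<Gamma> 1 {psubst (vals (h # fs)) (snd r)}"
proof -
  have "\<forall>i. psize (vals (h # fs) i) \<le> m"
    using s h_size m_pos by (auto simp: vals_def nth_Cons' list_all_length)
  from simulation[OF imageI[OF r] this] obtain ls where
    ls: "derivation R (psubst (vals (h # fs)) ` set (fst (lift_rule r))) ls"
      "psubst (vals (h # fs)) (snd (lift_rule r)) \<in> set ls"
      "length ls \<le> C" "\<forall>l\<in>set ls. psize l \<le> C * m" by blast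
  have "psubst (vals (h # fs)) ` set (fst (lift_rule r)) \<subseteq> PImp h ` \<Gamma>"
    using prems by (auto simp: lift_rule_def vals_def)
  then have "derivation R (PImp h ` \<Gamma>) ls"
    using ls(1) derivation_mono by blast
  then show ?thesis
    using ls(2-4) unfolding ext_def
    by (intro exI[of _ ls]) (auto simp: lift_rule_def vals_def)
qed

section \<open>Single facts and provable equivalence\<close>

definition pr :: "pform set \<Rightarrow> nat \<Rightarrow> pform \<Rightarrow> bool" where
  "pr \<Gamma> L f \<longleftrightarrow> ext \<Gamma> L {f}"

lemma pr_mono: "pr \<Gamma> L f \<Longrightarrow> \<Gamma> \<subseteq> \<Gamma>' \<Longrightarrow> L \<le> L' \<Longrightarrow> pr \<Gamma>' L' f"
  unfolding pr_def by (blast intro: ext_mono)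

lemma pr_member: "f \<in> \<Gamma> \<Longrightarrow> pr \<Gamma> L f"
  unfolding pr_def by (auto intro: ext_subset)

lemma pr_rule0:
  assumes "([], c) \<in> set (ring_rules @ clause_rules)" "list_all (\<lambda>f. psize f \<le> m) fs"
  shows "pr \<Gamma> 1 (psubst (vals (h # fs)) c)"
  using ext_rule[OF assms(1), of fs \<Gamma>] assms(2) unfolding pr_def by simp

lemma pr_rule1:
  assumes "([p], c) \<in> set (ring_rules @ clause_rules)" "list_all (\<lambda>f. psize f \<le> m) fs"
    and "pr \<Gamma> L (psubst (vals (h # fs)) p)"
  shows "pr \<Gamma> (L + 1) (psubst (vals (h # fs)) c)"
  using assms(3) ext_rule[OF assms(1), of fs "\<Gamma> \<union> {psubst (vals (h # fs)) p}"] assms(2)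
  unfolding pr_def fst_conv snd_conv by (intro ext_trans[of _ L]) auto

lemma pr_rule2:
  assumes "([p, q], c) \<in> set (ring_rules @ clause_rules)" "list_all (\<lambda>f. psize f \<le> m) fs"
    and "pr \<Gamma> L (psubst (vals (h # fs)) p)" "pr \<Gamma> L' (psubst (vals (h # fs)) q)"
  shows "pr \<Gamma> (L + L' + 1) (psubst (vals (h # fs)) c)"
proof -
  have "ext (\<Gamma> \<union> {psubst (vals (h # fs)) p}) L' {psubst (vals (h # fs)) q}"
    using assms(4) unfolding pr_def by (blast intro: ext_mono)
  then have "ext \<Gamma> (L + L') ({psubst (vals (h # fs)) p} \<union> {psubst (vals (h # fs)) q})"
    using assms(3) unfolding pr_def by (blast intro: ext_Un)
  then show ?thesis
    using ext_rule[OF assms(1), of fs "\<Gamma> \<union> ({psubst (vals (h # fs)) p} \<union> {psubst (vals (h # fs)) q})"]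
      assms(2) unfolding pr_def fst_conv snd_conv by (intro ext_trans[of _ "L + L'"]) auto
qed

text \<open>The size bounds are part of the relation so that transitivity needs no side condition on
  the middle formula.\<close>

definition eqv :: "pform set \<Rightarrow> nat \<Rightarrow> pform \<Rightarrow> pform \<Rightarrow> bool" where
  "eqv \<Gamma> L a b \<longleftrightarrow> pr \<Gamma> L (piff a b) \<and> psize a \<le> m \<and> psize b \<le> m"

lemma eqv_mono: "eqv \<Gamma> L a b \<Longrightarrow> \<Gamma> \<subseteq> \<Gamma>' \<Longrightarrow> L \<le> L' \<Longrightarrow> eqv \<Gamma>' L' a b"
  unfolding eqv_def by (blast intro: pr_mono)

lemma eqv_le: "eqv \<Gamma> L a b \<Longrightarrow> L \<le> L' \<Longrightarrow> eqv \<Gamma> L' a b"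
  by (rule eqv_mono) auto

lemma eqv_member: "piff a b \<in> \<Gamma> \<Longrightarrow> psize a \<le> m \<Longrightarrow> psize b \<le> m \<Longrightarrow> eqv \<Gamma> L a b"
  unfolding eqv_def by (blast intro: pr_member)

lemma eqv_size: assumes "eqv \<Gamma> L a b" shows "psize a \<le> m" "psize b \<le> m"
  using assms by (auto simp: eqv_def)

lemma eqv_refl: "psize a \<le> m \<Longrightarrow> 1 \<le> L \<Longrightarrow> eqv \<Gamma> L a a"
  unfolding eqv_def
  using pr_rule0[of "piff (mv 1) (mv 1)" "[a]" \<Gamma>]
  by (auto simp: ring_rules_def vals_def elim!: pr_mono)

lemma eqv_sym: "eqv \<Gamma> L a b \<Longrightarrow> eqv \<Gamma> (L + 1) b a"
  unfolding eqv_def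
  using pr_rule1[of "piff (mv 1) (mv 2)" "piff (mv 2) (mv 1)" "[a, b]" \<Gamma> L]
  by (auto simp: ring_rules_def vals_def)

lemma eqv_trans: "eqv \<Gamma> L a b \<Longrightarrow> eqv \<Gamma> L' b c \<Longrightarrow> eqv \<Gamma> (L + L' + 1) a c"
  unfolding eqv_def
  using pr_rule2[of "piff (mv 1) (mv 2)" "piff (mv 2) (mv 3)" "piff (mv 1) (mv 3)" "[a, b, c]" \<Gamma> L L']
  by (auto simp: ring_rules_def vals_def)

lemma eqv_PAnd:
  "eqv \<Gamma> L a b \<Longrightarrow> eqv \<Gamma> L' c d \<Longrightarrow> psize (PAnd a c) \<le> m \<Longrightarrow> psize (PAnd b d) \<le> m \<Longrightarrow>
    eqv \<Gamma> (L + L' + 1) (PAnd a c) (PAnd b d)"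
  unfolding eqv_def
  using pr_rule2[of "piff (mv 1) (mv 2)" "piff (mv 3) (mv 4)"
      "piff (PAnd (mv 1) (mv 3)) (PAnd (mv 2) (mv 4))" "[a, b, c, d]" \<Gamma> L L']
  by (auto simp: ring_rules_def vals_def)

lemma eqv_pxor:
  "eqv \<Gamma> L a b \<Longrightarrow> eqv \<Gamma> L' c d \<Longrightarrow> psize (pxor a c) \<le> m \<Longrightarrow> psize (pxor b d) \<le> m \<Longrightarrow>
    eqv \<Gamma> (L + L' + 1) (pxor a c) (pxor b d)"
  unfolding eqv_def
  using pr_rule2[of "piff (mv 1) (mv 2)" "piff (mv 3) (mv 4)"
      "piff (pxor (mv 1) (mv 3)) (pxor (mv 2) (mv 4))" "[a, b, c, d]" \<Gamma> L L']
  by (auto simp: ring_rules_def vals_def)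

lemma eqv_medial:
  "psize (pxor (pxor a b) (pxor c d)) \<le> m \<Longrightarrow>
    eqv \<Gamma> 1 (pxor (pxor a b) (pxor c d)) (pxor (pxor a c) (pxor b d))"
  unfolding eqv_def
  using pr_rule0[of "piff (pxor (pxor (mv 1) (mv 2)) (pxor (mv 3) (mv 4)))
              (pxor (pxor (mv 1) (mv 3)) (pxor (mv 2) (mv 4)))" "[a, b, c, d]" \<Gamma>]
  by (auto simp: ring_rules_def vals_def)

lemma eqv_distrib_left:
  "psize (pxor (PAnd a b) (PAnd a c)) \<le> m \<Longrightarrow>
    eqv \<Gamma> 1 (PAnd a (pxor b c)) (pxor (PAnd a b) (PAnd a c))"
  unfolding eqv_def
  using pr_rule0[of "piff (PAnd (mv 1) (pxor (mv 2) (mv 3)))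
              (pxor (PAnd (mv 1) (mv 2)) (PAnd (mv 1) (mv 3)))" "[a, b, c]" \<Gamma>]
  by (auto simp: ring_rules_def vals_def)

lemma eqv_distrib_right:
  "psize (pxor (PAnd a c) (PAnd b c)) \<le> m \<Longrightarrow>
    eqv \<Gamma> 1 (PAnd (pxor a b) c) (pxor (PAnd a c) (PAnd b c))"
  unfolding eqv_def
  using pr_rule0[of "piff (PAnd (pxor (mv 1) (mv 2)) (mv 3))
              (pxor (PAnd (mv 1) (mv 3)) (PAnd (mv 2) (mv 3)))" "[a, b, c]" \<Gamma>]
  by (auto simp: ring_rules_def vals_def)

lemma eqv_PAnd_assoc:
  "psize (PAnd a (PAnd b c)) \<le> m \<Longrightarrow> eqv \<Gamma> 1 (PAnd a (PAnd b c)) (PAnd (PAnd a b) c)"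
  unfolding eqv_def
  using pr_rule0[of "piff (PAnd (mv 1) (PAnd (mv 2) (mv 3))) (PAnd (PAnd (mv 1) (mv 2)) (mv 3))"
      "[a, b, c]" \<Gamma>]
  by (auto simp: ring_rules_def vals_def)

lemma eqv_pxor_False:
  assumes "psize (pxor PFalse a) \<le> m"
  shows "eqv \<Gamma> 1 (pxor PFalse a) a" "eqv \<Gamma> 1 (pxor a PFalse) a"
  unfolding eqv_def using assms
    pr_rule0[of "piff (pxor PFalse (mv 1)) (mv 1)" "[a]" \<Gamma>]
    pr_rule0[of "piff (pxor (mv 1) PFalse) (mv 1)" "[a]" \<Gamma>]
  by (auto simp: ring_rules_def vals_def)

lemma eqv_pxor_self: "psize (pxor a a) \<le> m \<Longrightarrow> eqv \<Gamma> 1 (pxor a a) PFalse"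
  unfolding eqv_def
  using pr_rule0[of "piff (pxor (mv 1) (mv 1)) PFalse" "[a]" \<Gamma>]
  by (auto simp: ring_rules_def vals_def)

lemma eqv_PAnd_False:
  assumes "psize (PAnd PFalse a) \<le> m"
  shows "eqv \<Gamma> 1 (PAnd PFalse a) PFalse" "eqv \<Gamma> 1 (PAnd a PFalse) PFalse"
  unfolding eqv_def using assms
    pr_rule0[of "piff (PAnd PFalse (mv 1)) PFalse" "[a]" \<Gamma>]
    pr_rule0[of "piff (PAnd (mv 1) PFalse) PFalse" "[a]" \<Gamma>]
  by (auto simp: ring_rules_def vals_def)

lemma eqv_PAnd_True: "psize (PAnd PTrue a) \<le> m \<Longrightarrow> eqv \<Gamma> 1 (PAnd PTrue a) a"
  unfolding eqv_def
  using pr_rule0[of "piff (PAnd PTrue (mv 1)) (mv 1)" "[a]" \<Gamma>]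
  by (auto simp: ring_rules_def vals_def)

text \<open>This is characteristic two at work: the mixed terms of \<open>(I + A)(I + A)\<close> in
  \<open>eqv_solv\<close> disappear by this rule.\<close>

lemma eqv_pxor_cancel:
  "psize (pxor (pxor a b) (pxor b c)) \<le> m \<Longrightarrow>
    eqv \<Gamma> 1 (pxor (pxor a b) (pxor b c)) (pxor a c)"
  unfolding eqv_def
  using pr_rule0[of "piff (pxor (pxor (mv 1) (mv 2)) (pxor (mv 2) (mv 3))) (pxor (mv 1) (mv 3))"
      "[a, b, c]" \<Gamma>]
  by (auto simp: ring_rules_def vals_def)

lemma eqv_pxor_move:
  "eqv \<Gamma> L (pxor a b) c \<Longrightarrow> psize (pxor c b) \<le> m \<Longrightarrow> eqv \<Gamma> (L + 1) a (pxor c b)"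
  unfolding eqv_def
  using pr_rule1[of "piff (pxor (mv 1) (mv 2)) (mv 3)" "piff (mv 1) (pxor (mv 3) (mv 2))"
      "[a, b, c]" \<Gamma> L]
  by (auto simp: ring_rules_def vals_def)

end

section \<open>Balanced exclusive-or trees\<close>

text \<open>A balanced tree over the leaves \<open>0, ..., 2 ^ k - 1\<close>. Since
  \<open>pxor\<close> doubles both arguments, a chain of that many summands would grow by a factor
  \<open>2 ^ (2 ^ k)\<close>, whereas the balanced tree grows by \<open>4 ^ k\<close>.\<close>

fun bx :: "nat \<Rightarrow> (nat \<Rightarrow> pform) \<Rightarrow> pform" where
  "bx 0 f = f 0"
| "bx (Suc k) f = pxor (bx k f) (bx k (\<lambda>i. f (i + 2 ^ k)))"

text \<open>The summand 2 absorbs the constant of \<open>pxor\<close>: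
  \<open>2 * x + 2 * y + 5 + 2\<close> is at most \<open>2 * (x + 2) + 2 * (y + 2)\<close>, so one
  level costs exactly a factor 4.\<close>

lemma psize_bx:
  assumes "\<And>i. i < 2 ^ k \<Longrightarrow> psize (f i) + 2 \<le> s"
  shows "psize (bx k f) + 2 \<le> 4 ^ k * s"
  using assms
proof (induction k arbitrary: f)
  case (Suc k)
  have "psize (bx k f) + 2 \<le> 4 ^ k * s" "psize (bx k (\<lambda>i. f (i + 2 ^ k))) + 2 \<le> 4 ^ k * s"
    by (rule Suc.IH, rule Suc.prems, simp)+
  then show ?case by simp
qed simp

lemma psize_le_bx: "i < 2 ^ k \<Longrightarrow> psize (f i) \<le> psize (bx k f)"
proof (induction k arbitrary: f i)
  case (Suc k)
  show ?case
  proof (cases "i < 2 ^ k")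
    case True
    then show ?thesis using Suc.IH[of i f] by simp
  next
    case False
    then have "i - 2 ^ k < 2 ^ k" using Suc.prems by simp
    from Suc.IH[OF this, of "\<lambda>i. f (i + 2 ^ k)"] False show ?thesis by simp
  qed
qed simp

lemma bx_cong: "(\<And>i. i < 2 ^ k \<Longrightarrow> f i = g i) \<Longrightarrow> bx k f = bx k g"
proof (induction k arbitrary: f g)
  case (Suc k)
  have "bx k f = bx k g" "bx k (\<lambda>i. f (i + 2 ^ k)) = bx k (\<lambda>i. g (i + 2 ^ k))"
    by (rule Suc.IH, rule Suc.prems, simp)+
  then show ?case by simp
qed simp

lemma sum_lessThan_double:
  fixes f :: "nat \<Rightarrow> 'b::comm_monoid_add"
  shows "(\<Sum>i<2 ^ Suc k. f i) = (\<Sum>i<2 ^ k. f i) + (\<Sum>i<2 ^ k. f (i + 2 ^ k))"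
proof -
  have "{..<2 ^ Suc k} = {0..<2 ^ k + 2 ^ k :: nat}" by auto
  moreover have "sum f {0..<2 ^ k + 2 ^ k} = sum f {0..<2 ^ k} + sum f {2 ^ k..<2 ^ k + 2 ^ k}"
    by (rule sum.atLeastLessThan_concat[symmetric]) auto
  moreover have "sum f {2 ^ k..<2 ^ k + 2 ^ k} = (\<Sum>i<2 ^ k. f (i + 2 ^ k))"
    using sum.shift_bounds_nat_ivl[of f 0 "2 ^ k" "2 ^ k"] by (simp add: atLeast0LessThan)
  ultimately show ?thesis by (simp only: atLeast0LessThan)
qed

text \<open>The cost of an argument that spends \<open>l\<close> at each leaf and \<open>d\<close>
  at each inner node of a balanced tree, that is \<open>2 ^ k * l + (2 ^ k - 1) * d\<close>.\<close>

fun tcost :: "nat \<Rightarrow> nat \<Rightarrow> nat \<Rightarrow> nat" where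
  "tcost l d 0 = l"
| "tcost l d (Suc k) = 2 * tcost l d k + d"

lemma tcost_le: "tcost l d k + d \<le> 2 ^ k * (l + d)"
  by (induction k) auto

context short_derivations
begin

lemma eqv_bx_cong:
  assumes "\<And>i. i < 2 ^ k \<Longrightarrow> eqv \<Gamma> l (f i) (g i)" "psize (bx k f) \<le> m" "psize (bx k g) \<le> m"
  shows "eqv \<Gamma> (tcost l 1 k) (bx k f) (bx k g)"
  using assms
proof (induction k arbitrary: f g)
  case (Suc k)
  have "eqv \<Gamma> (tcost l 1 k) (bx k f) (bx k g)"
       "eqv \<Gamma> (tcost l 1 k) (bx k (\<lambda>i. f (i + 2 ^ k))) (bx k (\<lambda>i. g (i + 2 ^ k)))"
    by (rule Suc.IH; use Suc.prems in simp)+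
  from eqv_pxor[OF this] show ?case
    using Suc.prems(2,3) by (auto elim!: eqv_le)
qed simp

text \<open>One application of the interchange law per inner node merges two trees of the same
  shape, so no rebalancing or general reordering of summands is needed.\<close>

lemma eqv_bx_pxor:
  assumes "psize (bx k (\<lambda>i. pxor (f i) (g i))) \<le> m" "psize (pxor (bx k f) (bx k g)) \<le> m"
  shows "eqv \<Gamma> (tcost 1 4 k) (bx k (\<lambda>i. pxor (f i) (g i))) (pxor (bx k f) (bx k g))"
  using assms
proof (induction k arbitrary: f g)
  case 0
  then show ?case by (simp add: eqv_refl)
next
  case (Suc k)
  have "eqv \<Gamma> (tcost 1 4 k) (bx k (\<lambda>i. pxor (f i) (g i))) (pxor (bx k f) (bx k g))"
    "eqv \<Gamma> (tcost 1 4 k) (bx k (\<lambda>i. pxor (f (i + 2 ^ k)) (g (i + 2 ^ k))))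
      (pxor (bx k (\<lambda>i. f (i + 2 ^ k))) (bx k (\<lambda>i. g (i + 2 ^ k))))"
    by (rule Suc.IH; use Suc.prems in simp)+
  from eqv_trans[OF eqv_pxor[OF this] eqv_medial] show ?case
    using Suc.prems by (auto elim!: eqv_le)
qed

lemma eqv_bx_PAnd_left:
  assumes "psize (bx k (\<lambda>i. PAnd a (f i))) \<le> m"
  shows "eqv \<Gamma> (tcost 1 4 k) (bx k (\<lambda>i. PAnd a (f i))) (PAnd a (bx k f))"
proof -
  \<comment> \<open>Pulling the common factor out does not increase the size, so a bound on the
    expanded tree also covers all intermediate forms.\<close>
  have *: "psize (PAnd a (bx k f)) \<le> psize (bx k (\<lambda>i. PAnd a (f i)))" for k f
  proof (induction k arbitrary: f)
    case (Suc k)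
    show ?case using Suc.IH[of f] Suc.IH[of "\<lambda>i. f (i + 2 ^ k)"] by simp
  qed simp
  show ?thesis using assms
  proof (induction k arbitrary: f)
    case 0
    then show ?case by (simp add: eqv_refl)
  next
    case (Suc k)
    have IH: "eqv \<Gamma> (tcost 1 4 k) (bx k (\<lambda>i. PAnd a (f i))) (PAnd a (bx k f))"
      "eqv \<Gamma> (tcost 1 4 k) (bx k (\<lambda>i. PAnd a (f (i + 2 ^ k)))) (PAnd a (bx k (\<lambda>i. f (i + 2 ^ k))))"
      by (rule Suc.IH; use Suc.prems in simp)+
    have s: "psize (pxor (PAnd a (bx k f)) (PAnd a (bx k (\<lambda>i. f (i + 2 ^ k))))) \<le> m"
      using *[of k f] *[of k "\<lambda>i. f (i + 2 ^ k)"] Suc.prems by simp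
    from Suc.prems have "eqv \<Gamma> (tcost 1 4 k + (tcost 1 4 k) + 1 + (1 + 1) + 1)
       (bx (Suc k) (\<lambda>i. PAnd a (f i))) (PAnd a (bx (Suc k) f))"
      unfolding bx.simps by (intro eqv_trans[OF eqv_pxor[OF IH] eqv_sym[OF eqv_distrib_left]] s) simp_all
    then show ?case by (rule eqv_le) auto
  qed
qed

lemma eqv_bx_PAnd_right:
  assumes "psize (bx k (\<lambda>i. PAnd (f i) a)) \<le> m"
  shows "eqv \<Gamma> (tcost 1 4 k) (bx k (\<lambda>i. PAnd (f i) a)) (PAnd (bx k f) a)"
proof -
  have *: "psize (PAnd (bx k f) a) \<le> psize (bx k (\<lambda>i. PAnd (f i) a))" for k f
  proof (induction k arbitrary: f)
    case (Suc k)
    show ?case using Suc.IH[of f] Suc.IH[of "\<lambda>i. f (i + 2 ^ k)"] by simp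
  qed simp
  show ?thesis using assms
  proof (induction k arbitrary: f)
    case 0
    then show ?case by (simp add: eqv_refl)
  next
    case (Suc k)
    have IH: "eqv \<Gamma> (tcost 1 4 k) (bx k (\<lambda>i. PAnd (f i) a)) (PAnd (bx k f) a)"
      "eqv \<Gamma> (tcost 1 4 k) (bx k (\<lambda>i. PAnd (f (i + 2 ^ k)) a)) (PAnd (bx k (\<lambda>i. f (i + 2 ^ k))) a)"
      by (rule Suc.IH; use Suc.prems in simp)+
    have s: "psize (pxor (PAnd (bx k f) a) (PAnd (bx k (\<lambda>i. f (i + 2 ^ k))) a)) \<le> m"
      using *[of k f] *[of k "\<lambda>i. f (i + 2 ^ k)"] Suc.prems by simp
    from Suc.prems have "eqv \<Gamma> (tcost 1 4 k + (tcost 1 4 k) + 1 + (1 + 1) + 1)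
       (bx (Suc k) (\<lambda>i. PAnd (f i) a)) (PAnd (bx (Suc k) f) a)"
      unfolding bx.simps by (intro eqv_trans[OF eqv_pxor[OF IH] eqv_sym[OF eqv_distrib_right]] s) simp_all
    then show ?case by (rule eqv_le) auto
  qed
qed

lemma eqv_bx_False:
  assumes "psize (bx k (\<lambda>i. PFalse)) \<le> m"
  shows "eqv \<Gamma> (tcost 1 4 k) (bx k (\<lambda>i. PFalse)) PFalse"
  using assms
proof (induction k)
  case 0
  then show ?case by (simp add: eqv_refl)
next
  case (Suc k)
  have IH: "eqv \<Gamma> (tcost 1 4 k) (bx k (\<lambda>i. PFalse)) PFalse"
    by (rule Suc.IH) (use Suc.prems in simp)
  have s: "9 \<le> m" using Suc.prems psize_pos[of "bx k (\<lambda>i. PFalse)"] by simp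
  from eqv_trans[OF eqv_pxor[OF IH IH] eqv_pxor_False(1)] show ?case
    using Suc.prems s by (auto elim!: eqv_le)
qed

lemma eqv_bx_single:
  assumes "psize (bx k (\<lambda>i. if i = j then a else PFalse)) \<le> m" "j < 2 ^ k"
  shows "eqv \<Gamma> (tcost 1 4 k) (bx k (\<lambda>i. if i = j then a else PFalse)) a"
  using assms
proof (induction k arbitrary: j)
  case 0
  then show ?case by (simp add: eqv_refl)
next
  case (Suc k)
  let ?l = "bx k (\<lambda>i. if i = j then a else PFalse)"
  let ?r = "bx k (\<lambda>i. if i + 2 ^ k = j then a else PFalse)"
  have sz: "2 * psize ?l + 2 * psize ?r + 5 \<le> m"
    using Suc.prems(1) by simp
  show ?case
  proof (cases "j < 2 ^ k")
    case True
    then have r: "?r = bx k (\<lambda>i. PFalse)" by (intro bx_cong) auto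
    have l: "eqv \<Gamma> (tcost 1 4 k) ?l a" by (rule Suc.IH) (use sz True in auto)
    have f: "eqv \<Gamma> (tcost 1 4 k) ?r PFalse" unfolding r
      by (rule eqv_bx_False) (use sz r in auto)
    have "psize a \<le> psize ?l"
      using psize_le_bx[OF True, of "\<lambda>i. if i = j then a else PFalse"] by simp
    then have "eqv \<Gamma> (tcost 1 4 k + (tcost 1 4 k) + 1 + 1 + 1) (pxor ?l ?r) a"
      by (intro eqv_trans[OF eqv_pxor[OF l f] eqv_pxor_False(2)])
        (use sz psize_pos[of ?r] in auto)
    then show ?thesis by (auto elim!: eqv_le)
  next
    case False
    then have l: "?l = bx k (\<lambda>i. PFalse)" by (intro bx_cong) auto
    have eq: "?r = bx k (\<lambda>i. if i = j - 2 ^ k then a else PFalse)"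
      using False by (intro bx_cong) auto
    have j: "j - 2 ^ k < 2 ^ k" using False Suc.prems(2) by auto
    have r: "eqv \<Gamma> (tcost 1 4 k) ?r a" unfolding eq
      by (rule Suc.IH) (use sz eq j in auto)
    have f: "eqv \<Gamma> (tcost 1 4 k) ?l PFalse" unfolding l
      by (rule eqv_bx_False) (use sz l in auto)
    have "psize a \<le> psize ?r"
      using psize_le_bx[OF j, of "\<lambda>i. if i = j - 2 ^ k then a else PFalse"] eq by simp
    then have "eqv \<Gamma> (tcost 1 4 k + (tcost 1 4 k) + 1 + 1 + 1) (pxor ?l ?r) a"
      by (intro eqv_trans[OF eqv_pxor[OF f r] eqv_pxor_False(1)])
        (use sz psize_pos[of ?l] in auto)
    then show ?thesis by (auto elim!: eqv_le)
  qed
qed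

text \<open>Exchange of two finite sums by induction on the outer tree; each outer node is paid for
  by one merge of two inner trees of depth \<open>l\<close>.\<close>

lemma eqv_bx_swap:
  assumes "psize (bx k (\<lambda>i. bx l (f i))) \<le> m"
    and "psize (bx l (\<lambda>j. bx k (\<lambda>i. f i j))) \<le> m"
  shows "eqv \<Gamma> (tcost 1 (tcost 1 4 l + 3) k)
    (bx k (\<lambda>i. bx l (f i))) (bx l (\<lambda>j. bx k (\<lambda>i. f i j)))"
  using assms
proof (induction k arbitrary: f)
  case 0
  then show ?case by (simp add: eqv_refl)
next
  case (Suc k)
  let ?a = "bx l (\<lambda>j. bx k (\<lambda>i. f i j))"
  let ?b = "bx l (\<lambda>j. bx k (\<lambda>i. f (i + 2 ^ k) j))"
  have size: "psize (pxor (bx l F) (bx l G)) \<le> psize (bx l (\<lambda>j. pxor (F j) (G j)))" for F G l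
  proof (induction l arbitrary: F G)
    case (Suc l)
    show ?case using Suc.IH[of F G] Suc.IH[of "\<lambda>j. F (j + 2 ^ l)" "\<lambda>j. G (j + 2 ^ l)"] by simp
  qed simp
  have s: "psize (pxor ?a ?b) \<le> m"
    using order_trans[OF size Suc.prems(2)[unfolded bx.simps]] .
  have IH: "eqv \<Gamma> (tcost 1 (tcost 1 4 l + 3) k) (bx k (\<lambda>i. bx l (f i))) ?a"
     "eqv \<Gamma> (tcost 1 (tcost 1 4 l + 3) k) (bx k (\<lambda>i. bx l (f (i + 2 ^ k)))) ?b"
    by (rule Suc.IH; use Suc.prems s in simp)+
  have "eqv \<Gamma> (tcost 1 (tcost 1 4 l + 3) k + (tcost 1 (tcost 1 4 l + 3) k) + 1
      + (tcost 1 4 l + 1) + 1) (bx (Suc k) (\<lambda>i. bx l (f i))) (bx l (\<lambda>j. bx (Suc k) (\<lambda>i. f i j)))"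
    unfolding bx.simps
    by (intro eqv_trans[OF eqv_pxor[OF IH] eqv_sym[OF eqv_bx_pxor]] s)
      (use Suc.prems in simp_all)
  then show ?case by (rule eqv_le) simp
qed

end

section \<open>Non-commutative polynomials and linear straight-line programs\<close>

declare add_bit_eq_xor [simp del] mult_bit_eq_and [simp del]

lemma bit_add_self [simp]: "(b::bit) + b = 0"
  by (cases b) simp_all

lemma nc_mul_Nil: "nc_mul p q [] = p [] * q []"
  by (simp add: nc_mul_def)

text \<open>Either the left factor contributes the empty word, or it consumes the first letter.
  Taking the left quotient by a letter thus obeys a product rule, which opens products to induction
  on the word.\<close>

lemma nc_mul_Cons: "nc_mul p q (a # w) = p [] * q (a # w) + nc_mul (\<lambda>w. p (a # w)) q w"
  unfolding nc_mul_def atLeast0AtMost length_Cons sum.atMost_Suc_shift by simp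

lemma nc_mul_scale_left: "nc_mul (\<lambda>w. c * p w) q w = c * nc_mul p q w"
  unfolding nc_mul_def by (simp add: sum_distrib_left mult.assoc)

lemma nc_mul_scale_right: "nc_mul p (\<lambda>w. c * q w) w = c * nc_mul p q w"
  unfolding nc_mul_def by (simp add: sum_distrib_left mult.left_commute)

lemma nc_mul_sum_right: "nc_mul p (\<lambda>w. \<Sum>i\<in>I. f i w) w = (\<Sum>i\<in>I. nc_mul p (f i) w)"
  unfolding nc_mul_def by (simp add: sum_distrib_left) (rule sum.swap)

lemma nc_mul_plus_left: "nc_mul (\<lambda>w. p w + q w) r w = nc_mul p r w + nc_mul q r w"
  unfolding nc_mul_def by (simp add: distrib_right sum.distrib)

lemma nc_mul_zero_left [simp]: "nc_mul (\<lambda>w. 0) q w = 0"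
  unfolding nc_mul_def by simp

lemma nc_mul_assoc: "nc_mul (nc_mul p q) r = nc_mul p (nc_mul q r)"
proof
  fix w
  show "nc_mul (nc_mul p q) r w = nc_mul p (nc_mul q r) w"
  proof (induction w arbitrary: p)
    case Nil
    then show ?case by (simp add: nc_mul_Nil mult.assoc)
  next
    case (Cons a w)
    have "(\<lambda>w. nc_mul p q (a # w)) = (\<lambda>w. p [] * q (a # w) + nc_mul (\<lambda>w. p (a # w)) q w)"
      by (simp add: nc_mul_Cons)
    then show ?case
      by (simp add: nc_mul_Cons[of "nc_mul p q"] nc_mul_Cons[of p] nc_mul_Cons[of q] nc_mul_Nil
          nc_mul_plus_left nc_mul_scale_left Cons.IH distrib_left mult.assoc add.assoc)
  qed
qed

lemma nc_mul_const: "nc_mul (nc_const c) q = (\<lambda>w. c * q w)"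
proof
  fix w show "nc_mul (nc_const c) q w = c * q w"
    by (cases w) (auto simp: nc_mul_Nil nc_mul_Cons nc_const_def)
qed

text \<open>Left multiplication by a variable only shifts words, hence can be undone. Dividing a
  relation by its first letter rests on this.\<close>

lemma nc_mul_var:
  "nc_mul (nc_var v) q w = (case w of [] \<Rightarrow> 0 | a # w' \<Rightarrow> if a = v then q w' else 0)"
proof (cases w)
  case (Cons a w')
  have "(\<lambda>w. nc_var v (a # w)) = (if a = v then nc_const 1 else (\<lambda>w. 0))"
    by (auto simp: nc_var_def nc_const_def)
  then show ?thesis using Cons by (simp add: nc_mul_Cons nc_mul_const) (simp add: nc_var_def)
qed (simp add: nc_mul_Nil nc_var_def)

section \<open>Linear combinations and their behaviour under substitution\<close>

definition comb :: "nat \<Rightarrow> (nat \<Rightarrow> bit) \<Rightarrow> (nat \<Rightarrow> 'v ncpoly) \<Rightarrow> 'v ncpoly" where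
  "comb n u p = (\<lambda>w. \<Sum>j<n. u j * p j w)"

lemma comb_cong: "(\<And>j. j < n \<Longrightarrow> p j = p' j) \<Longrightarrow> comb n u p = comb n u p'"
  by (simp add: comb_def)

lemma comb_extend:
  assumes "\<And>j. n \<le> j \<Longrightarrow> u j = 0" "n \<le> n'"
  shows "comb n' u p = comb n u p"
  unfolding comb_def using assms by (intro ext sum.mono_neutral_right) auto

lemma comb_plus: "comb n (\<lambda>j. u j + v j) p = nc_add (comb n u p) (comb n v p)"
  by (simp add: comb_def nc_add_def distrib_right sum.distrib)

lemma comb_scale: "comb n (\<lambda>j. c * u j) p = (\<lambda>w. c * comb n u p w)"
  by (simp add: comb_def sum_distrib_left mult.assoc)

lemma comb_single:
  assumes "i < n" shows "comb n (\<lambda>j. if j = i then 1 else 0) p = p i"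
proof
  fix w
  have "(\<Sum>j<n. (if j = i then 1 else 0) * p j w) = (\<Sum>j<n. if j = i then p j w else 0)"
    by (intro sum.cong) auto
  then show "comb n (\<lambda>j. if j = i then 1 else 0) p w = p i w"
    using assms by (simp add: comb_def)
qed

lemma comb_comb: "comb n u (\<lambda>i. comb k (U i) p) = comb k (\<lambda>j. \<Sum>i<n. u i * U i j) p"
proof
  fix w
  have "comb n u (\<lambda>i. comb k (U i) p) w = (\<Sum>i<n. \<Sum>j<k. u i * (U i j * p j w))"
    by (simp add: comb_def sum_distrib_left)
  also have "\<dots> = (\<Sum>j<k. \<Sum>i<n. u i * (U i j * p j w))" by (rule sum.swap)
  finally show "comb n u (\<lambda>i. comb k (U i) p) w = comb k (\<lambda>j. \<Sum>i<n. u i * U i j) p w"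
    by (simp add: comb_def sum_distrib_right mult.assoc)
qed

text \<open>\<open>nc_subst\<close> sums over the support, and a sum over an infinite set is 0 by
  convention; hence the attention to finite supports here and below.\<close>

lemma nc_subst_superset:
  assumes "finite A" "{w. P w \<noteq> 0} \<subseteq> A"
  shows "nc_subst P \<sigma> u = (\<Sum>w\<in>A. P w * nc_monoprod \<sigma> w u)"
  unfolding nc_subst_def using assms by (intro sum.mono_neutral_left) auto

lemma nc_subst_one: "nc_subst (nc_const 1) \<sigma> = nc_const 1"
proof
  fix u show "nc_subst (nc_const 1) \<sigma> u = nc_const 1 u"
    by (subst nc_subst_superset[of "{[]}"]) (auto simp: nc_const_def)
qed

lemma support_var_mul: "{w. nc_mul (nc_var v) Q w \<noteq> 0} = (#) v ` {w. Q w \<noteq> 0}"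
proof (intro set_eqI)
  fix w
  show "w \<in> {w. nc_mul (nc_var v) Q w \<noteq> 0} \<longleftrightarrow> w \<in> (#) v ` {w. Q w \<noteq> 0}"
    by (cases w) (auto simp: nc_mul_var)
qed

lemma finite_support_var_mul:
  assumes "finite {w. Q w \<noteq> 0}"
  shows "finite {w. nc_mul (nc_var v) Q w \<noteq> 0}"
  unfolding support_var_mul using assms by (rule finite_imageI)

text \<open>Nodes of a program arise only by left multiplication with a variable and by linear
  combination, so this case replaces full multiplicativity of substitution.\<close>

lemma nc_subst_var_mul:
  assumes "finite {w. Q w \<noteq> 0}"
  shows "nc_subst (nc_mul (nc_var v) Q) \<sigma> = nc_mul (\<sigma> v) (nc_subst Q \<sigma>)"
proof
  fix u
  have "nc_subst (nc_mul (nc_var v) Q) \<sigma> u =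
      (\<Sum>w\<in>(#) v ` {w. Q w \<noteq> 0}. nc_mul (nc_var v) Q w * nc_monoprod \<sigma> w u)"
    using assms by (intro nc_subst_superset) (simp_all only: support_var_mul finite_imageI order_refl)
  also have "\<dots> = (\<Sum>w\<in>{w. Q w \<noteq> 0}. Q w * nc_mul (\<sigma> v) (nc_monoprod \<sigma> w) u)"
    by (subst sum.reindex) (auto simp: nc_mul_var)
  also have "\<dots> = nc_mul (\<sigma> v) (nc_subst Q \<sigma>) u"
    unfolding nc_subst_def by (simp only: nc_mul_sum_right nc_mul_scale_right)
  finally show "nc_subst (nc_mul (nc_var v) Q) \<sigma> u = nc_mul (\<sigma> v) (nc_subst Q \<sigma>) u" .
qed

lemma finite_support_comb:
  assumes "\<And>i. i < n \<Longrightarrow> finite {w. p i w \<noteq> 0}"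
  shows "finite {w. comb n u p w \<noteq> 0}"
proof (rule finite_subset)
  show "{w. comb n u p w \<noteq> 0} \<subseteq> (\<Union>i<n. {w. p i w \<noteq> 0})"
    by (rule, rule ccontr) (auto simp: comb_def simp del: bit_not_zero_iff)
  show "finite (\<Union>i<n. {w. p i w \<noteq> 0})" using assms by auto
qed

lemma nc_subst_comb:
  assumes "\<And>i. i < n \<Longrightarrow> finite {w. p i w \<noteq> 0}"
  shows "nc_subst (comb n u p) \<sigma> = comb n u (\<lambda>i. nc_subst (p i) \<sigma>)"
proof
  fix x
  let ?A = "\<Union>i<n. {w. p i w \<noteq> 0}"
  have fin: "finite ?A" using assms by auto
  have "nc_subst (comb n u p) \<sigma> x = (\<Sum>w\<in>?A. comb n u p w * nc_monoprod \<sigma> w x)"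
    by (rule nc_subst_superset[OF fin], rule, rule ccontr)
       (auto simp: comb_def simp del: bit_not_zero_iff)
  also have "\<dots> = (\<Sum>w\<in>?A. \<Sum>i<n. u i * (p i w * nc_monoprod \<sigma> w x))"
    by (simp add: comb_def sum_distrib_right mult.assoc)
  also have "\<dots> = (\<Sum>i<n. \<Sum>w\<in>?A. u i * (p i w * nc_monoprod \<sigma> w x))"
    by (rule sum.swap)
  also have "\<dots> = (\<Sum>i<n. u i * (\<Sum>w\<in>?A. p i w * nc_monoprod \<sigma> w x))"
    by (simp add: sum_distrib_left)
  also have "\<dots> = (\<Sum>i<n. u i * nc_subst (p i) \<sigma> x)"
    using fin by (intro sum.cong refl arg_cong2[where f = "(*)"] nc_subst_superset[symmetric]) auto
  finally show "nc_subst (comb n u p) \<sigma> x = comb n u (\<lambda>i. nc_subst (p i) \<sigma>) x"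
    by (simp add: comb_def)
qed

lemma nc_monoprod_cong: "(\<And>v. v \<in> set w \<Longrightarrow> \<sigma> v = \<tau> v) \<Longrightarrow> nc_monoprod \<sigma> w = nc_monoprod \<tau> w"
  by (induction w) auto

lemma nc_subst_cong:
  "(\<And>w v. P w \<noteq> 0 \<Longrightarrow> v \<in> set w \<Longrightarrow> \<sigma> v = \<tau> v) \<Longrightarrow> nc_subst P \<sigma> = nc_subst P \<tau>"
  unfolding nc_subst_def
  by (intro ext sum.cong refl arg_cong2[where f = "(*)"] fun_cong[OF nc_monoprod_cong]) auto

text \<open>The nodes are numbered against the direction in which words are read.\<close>

fun prog :: "('v \<Rightarrow> 'u ncpoly) \<Rightarrow> (nat \<Rightarrow> 'v) \<Rightarrow> (nat \<Rightarrow> nat \<Rightarrow> bit) \<Rightarrow> nat \<Rightarrow> 'u ncpoly" where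
  "prog \<sigma> v S i = (if i = 0 then nc_const 1
     else nc_mul (\<sigma> (v i)) (\<lambda>w. \<Sum>j<i. S i j * prog \<sigma> v S j w))"

declare prog.simps [simp del]

lemma prog_0 [simp]: "prog \<sigma> v S 0 = nc_const 1"
  by (simp add: prog.simps)

lemma prog_pos: "0 < i \<Longrightarrow> prog \<sigma> v S i = nc_mul (\<sigma> (v i)) (comb i (S i) (prog \<sigma> v S))"
  by (subst prog.simps) (simp add: comb_def)

lemma prog_cong:
  assumes "\<And>i j. i < n \<Longrightarrow> j < i \<Longrightarrow> v' i = v i \<and> S' i j = S i j" "i < n"
  shows "prog \<sigma> v' S' i = prog \<sigma> v S i"
  using assms(2)
proof (induction i rule: less_induct)
  case (less i)
  show ?case
  proof (cases "i = 0")
    case False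
    then have "comb i (S' i) (prog \<sigma> v' S') = comb i (S i) (prog \<sigma> v S)"
      using less assms(1)[of i] by (auto simp: comb_def)
    then show ?thesis using False assms(1)[of i 0] less.prems by (simp add: prog_pos)
  qed simp
qed

lemma finite_support_prog: "finite {w. prog nc_var v S i w \<noteq> 0}"
proof (induction i rule: less_induct)
  case (less i)
  show ?case
  proof (cases "i = 0")
    case True
    then show ?thesis by (auto simp: nc_const_def intro: finite_subset[of _ "{[]}"])
  next
    case False
    then show ?thesis
      using less by (simp only: prog_pos) (intro finite_support_var_mul finite_support_comb; simp)
  qed
qed

lemma nc_subst_prog: "nc_subst (prog nc_var v S i) \<sigma> = prog \<sigma> v S i"
proof (induction i rule: less_induct)
  case (less i)
  show ?case
  proof (cases "i = 0")
    case True
    then show ?thesis by (simp add: nc_subst_one)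
  next
    case False
    have "nc_subst (comb i (S i) (prog nc_var v S)) \<sigma> = comb i (S i) (prog \<sigma> v S)"
      by (subst nc_subst_comb[OF finite_support_prog]) (simp add: comb_def less)
    then show ?thesis using False
      by (simp add: prog_pos nc_subst_var_mul finite_support_comb finite_support_prog
          del: bit_not_zero_iff)
  qed
qed

text \<open>A formula is compiled against a continuation: given a combination \<open>u\<close> of
  existing nodes, nodes are appended that yield \<open>f\<close> times that combination. A variable
  leaf adds one node with row \<open>u\<close>, a constant rescales \<open>u\<close>, both summands
  of a sum receive the same \<open>u\<close>, and in a product the right factor is compiled first
  and its result handed to the left one. Since \<open>u\<close> vanishes from \<open>n\<close> on,
  later nodes do not disturb it.\<close>

lemma program_extend:
  assumes "\<And>j. n \<le> j \<Longrightarrow> u j = 0" "1 \<le> n"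
  shows "\<exists>n' v' S' u'. n \<le> n' \<and> n' \<le> n + nc_size f \<and> (\<forall>i<n. v' i = v i \<and> S' i = S i) \<and>
    (\<forall>j\<ge>n'. u' j = 0) \<and>
    comb n' u' (prog nc_var v' S') = nc_mul (nc_eval f) (comb n u (prog nc_var v S))"
  using assms
proof (induction f arbitrary: n v S u)
  case (NVar x)
  let ?v = "v(n := x)" and ?S = "S(n := u)"
  have eq: "prog nc_var ?v ?S i = prog nc_var v S i" if "i < n" for i
    by (rule prog_cong[of n]) (use that in auto)
  have "prog nc_var ?v ?S n = nc_mul (nc_var x) (comb n u (prog nc_var v S))"
    using NVar.prems(2) by (simp add: prog_pos comb_def eq)
  then have "comb (n + 1) (\<lambda>j. if j = n then 1 else 0) (prog nc_var ?v ?S) =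
      nc_mul (nc_eval (NVar x)) (comb n u (prog nc_var v S))"
    by (subst comb_single) auto
  then show ?case
    by (intro exI[of _ "n + 1"] exI[of _ ?v] exI[of _ ?S] exI[of _ "\<lambda>j. if j = n then 1 else 0"])
      (auto simp del: fun_upd_apply, auto)
next
  case (NConst c)
  have "comb n (\<lambda>j. c * u j) (prog nc_var v S) =
      nc_mul (nc_eval (NConst c)) (comb n u (prog nc_var v S))"
    by (simp add: nc_mul_const comb_scale)
  then show ?case using NConst
    by (intro exI[of _ n] exI[of _ v] exI[of _ S] exI[of _ "\<lambda>j. c * u j"]) auto
next
  case (NAdd f g)
  from NAdd.IH(1)[where n = n and u = u and v = v and S = S, OF NAdd.prems] obtain n1 v1 S1 u1 where
    1: "n \<le> n1" "n1 \<le> n + nc_size f" "\<forall>i<n. v1 i = v i \<and> S1 i = S i" "\<forall>j\<ge>n1. u1 j = 0"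
    "comb n1 u1 (prog nc_var v1 S1) = nc_mul (nc_eval f) (comb n u (prog nc_var v S))" by blast
  have "\<And>j. n1 \<le> j \<Longrightarrow> u j = 0" "1 \<le> n1" using NAdd.prems 1(1) by auto
  from NAdd.IH(2)[where n = n1 and u = u and v = v1 and S = S1, OF this] obtain n2 v2 S2 u2 where
    2: "n1 \<le> n2" "n2 \<le> n1 + nc_size g" "\<forall>i<n1. v2 i = v1 i \<and> S2 i = S1 i" "\<forall>j\<ge>n2. u2 j = 0"
    "comb n2 u2 (prog nc_var v2 S2) = nc_mul (nc_eval g) (comb n1 u (prog nc_var v1 S1))" by blast
  have "comb n1 u (prog nc_var v1 S1) = comb n u (prog nc_var v1 S1)"
    by (rule comb_extend) (use NAdd.prems 1 in auto)
  also have "\<dots> = comb n u (prog nc_var v S)"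
    using 1(3) by (intro comb_cong prog_cong[of n]) auto
  finally have a: "comb n1 u (prog nc_var v1 S1) = comb n u (prog nc_var v S)" .
  have "comb n2 u1 (prog nc_var v2 S2) = comb n1 u1 (prog nc_var v2 S2)"
    by (rule comb_extend) (use 1 2 in auto)
  also have "\<dots> = comb n1 u1 (prog nc_var v1 S1)"
    using 2(3) by (intro comb_cong prog_cong[of n1]) auto
  finally have b: "comb n2 u1 (prog nc_var v2 S2) = comb n1 u1 (prog nc_var v1 S1)" .
  have "comb n2 (\<lambda>j. u1 j + u2 j) (prog nc_var v2 S2) =
      nc_mul (nc_eval (NAdd f g)) (comb n u (prog nc_var v S))"
    unfolding comb_plus b 1(5) 2(5) a by (auto simp: nc_add_def nc_mul_plus_left)
  then show ?case using 1 2
    by (intro exI[of _ n2] exI[of _ v2] exI[of _ S2] exI[of _ "\<lambda>j. u1 j + u2 j"]) auto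
next
  case (NMul f g)
  from NMul.IH(2)[where n = n and u = u and v = v and S = S, OF NMul.prems] obtain n1 v1 S1 u1 where
    1: "n \<le> n1" "n1 \<le> n + nc_size g" "\<forall>i<n. v1 i = v i \<and> S1 i = S i" "\<forall>j\<ge>n1. u1 j = 0"
    "comb n1 u1 (prog nc_var v1 S1) = nc_mul (nc_eval g) (comb n u (prog nc_var v S))" by blast
  have "\<And>j. n1 \<le> j \<Longrightarrow> u1 j = 0" "1 \<le> n1" using NMul.prems 1 by auto
  from NMul.IH(1)[where n = n1 and u = u1 and v = v1 and S = S1, OF this] obtain n2 v2 S2 u2 where
    2: "n1 \<le> n2" "n2 \<le> n1 + nc_size f" "\<forall>i<n1. v2 i = v1 i \<and> S2 i = S1 i" "\<forall>j\<ge>n2. u2 j = 0"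
    "comb n2 u2 (prog nc_var v2 S2) = nc_mul (nc_eval f) (comb n1 u1 (prog nc_var v1 S1))" by blast
  have "comb n2 u2 (prog nc_var v2 S2) = nc_mul (nc_eval (NMul f g)) (comb n u (prog nc_var v S))"
    by (simp add: 1 2 nc_mul_assoc)
  then show ?case using 1 2
    by (intro exI[of _ n2] exI[of _ v2] exI[of _ S2] exI[of _ u2]) auto
qed

text \<open>The quantifier order matters: \<open>v\<close>, \<open>S\<close> and \<open>u\<close>
  come before the substitution, so one program serves both identities of a refutation. Compilation
  starts from the continuation 1, which is node \<open>0\<close>.\<close>

lemma program_exists:
  "\<exists>n v S u. 1 \<le> n \<and> n \<le> nc_size f + 1 \<and> (\<forall>j\<ge>n. u j = 0) \<and> (\<forall>i j. i \<le> j \<longrightarrow> S i j = 0) \<and>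
    (\<forall>\<sigma> :: _ \<Rightarrow> 'u ncpoly. nc_subst (nc_eval f) \<sigma> = comb n u (prog \<sigma> v S))"
proof -
  obtain n v S u where p: "1 \<le> n" "n \<le> 1 + nc_size f" "\<forall>j\<ge>n. u j = (0::bit)"
    "comb n u (prog nc_var v S) = nc_mul (nc_eval f)
        (comb 1 (\<lambda>j. if j = 0 then 1 else 0) (prog nc_var (\<lambda>_. undefined) (\<lambda>_ _. 0)))"
    using program_extend[of 1 "\<lambda>j. if j = 0 then 1 else 0" f "\<lambda>_. undefined" "\<lambda>_ _. 0"]
    by auto
  \<comment> \<open>\<open>prog\<close> never reads entries with \<open>i \<le> j\<close>; clearing
    them makes the matrix strictly triangular, as the nilpotency argument requires.\<close>
  define S' where "S' i j = (if j < i then S i j else 0)" for i j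
  have one: "nc_mul P (nc_const 1) = P" for P :: "'v ncpoly"
  proof
    fix w show "nc_mul P (nc_const 1) w = P w"
      by (induction w arbitrary: P) (simp_all add: nc_mul_Nil nc_mul_Cons nc_const_def)
  qed
  have S': "prog \<sigma> v S' i = prog \<sigma> v S i" for \<sigma> :: "_ \<Rightarrow> 'x ncpoly" and i
    by (rule prog_cong[of "Suc i"]) (auto simp: S'_def)
  have "nc_eval f = comb n u (prog nc_var v S')"
    using p(4) unfolding S' by (simp add: comb_single one)
  then have "nc_subst (nc_eval f) \<sigma> = comb n u (prog \<sigma> v S')" for \<sigma> :: "_ \<Rightarrow> 'u ncpoly"
    by (simp only: nc_subst_comb[OF finite_support_prog] nc_subst_prog)
  moreover have "\<forall>i j. i \<le> j \<longrightarrow> S' i j = 0" by (simp add: S'_def)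
  ultimately show ?thesis using p(1-3) by (metis add.commute)
qed

section \<open>Solving triangular linear systems by repeated squaring\<close>

text \<open>Here \<open>a\<close> bounds the formulas used as entries. The two factors
  \<open>4 ^ K\<close> leave room for a double sum over terms of size linear in \<open>a\<close>;
  the full \<open>32 * a + 128\<close> is spent in the induction step of \<open>eqv_solv\<close>,
  while half of it suffices for \<open>room0\<close>, \<open>room1\<close> and
  \<open>room2\<close>.\<close>

locale xor_sums = short_derivations R C m h
  for R :: "frule set" and C m :: nat and h :: pform +
  fixes K a :: nat
  assumes room: "4 ^ K * (4 ^ K * (32 * a + 128)) \<le> m"
begin

lemma room2: "4 ^ K * (4 ^ K * (16 * a + 64)) \<le> m"
  by (rule order_trans[OF _ room]) simp

lemma room1: "4 ^ K * (16 * a + 64) \<le> m"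
  by (rule order_trans[OF _ room2]) simp

lemma room0: "16 * a + 64 \<le> m"
  by (rule order_trans[OF _ room1]) simp

lemma le_pow4: "(x::nat) \<le> 4 ^ K * x"
  by simp

lemma psize_PAnd_le: "psize x \<le> s \<Longrightarrow> psize y \<le> s' \<Longrightarrow> psize (PAnd x y) \<le> s + s' + 1"
  by simp

lemma psize_bx_PAnd:
  assumes "\<And>i. psize (f i) \<le> s" "\<And>i. psize (g i) \<le> s"
  shows "psize (bx K (\<lambda>i. PAnd (f i) (g i))) + 2 \<le> 4 ^ K * (2 * s + 3)"
proof (rule psize_bx)
  fix i show "psize (PAnd (f i) (g i)) + 2 \<le> 2 * s + 3"
    using assms(1)[of i] assms(2)[of i] by simp
qed

lemma bx_small:
  assumes "\<And>i. i < 2 ^ K \<Longrightarrow> psize (f i) \<le> 16 * a + 62"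
  shows "psize (bx K f) \<le> m"
proof -
  have "psize (bx K f) + 2 \<le> 4 ^ K * (16 * a + 64)"
    by (rule psize_bx) (use assms in fastforce)
  then show ?thesis using room1 by linarith
qed

lemma bx_bx_small:
  assumes "\<And>i j. i < 2 ^ K \<Longrightarrow> j < 2 ^ K \<Longrightarrow> psize (f i j) \<le> 16 * a + 62"
  shows "psize (bx K (\<lambda>i. bx K (f i))) \<le> m"
proof -
  have "psize (bx K (\<lambda>i. bx K (f i))) + 2 \<le> 4 ^ K * (4 ^ K * (16 * a + 64))"
    by (intro psize_bx) (use assms in fastforce)
  then show ?thesis using room2 by linarith
qed

lemma pxor_bx_small:
  assumes "\<And>i. i < 2 ^ K \<Longrightarrow> psize (f i) \<le> 3 * a + 10" "\<And>i. i < 2 ^ K \<Longrightarrow> psize (g i) \<le> 3 * a + 10"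
  shows "psize (pxor (bx K f) (bx K g)) \<le> m"
proof -
  have "psize (bx K f) + 2 \<le> 4 ^ K * (4 * a + 16)" "psize (bx K g) + 2 \<le> 4 ^ K * (4 * a + 16)"
    by (rule psize_bx; use assms in fastforce)+
  moreover have "4 * (4 ^ K * (4 * a + 16)) = 4 ^ K * (16 * a + 64)" by (simp add: algebra_simps)
  ultimately have "psize (pxor (bx K f) (bx K g)) \<le> 4 ^ K * (16 * a + 64)"
    unfolding pxor_simps by linarith
  then show ?thesis using room1 by linarith
qed

lemma tcost_14: "tcost 1 4 K + 4 \<le> 5 * 2 ^ K"
  using tcost_le[of 1 4 K] by simp

lemma tcost_1: "l \<le> l' \<Longrightarrow> tcost l 1 K + 1 \<le> 2 ^ K * (l' + 1)"
  using tcost_le[of l 1 K] mult_le_mono2[of "l + 1" "l' + 1" "2 ^ K"] by linarith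

section \<open>Matrices and vectors of formulas over GF(2)\<close>

definition mvec :: "(nat \<Rightarrow> nat \<Rightarrow> pform) \<Rightarrow> (nat \<Rightarrow> pform) \<Rightarrow> nat \<Rightarrow> pform" where
  "mvec A v i = bx K (\<lambda>j. PAnd (A i j) (v j))"

definition mmul :: "(nat \<Rightarrow> nat \<Rightarrow> pform) \<Rightarrow> (nat \<Rightarrow> nat \<Rightarrow> pform) \<Rightarrow> nat \<Rightarrow> nat \<Rightarrow> pform" where
  "mmul A B i j = bx K (\<lambda>l. PAnd (A i l) (B l j))"

lemma eqv_mvec_pxor:
  assumes A: "\<And>i j. psize (A i j) \<le> a" and v: "\<And>j. psize (v j) \<le> a" and w: "\<And>j. psize (w j) \<le> a"
  shows "eqv \<Gamma> (8 * 2 ^ K) (mvec A (\<lambda>j. pxor (v j) (w j)) i) (pxor (mvec A v i) (mvec A w i))"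
proof -
  let ?x = "\<lambda>j. pxor (PAnd (A i j) (v j)) (PAnd (A i j) (w j))"
  have s: "psize (A i j) \<le> a" "psize (v j) \<le> a" "psize (w j) \<le> a" for j
    by (fact A v w)+
  have x: "psize (?x j) \<le> 8 * a + 9" for j
    using s[of j] by simp
  have bx: "psize (bx K ?x) \<le> m"
    by (intro bx_small order_trans[OF x]) simp
  have "psize (PAnd (A i j) (pxor (v j) (w j))) \<le> 16 * a + 62" for j
    using s[of j] by simp
  then have bx': "psize (bx K (\<lambda>j. PAnd (A i j) (pxor (v j) (w j)))) \<le> m"
    by (intro bx_small)
  have "psize (?x j) \<le> m" for j using x[of j] room0 by linarith
  then have "eqv \<Gamma> 1 (PAnd (A i j) (pxor (v j) (w j))) (?x j)" for j
    by (rule eqv_distrib_left)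
  then have 1: "eqv \<Gamma> (tcost 1 1 K) (bx K (\<lambda>j. PAnd (A i j) (pxor (v j) (w j)))) (bx K ?x)"
    using bx bx' by (intro eqv_bx_cong)
  have y: "psize (PAnd (A i j) (v j)) \<le> 3 * a + 10" "psize (PAnd (A i j) (w j)) \<le> 3 * a + 10" for j
    using s[of j] by simp_all
  have 2: "eqv \<Gamma> (tcost 1 4 K) (bx K ?x) (pxor (mvec A v i) (mvec A w i))"
    unfolding mvec_def using bx y by (intro eqv_bx_pxor pxor_bx_small)
  show ?thesis
    using eqv_trans[OF 1 2] tcost_14 tcost_1[of 1 1] unfolding mvec_def by (elim eqv_le) simp
qed

text \<open>The factor \<open>A i j\<close> is pushed into the inner sum, the two sums are
  exchanged, and \<open>v l\<close> is pulled out again. The exchange accounts for the quadratic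
  cost in the dimension \<open>2 ^ K\<close>.\<close>

lemma eqv_mvec_mvec:
  assumes A: "\<And>i j. psize (A i j) \<le> a" and v: "\<And>j. psize (v j) \<le> a"
  shows "eqv \<Gamma> (20 * (2 ^ K * 2 ^ K)) (mvec A (mvec A v) i) (mvec (mmul A A) v i)"
proof -
  let ?l = "\<lambda>j l. PAnd (A i j) (PAnd (A j l) (v l))"
  let ?r = "\<lambda>j l. PAnd (PAnd (A i j) (A j l)) (v l)"
  have l: "psize (?l j l) \<le> 3 * a + 2" and r: "psize (?r j l) \<le> 3 * a + 2" for j l
    using A[of i j] A[of j l] v[of l] by simp_all
  have l': "psize (?l j l) \<le> 16 * a + 62" and r': "psize (?r j l) \<le> 16 * a + 62"
    and lm: "psize (?l j l) \<le> m" for j l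
    using l[of j l] r[of j l] room0 by linarith+
  have bl: "psize (bx K (?l j)) \<le> m" and br: "psize (bx K (?r j)) \<le> m"
    and brT: "psize (bx K (\<lambda>j. ?r j l)) \<le> m" for j l
    by (intro bx_small l' r')+
  have bb: "psize (bx K (\<lambda>j. bx K (?r j))) \<le> m" "psize (bx K (\<lambda>l. bx K (\<lambda>j. ?r j l))) \<le> m"
    by (intro bx_bx_small r')+
  have sl: "psize (PAnd (A i j) (bx K (\<lambda>l. PAnd (A j l) (v l)))) \<le> 4 ^ K * (3 * a + 4)" for j
  proof -
    have "psize (bx K (\<lambda>l. PAnd (A j l) (v l))) + 2 \<le> 4 ^ K * (2 * a + 3)"
      using A[of j] v by (intro psize_bx_PAnd) auto
    moreover have "a + 1 \<le> 4 ^ K * (a + 1)" by (rule le_pow4)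
    ultimately show ?thesis using A[of i j] by (simp add: algebra_simps)
  qed
  have sr: "psize (PAnd (bx K (\<lambda>j. PAnd (A i j) (A j l))) (v l)) \<le> 4 ^ K * (3 * a + 4)" for l
  proof -
    have "psize (bx K (\<lambda>j. PAnd (A i j) (A j l))) + 2 \<le> 4 ^ K * (2 * a + 3)"
      using A by (intro psize_bx_PAnd) auto
    moreover have "a + 1 \<le> 4 ^ K * (a + 1)" by (rule le_pow4)
    ultimately show ?thesis using v[of l] by (simp add: algebra_simps)
  qed
  have big: "psize (bx K F) \<le> m" if "\<And>j. psize (F j) \<le> 4 ^ K * (3 * a + 4)" for F
  proof -
    have "psize (bx K F) + 2 \<le> 4 ^ K * (4 ^ K * (3 * a + 4) + 2)"
      using that by (intro psize_bx) simp
    also have "\<dots> \<le> 4 ^ K * (4 ^ K * (3 * a + 4) + 4 ^ K * 2)"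
      by (intro mult_le_mono2 add_left_mono le_pow4)
    also have "\<dots> \<le> 4 ^ K * (4 ^ K * (16 * a + 64))" by (simp flip: distrib_left)
    finally show ?thesis using room2 by linarith
  qed
  have "eqv \<Gamma> (tcost 1 4 K + 1 + tcost 1 1 K + 1) (PAnd (A i j) (bx K (\<lambda>l. PAnd (A j l) (v l)))) (bx K (?r j))"
    for j
    using bl br lm by (intro eqv_trans[OF eqv_sym[OF eqv_bx_PAnd_left]] eqv_bx_cong eqv_PAnd_assoc)
  then have 1: "eqv \<Gamma> (tcost (tcost 1 4 K + 1 + tcost 1 1 K + 1) 1 K)
      (mvec A (mvec A v) i) (bx K (\<lambda>j. bx K (?r j)))"
    unfolding mvec_def by (rule eqv_bx_cong[OF _ big[OF sl] bb(1)])
  have 2: "eqv \<Gamma> (tcost 1 (tcost 1 4 K + 3) K) (bx K (\<lambda>j. bx K (?r j))) (bx K (\<lambda>l. bx K (\<lambda>j. ?r j l)))"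
    using bb by (intro eqv_bx_swap)
  have 3: "eqv \<Gamma> (tcost (tcost 1 4 K) 1 K) (bx K (\<lambda>l. bx K (\<lambda>j. ?r j l))) (mvec (mmul A A) v i)"
    unfolding mvec_def mmul_def
    by (rule eqv_bx_cong[OF eqv_bx_PAnd_right[OF brT] bb(2) big[OF sr]])
  let ?D = "2 ^ K :: nat"
  have "tcost 1 4 K + 1 + tcost 1 1 K + 1 \<le> 7 * ?D"
    using tcost_14 tcost_1[of 1 1] by simp
  then have c1: "tcost (tcost 1 4 K + 1 + tcost 1 1 K + 1) 1 K + 1 \<le> ?D * (7 * ?D + 1)"
    by (rule tcost_1)
  have "tcost 1 (tcost 1 4 K + 3) K \<le> ?D * (1 + (tcost 1 4 K + 3))"
    using tcost_le[of 1 "tcost 1 4 K + 3" K] by linarith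
  also have "\<dots> \<le> ?D * (5 * ?D)"
    using tcost_14 by (intro mult_le_mono) auto
  finally have c2: "tcost 1 (tcost 1 4 K + 3) K \<le> ?D * (5 * ?D)" .
  have c3: "tcost (tcost 1 4 K) 1 K + 1 \<le> ?D * (5 * ?D + 1)"
    using tcost_14 by (intro tcost_1) simp
  define E where "E = ?D * ?D"
  have E: "1 \<le> E" "?D \<le> E" by (simp_all add: E_def)
  have "?D * (7 * ?D + 1) = 7 * E + ?D" "?D * (5 * ?D) = 5 * E" "?D * (5 * ?D + 1) = 5 * E + ?D"
    by (simp_all add: algebra_simps E_def)
  then show ?thesis
    using eqv_trans[OF eqv_trans[OF 1 2] 3] c1 c2 c3 E
    unfolding E_def[symmetric] by (elim eqv_le) linarith
qed

fun mpow :: "(nat \<Rightarrow> nat \<Rightarrow> pform) \<Rightarrow> nat \<Rightarrow> nat \<Rightarrow> nat \<Rightarrow> pform" where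
  "mpow M 0 = M"
| "mpow M (Suc k) = mmul (mpow M k) (mpow M k)"

text \<open>With \<open>A\<^sub>k = M\<^bsup>2^k\<^esup>\<close>, this is \<open>(I + A\<^sub>K\<^sub>-\<^sub>r) \<cdots> (I + A\<^sub>K\<^sub>-\<^sub>1) t\<close>; since \<open>(I + A\<^sub>k)\<^sup>2 = I + A\<^sub>k\<^sub>+\<^sub>1\<close>
  and \<open>A\<^sub>K = 0\<close>, multiplying it by \<open>I + A\<^sub>K\<^sub>-\<^sub>r\<close> yields \<open>t\<close>.\<close>

fun solv :: "(nat \<Rightarrow> nat \<Rightarrow> pform) \<Rightarrow> (nat \<Rightarrow> pform) \<Rightarrow> nat \<Rightarrow> nat \<Rightarrow> pform" where
  "solv M t 0 = t"
| "solv M t (Suc r) = (\<lambda>i. pxor (solv M t r i) (mvec (mpow M (K - Suc r)) (solv M t r) i))"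

lemma psize_mpow:
  assumes "\<And>i j. psize (M i j) \<le> 1"
  shows "psize (mpow M k i j) \<le> (32 * 4 ^ K) ^ k"
proof (induction k arbitrary: i j)
  case (Suc k)
  let ?b = "(32 * 4 ^ K) ^ k :: nat"
  have "psize (mmul (mpow M k) (mpow M k) i j) + 2 \<le> 4 ^ K * (2 * ?b + 3)"
    unfolding mmul_def using Suc by (intro psize_bx_PAnd) auto
  also have "\<dots> \<le> 4 ^ K * (2 * ?b + 3 * ?b)" by (intro mult_le_mono add_mono) (auto simp: one_le_power)
  also have "\<dots> \<le> (32 * 4 ^ K) ^ Suc k" by simp
  finally show ?case by simp
qed (use assms in simp)

text \<open>Each squaring and each factor \<open>I + A\<close> multiplies the size by at most
  \<open>32 * 4 ^ K\<close>: \<open>4 ^ K\<close> is the price of one tree, and 32 covers the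
  constants (17 would do here). Up to \<open>K\<close> squarings are followed by \<open>r\<close>
  factors, hence the exponent \<open>K + r\<close>.\<close>

lemma psize_solv:
  assumes M: "\<And>i j. psize (M i j) \<le> 1" and t: "\<And>i. psize (t i) \<le> 1" and "r \<le> K"
  shows "psize (solv M t r i) \<le> (32 * 4 ^ K) ^ (K + r)"
  using assms(3)
proof (induction r arbitrary: i)
  case 0
  show ?case unfolding solv.simps by (rule order_trans[OF t one_le_power]) simp
next
  case (Suc r)
  let ?B = "32 * 4 ^ K :: nat"
  let ?b = "?B ^ (K + r)"
  have b: "1 \<le> ?b" by (rule one_le_power) simp
  have "psize (mpow M (K - Suc r) i j) \<le> ?b" for i j
    by (rule order_trans[OF psize_mpow[OF M] power_increasing]) auto
  moreover have v: "psize (solv M t r i) \<le> ?b" for i using Suc by simp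
  ultimately have "psize (mvec (mpow M (K - Suc r)) (solv M t r) i) + 2 \<le> 4 ^ K * (2 * ?b + 3)"
    unfolding mvec_def by (intro psize_bx_PAnd) auto
  also have "\<dots> \<le> 4 ^ K * (2 * ?b + 3 * ?b)" using b by (intro mult_le_mono add_mono) auto
  finally have "psize (solv M t (Suc r) i) \<le> 2 * ?b + 2 * (4 ^ K * (2 * ?b + 3 * ?b)) + 5"
    using v[of i] by simp
  also have "\<dots> \<le> 4 ^ K * (2 * ?b) + 2 * (4 ^ K * (2 * ?b + 3 * ?b)) + 4 ^ K * (5 * ?b)"
    using b le_pow4[of "2 * ?b"] le_pow4[of "5 * ?b"] by linarith
  also have "\<dots> \<le> ?B * ?b" by simp
  finally show ?case by simp
qed

text \<open>A nonzero entry of \<open>M\<close> to the power \<open>2 ^ k\<close> would need a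
  descending path of length \<open>2 ^ k\<close> from \<open>i\<close> to \<open>j\<close>, which is
  impossible if \<open>i < j + 2 ^ k\<close>. Every entry is refuted afresh from the entries one
  level below, so the cost is multiplied by about \<open>2 ^ K\<close> per level; this is what makes
  the line count quasi-polynomial.\<close>

lemma eqv_mpow_False:
  assumes M: "\<And>i j. i \<le> j \<Longrightarrow> M i j = PFalse" and a: "\<And>k i j. k \<le> K \<Longrightarrow> psize (mpow M k i j) \<le> a"
    and "i < j + 2 ^ k" "k \<le> K"
  shows "eqv \<Gamma> ((12 * 2 ^ K) ^ k) (mpow M k i j) PFalse"
  using assms(3,4)
proof (induction k arbitrary: i j)
  case 0
  then show ?case using M[of i j] room0 by (simp add: eqv_refl)
next
  case (Suc k)
  let ?A = "mpow M k" and ?z = "(12 * 2 ^ K) ^ k :: nat"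
  have s: "psize (PAnd (?A i l) (?A l' j)) \<le> 2 * a + 1" for i l l' j
    using a[of k i l] a[of k l' j] Suc.prems by simp
  have "eqv \<Gamma> (?z + 4) (PAnd (?A i l) (?A l j)) PFalse" for l
  \<comment> \<open>The first half of the path is too long if \<open>i < l + 2 ^ k\<close>.
    Otherwise \<open>i < j + 2 ^ Suc k\<close> forces \<open>l < j + 2 ^ k\<close>, and the second
    half is.\<close>
  proof (cases "i < l + 2 ^ k")
    case True
    then have "eqv \<Gamma> ?z (?A i l) PFalse" using Suc by simp
    moreover have "eqv \<Gamma> 1 (?A l j) (?A l j)" using a[of k l j] Suc.prems room0 by (simp add: eqv_refl)
    ultimately have "eqv \<Gamma> (?z + 1 + 1 + 1 + 1) (PAnd (?A i l) (?A l j)) PFalse"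
      using s[of i l l j] a[of k l j] Suc.prems room0
      by (intro eqv_trans[OF eqv_PAnd eqv_PAnd_False(1)]) auto
    then show ?thesis by (rule eqv_le) simp
  next
    case False
    then have "eqv \<Gamma> ?z (?A l j) PFalse" using Suc by simp
    moreover have "eqv \<Gamma> 1 (?A i l) (?A i l)" using a[of k i l] Suc.prems room0 by (simp add: eqv_refl)
    ultimately have "eqv \<Gamma> (1 + ?z + 1 + 1 + 1) (PAnd (?A i l) (?A l j)) PFalse"
      using s[of i l l j] a[of k i l] Suc.prems room0
      by (intro eqv_trans[OF eqv_PAnd eqv_PAnd_False(2)]) auto
    then show ?thesis by (rule eqv_le) simp
  qed
  moreover have "psize (PAnd (?A i l) (?A l j)) \<le> 16 * a + 62" for l
    using s[of i l l j] by linarith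
  ultimately have "eqv \<Gamma> (tcost (?z + 4) 1 K + tcost 1 4 K + 1) (mpow M (Suc k) i j) PFalse"
    unfolding mpow.simps mmul_def
    by (intro eqv_trans[OF eqv_bx_cong eqv_bx_False] bx_small) auto
  then show ?case
  proof (rule eqv_le)
    have z: "1 \<le> ?z" by (rule one_le_power) simp
    have "tcost (?z + 4) 1 K + tcost 1 4 K + 1 \<le> 2 ^ K * (?z + 4 + 1) + 5 * 2 ^ K"
      using tcost_1[of "?z + 4" "?z + 4"] tcost_14 by linarith
    also have "\<dots> \<le> 2 ^ K * (?z + 5 * ?z) + 5 * (2 ^ K * ?z)"
      using mult_le_mono2[of "?z + 4 + 1" "?z + 5 * ?z" "2 ^ K"] mult_le_mono2[OF z, of "2 ^ K"] z
      by linarith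
    finally show "tcost (?z + 4) 1 K + tcost 1 4 K + 1 \<le> (12 * 2 ^ K) ^ Suc k"
      by simp
  qed
qed

text \<open>For \<open>r = K\<close> the matrix is \<open>M\<close> itself, so this is the system
  \<open>(I + M) z = t\<close>. The base case is nilpotency: the rows of \<open>mpow M K\<close>
  with index below \<open>2 ^ K\<close> are provably false.\<close>

lemma eqv_solv:
  assumes M: "\<And>i j. i \<le> j \<Longrightarrow> M i j = PFalse" "\<And>i j. psize (M i j) \<le> 1"
    and t: "\<And>i. psize (t i) \<le> 1" and a: "(32 * 4 ^ K) ^ (2 * K) \<le> a"
    and "r \<le> K" "i < 2 ^ K"
  shows "eqv \<Gamma> (12 * 2 ^ K * (12 * 2 ^ K) ^ K + 60 * (2 ^ K * 2 ^ K) * r)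
    (pxor (solv M t r i) (mvec (mpow M (K - r)) (solv M t r) i)) (t i)"
  using assms(5,6)
proof (induction r arbitrary: i)
  case 0
  have p: "psize (mpow M k i j) \<le> a" if "k \<le> K" for k i j
    by (rule order_trans[OF psize_mpow[OF M(2)] order_trans[OF power_increasing a]]) (use that in auto)
  have t': "psize (t i) \<le> 1" for i by (fact t)
  let ?z = "(12 * 2 ^ K) ^ K :: nat"
  have s: "psize (PAnd (mpow M K i j) (t j)) \<le> a + 2" for i j
    using p[of K i j] t'[of j] by simp
  have "eqv \<Gamma> (?z + 1 + 1 + 1 + 1) (PAnd (mpow M K i j) (t j)) PFalse" for j
    using s[of i j] t'[of j] room0 0
    by (intro eqv_trans[OF eqv_PAnd[OF eqv_mpow_False[OF M(1) p] eqv_refl] eqv_PAnd_False(1)]) auto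
  then have "eqv \<Gamma> (?z + 4) (PAnd (mpow M K i j) (t j)) PFalse" for j
    by (rule eqv_le) simp
  moreover have "psize (PAnd (mpow M K i j) (t j)) \<le> 16 * a + 62" for j
    using s[of i j] by linarith
  ultimately have b: "eqv \<Gamma> (tcost (?z + 4) 1 K + tcost 1 4 K + 1) (mvec (mpow M K) t i) PFalse"
    unfolding mvec_def by (intro eqv_trans[OF eqv_bx_cong eqv_bx_False] bx_small) auto
  \<comment> \<open>The constant tree is a stand-in that is at least as large as \<open>t i\<close>;
    the size bound for two trees then covers a tree paired with a single leaf.\<close>
  have "psize (pxor (mvec (mpow M K) t i) (bx K (\<lambda>i. PFalse))) \<le> m"
    unfolding mvec_def using s[of i] by (intro pxor_bx_small order_trans[OF s]) auto
  then have sz: "psize (pxor (t i) (mvec (mpow M K) t i)) \<le> m"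
    using t'[of i] psize_pos[of "bx K (\<lambda>i. PFalse)"] by simp
  have "eqv \<Gamma> (1 + (tcost (?z + 4) 1 K + tcost 1 4 K + 1) + 1 + 1 + 1)
     (pxor (t i) (mvec (mpow M K) t i)) (t i)"
    using sz t'[of i] room0
    by (intro eqv_trans[OF eqv_pxor[OF eqv_refl b] eqv_pxor_False(2)]) auto
  then show ?case
  proof (simp only: diff_zero mult_0_right add_0_right solv.simps, elim eqv_le)
    have z: "1 \<le> ?z" by (rule one_le_power) simp
    have "1 + (tcost (?z + 4) 1 K + tcost 1 4 K + 1) + 1 + 1 + 1
        \<le> 2 ^ K * (?z + 4 + 1) + 5 * 2 ^ K"
      using tcost_1[of "?z + 4" "?z + 4"] tcost_14 by linarith
    also have "\<dots> \<le> 2 ^ K * (?z + 5 * ?z) + 5 * (2 ^ K * ?z)"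
      using mult_le_mono2[of "?z + 4 + 1" "?z + 5 * ?z" "2 ^ K"] mult_le_mono2[OF z, of "2 ^ K"] z
      by linarith
    finally show "1 + (tcost (?z + 4) 1 K + tcost 1 4 K + 1) + 1 + 1 + 1
        \<le> 12 * 2 ^ K * ?z" by simp
  qed
next
  case (Suc r)
  define A where "A = mpow M (K - Suc r)"
  define v where "v = solv M t r"
  have A: "psize (A i j) \<le> a" for i j
    unfolding A_def by (rule order_trans[OF psize_mpow[OF M(2)] order_trans[OF power_increasing a]]) auto
  have solv: "psize (solv M t r' i) \<le> a" if "r' \<le> K" for r' i
    by (rule order_trans[OF psize_solv[OF M(2) t that] order_trans[OF power_increasing a]]) (use that in auto)
  have v: "psize (v i) \<le> a" for i
    using solv[of r i] Suc.prems by (simp add: v_def)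
  have vAv: "psize (pxor (v i) (mvec A v i)) \<le> a" for i
    using solv[of "Suc r" i] Suc.prems unfolding solv.simps A_def v_def by simp
  then have Av: "psize (mvec A v i) \<le> a" for i
    using order_trans[OF _ vAv[of i]] by simp
  have "K - r = Suc (K - Suc r)" using Suc.prems by simp
  then have AA: "mpow M (K - r) = mmul A A" by (simp add: A_def)
  \<comment> \<open>The first conjunct bounds the exclusive or of a formula of size at most
    \<open>a\<close> with the right side. That is the largest formula of the induction step, so its
    bound is taken directly from \<open>room\<close>.\<close>
  have "2 * a + 2 * psize (pxor (mvec A v i) (mvec (mmul A A) v i)) + 5 \<le> m \<and>
     eqv \<Gamma> (8 * 2 ^ K + (1 + 20 * (2 ^ K * 2 ^ K) + 1) + 1) (mvec A (solv M t (Suc r)) i)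
     (pxor (mvec A v i) (mvec (mmul A A) v i))"
  proof -
    have *: "psize (pxor (mvec A v i) (mvec A (mvec A v) i)) \<le> m"
      unfolding mvec_def[of A v i] mvec_def[of A "mvec A v" i]
      using A v Av by (intro pxor_bx_small order_trans[OF psize_PAnd_le[of _ a _ a]]) auto
    have AA': "psize (PAnd (mmul A A i j) (v j)) \<le> 4 ^ K * (3 * a + 4)" for j
    proof -
      have "psize (mmul A A i j) + 2 \<le> 4 ^ K * (2 * a + 3)"
        unfolding mmul_def using A by (intro psize_bx_PAnd) auto
      moreover have "a + 1 \<le> 4 ^ K * (a + 1)" by (rule le_pow4)
      ultimately have "psize (PAnd (mmul A A i j) (v j)) \<le> 4 ^ K * (2 * a + 3) + 4 ^ K * (a + 1)"
        using v[of j] by simp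
      also have "\<dots> = 4 ^ K * (3 * a + 4)" by (simp add: algebra_simps)
      finally show ?thesis .
    qed
    have "psize (mvec (mmul A A) v i) + 2 \<le> 4 ^ K * (4 ^ K * (3 * a + 4) + 2)"
      unfolding mvec_def using AA' by (intro psize_bx) simp
    also have "\<dots> \<le> 4 ^ K * (4 ^ K * (3 * a + 4) + 4 ^ K * 2)"
      by (intro mult_le_mono2 add_left_mono le_pow4)
    also have "\<dots> = 4 ^ K * (4 ^ K * (3 * a + 6))" by (simp flip: distrib_left)
    finally have "4 * psize (mvec (mmul A A) v i) + 8 \<le> 4 ^ K * (4 ^ K * (12 * a + 24))"
      by (simp add: distrib_left)
    moreover have "6 * a + 15 \<le> 4 ^ K * (4 ^ K * (6 * a + 15))"
      by (rule order_trans[OF le_pow4 le_pow4])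
    moreover have "2 * a + 2 * (2 * x + 2 * y + 5) + 5 \<le> p + q"
      if "4 * y + 8 \<le> p" "6 * a + 15 \<le> q" "x \<le> a" for x y p q :: nat
      using that by presburger
    ultimately have "2 * a + 2 * (2 * psize (mvec A v i) + 2 * psize (mvec (mmul A A) v i) + 5) + 5
      \<le> 4 ^ K * (4 ^ K * (12 * a + 24)) + 4 ^ K * (4 ^ K * (6 * a + 15))"
      using Av[of i] by blast
    also have "\<dots> \<le> 4 ^ K * (4 ^ K * (32 * a + 128))" by (simp flip: distrib_left)
    finally have big: "2 * a + 2 * psize (pxor (mvec A v i) (mvec (mmul A A) v i)) + 5 \<le> m"
      using room by simp
    then have **: "psize (pxor (mvec A v i) (mvec (mmul A A) v i)) \<le> m" by linarith
    have 1: "eqv \<Gamma> (8 * 2 ^ K) (mvec A (solv M t (Suc r)) i) (pxor (mvec A v i) (mvec A (mvec A v) i))"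
      using eqv_mvec_pxor[of A v "mvec A v", OF A v Av] by (simp add: A_def v_def)
    have 2: "eqv \<Gamma> (1 + 20 * (2 ^ K * 2 ^ K) + 1) (pxor (mvec A v i) (mvec A (mvec A v) i))
       (pxor (mvec A v i) (mvec (mmul A A) v i))"
      using * ** Av[of i] room0 by (intro eqv_pxor eqv_refl eqv_mvec_mvec A v) auto
    show ?thesis using big eqv_trans[OF 1 2] by blast
  qed
  then have big: "2 * a + 2 * psize (pxor (mvec A v i) (mvec (mmul A A) v i)) + 5 \<le> m"
    and e: "eqv \<Gamma> (8 * 2 ^ K + (1 + 20 * (2 ^ K * 2 ^ K) + 1) + 1) (mvec A (solv M t (Suc r)) i)
     (pxor (mvec A v i) (mvec (mmul A A) v i))" by blast+
  have "psize (pxor (bx K (\<lambda>j. PFalse)) (mvec A (solv M t (Suc r)) i)) \<le> m"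
    unfolding mvec_def using A solv[OF Suc.prems(1)]
    by (intro pxor_bx_small order_trans[OF psize_PAnd_le[of _ a _ a]]) auto
  moreover have "4 * a + 2 * psize (mvec A (solv M t (Suc r)) i) + 5 \<le> m"
  proof -
    have "psize (mvec A (solv M t (Suc r)) i) + 2 \<le> 4 ^ K * (2 * a + 3)"
      unfolding mvec_def using A solv[OF Suc.prems(1)] by (intro psize_bx_PAnd) auto
    moreover have "4 * a + 5 \<le> 4 ^ K * (4 * a + 5)" by (rule le_pow4)
    ultimately have "4 * a + 2 * psize (mvec A (solv M t (Suc r)) i) + 5
        \<le> 4 ^ K * (4 * a + 5) + 2 * (4 ^ K * (2 * a + 3))" by linarith
    also have "\<dots> \<le> 4 ^ K * (16 * a + 64)" by (simp add: algebra_simps)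
    finally show ?thesis using room1 by linarith
  qed
  ultimately have "eqv \<Gamma> (1 + (8 * 2 ^ K + (1 + 20 * (2 ^ K * 2 ^ K) + 1) + 1) + 1)
      (pxor (solv M t (Suc r) i) (mvec A (solv M t (Suc r)) i))
      (pxor (pxor (v i) (mvec A v i)) (pxor (mvec A v i) (mvec (mmul A A) v i)))"
    using big vAv[of i] room0 e
    by (simp only: solv.simps A_def[symmetric] v_def[symmetric])
      (intro eqv_pxor[OF eqv_refl]; simp)
  moreover have "eqv \<Gamma> 1 (pxor (pxor (v i) (mvec A v i)) (pxor (mvec A v i) (mvec (mmul A A) v i)))
      (pxor (v i) (mvec (mmul A A) v i))"
    using big vAv[of i] by (intro eqv_pxor_cancel) simp
  moreover have "eqv \<Gamma> (12 * 2 ^ K * (12 * 2 ^ K) ^ K + 60 * (2 ^ K * 2 ^ K) * r)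
      (pxor (v i) (mvec (mmul A A) v i)) (t i)"
    using Suc.IH[of i] Suc.prems by (simp add: AA v_def)
  ultimately have "eqv \<Gamma> (1 + (8 * 2 ^ K + (1 + 20 * (2 ^ K * 2 ^ K) + 1) + 1) + 1 + 1 + 1 +
      (12 * 2 ^ K * (12 * 2 ^ K) ^ K + 60 * (2 ^ K * 2 ^ K) * r) + 1)
      (pxor (solv M t (Suc r) i) (mvec A (solv M t (Suc r)) i)) (t i)"
    by (blast intro: eqv_trans)
  then show ?case unfolding A_def
  proof (rule eqv_le)
    have "1 * 1 \<le> 2 ^ K * (2 ^ K :: nat)" "1 * 2 ^ K \<le> 2 ^ K * (2 ^ K :: nat)" by (intro mult_le_mono; simp)+
    then show "1 + (8 * 2 ^ K + (1 + 20 * (2 ^ K * 2 ^ K) + 1) + 1) + 1 + 1 + 1 +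
      (12 * 2 ^ K * (12 * 2 ^ K) ^ K + 60 * (2 ^ K * 2 ^ K) * r) + 1
      \<le> 12 * 2 ^ K * (12 * 2 ^ K) ^ K + 60 * (2 ^ K * 2 ^ K) * Suc r"
      unfolding mult_Suc_right by linarith
  qed
qed

end

section \<open>Accumulating derived facts\<close>

context short_derivations
begin

text \<open>Facts kept in \<open>\<Gamma>'\<close> are paid for once and then used freely. Chaining
  equivalences alone would pay again at every use.\<close>

definition grow :: "pform set \<Rightarrow> nat \<Rightarrow> pform set \<Rightarrow> bool" where
  "grow \<Gamma> L \<Gamma>' \<longleftrightarrow> \<Gamma> \<subseteq> \<Gamma>' \<and> ext \<Gamma> L \<Gamma>'"

lemma grow_refl: "grow \<Gamma> L \<Gamma>"
  by (simp add: grow_def ext_subset)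

lemma grow_subset: "grow \<Gamma> L \<Gamma>' \<Longrightarrow> \<Gamma> \<subseteq> \<Gamma>'"
  by (simp add: grow_def)

lemma grow_le: "grow \<Gamma> L \<Gamma>' \<Longrightarrow> L \<le> L' \<Longrightarrow> grow \<Gamma> L' \<Gamma>'"
  unfolding grow_def by (blast intro: ext_mono)

lemma grow_trans:
  assumes "grow \<Gamma> L \<Gamma>'" "grow \<Gamma>' L' \<Gamma>''"
  shows "grow \<Gamma> (L + L') \<Gamma>''"
proof -
  have "\<Gamma> \<union> \<Gamma>' = \<Gamma>'" using assms by (auto simp: grow_def)
  then show ?thesis
    using assms ext_trans[of \<Gamma> L \<Gamma>' L' \<Gamma>''] unfolding grow_def by auto
qed

lemma grow_Un: "ext \<Gamma> L \<Delta> \<Longrightarrow> grow \<Gamma> L (\<Gamma> \<union> \<Delta>)"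
  using ext_Un[of \<Gamma> 0 \<Gamma> L \<Delta>] by (simp add: grow_def ext_subset)

lemma grow_insert: "eqv \<Gamma> L a b \<Longrightarrow> grow \<Gamma> L (insert (piff a b) \<Gamma>)"
  using grow_Un[of \<Gamma> L "{piff a b}"] by (simp add: eqv_def pr_def)

lemma grow_eqv: "grow \<Gamma> L \<Gamma>' \<Longrightarrow> eqv \<Gamma>' L' a b \<Longrightarrow> eqv \<Gamma> (L + L') a b"
  using ext_trans[of \<Gamma> L \<Gamma>' L'] unfolding grow_def eqv_def pr_def
  by (metis sup.absorb_iff2)

end

section \<open>Selected sums of node values and the Boolean solution of a program\<close>

context xor_sums
begin

text \<open>The propositional counterpart of \<open>comb\<close>: the vector \<open>u\<close>
  selects the summands. The tree always has depth \<open>K\<close>, so any two such sums have the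
  same shape.\<close>

definition bs :: "(nat \<Rightarrow> pform) \<Rightarrow> (nat \<Rightarrow> bit) \<Rightarrow> pform" where
  "bs z u = bx K (\<lambda>i. if u i = 1 then z i else PFalse)"

lemma psize_bs:
  assumes "\<And>i. psize (z i) \<le> b"
  shows "psize (bs z u) + 2 \<le> 4 ^ K * (b + 3)"
  unfolding bs_def by (rule psize_bx) (use assms le_Suc_eq in auto)

lemma bs_small:
  assumes "\<And>i. psize (z i) \<le> a"
  shows "psize (bs z u) \<le> m"
  unfolding bs_def by (rule bx_small) (auto intro!: order_trans[OF assms])

lemma pxor_bs_small:
  assumes "\<And>i. psize (z i) \<le> a"
  shows "psize (pxor (bs z u) (bs z v)) \<le> m"
  unfolding bs_def by (rule pxor_bx_small) (auto intro!: order_trans[OF assms])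

lemma bs_cong: "(\<And>i. i < 2 ^ K \<Longrightarrow> u i = 1 \<Longrightarrow> z i = z' i) \<Longrightarrow> bs z u = bs z' u"
  unfolding bs_def by (rule bx_cong) auto

text \<open>The equivalences hold for every \<open>\<Gamma>\<close>, in particular the empty one:
  the formulas satisfy the recurrence outright, whatever leaves \<open>g\<close> of size 1 are
  taken.\<close>

lemma boolean_program:
  assumes S: "\<And>i j. i \<le> j \<Longrightarrow> S i j = (0::bit)" and g: "\<And>i. psize (g i) \<le> 1"
    and a: "(32 * 4 ^ K) ^ (2 * K) \<le> a"
  shows "\<exists>z. (\<forall>i. psize (z i) \<le> (32 * 4 ^ K) ^ (2 * K)) \<and>
    (\<forall>\<Gamma>. eqv \<Gamma> (12 * 2 ^ K * (12 * 2 ^ K) ^ K + 60 * (2 ^ K * 2 ^ K) * K + 30 * 2 ^ K) (z 0) PTrue) \<and>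
    (\<forall>\<Gamma> i. 0 < i \<and> i < 2 ^ K \<longrightarrow>
      eqv \<Gamma> (12 * 2 ^ K * (12 * 2 ^ K) ^ K + 60 * (2 ^ K * 2 ^ K) * K + 30 * 2 ^ K)
        (z i) (PAnd (g i) (bs z (S i))))"
proof -
  \<comment> \<open>With these choices the recurrence reads \<open>z = t + M z\<close>:
    \<open>t\<close> supplies the value 1 of node \<open>0\<close>, and row \<open>i\<close> of
    \<open>M\<close> is row \<open>i\<close> of \<open>S\<close> multiplied by
    \<open>g i\<close>.\<close>
  define M where "M i j = (if S i j = 1 then g i else PFalse)" for i j
  define t where "t i = (if i = (0::nat) then PTrue else PFalse)" for i
  define z where "z = solv M t K"
  define L where "L = 12 * 2 ^ K * (12 * 2 ^ K) ^ K + 60 * (2 ^ K * 2 ^ K) * K"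
  have M: "M i j = PFalse" if "i \<le> j" for i j using S[OF that] by (simp add: M_def)
  have M1: "psize (M i j) \<le> 1" for i j using g[of i] by (simp add: M_def)
  have t1: "psize (t i) \<le> 1" for i by (simp add: t_def)
  have zb: "psize (z i) \<le> (32 * 4 ^ K) ^ (2 * K)" for i
    unfolding z_def by (rule order_trans[OF psize_solv[OF M1 t1 order_refl]]) (simp add: mult_2)
  have z: "psize (z i) \<le> a" for i using zb[of i] a by linarith
  have g': "psize (g i) \<le> 1" for i by (fact g)
  have tM: "psize (pxor (t i) (mvec M z i)) \<le> m" for i
  proof -
    have "psize (pxor (bx K (\<lambda>j. PFalse)) (mvec M z i)) \<le> m"
      unfolding mvec_def using M1 z
      by (intro pxor_bx_small order_trans[OF psize_PAnd_le[of _ 1 _ a]]) auto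
    then show ?thesis using t1[of i] psize_pos[of "bx K (\<lambda>j. PFalse)"] by simp
  qed
  have tM': "psize (mvec M z i) \<le> m" for i using tM[of i] by simp
  \<comment> \<open>The solver gives \<open>z + M z = t\<close>; moving one summand across turns it
    into the recurrence.\<close>
  have main: "eqv \<Gamma> (L + 1) (z i) (pxor (t i) (mvec M z i))" if "i < 2 ^ K" for \<Gamma> i
    using eqv_solv[OF M M1 t1 a order_refl that, where \<Gamma> = \<Gamma>] tM[of i]
    unfolding z_def L_def by (intro eqv_pxor_move) auto
  have bF: "psize (bx K (\<lambda>j. PFalse)) \<le> m" by (rule bx_small) simp
  have "eqv \<Gamma> (L + 30 * 2 ^ K) (z 0) PTrue" for \<Gamma>
  proof -
    have M0: "M 0 j = PFalse" for j by (rule M) simp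
    have "eqv \<Gamma> 1 (PAnd (M 0 j) (z j)) PFalse" for j
      using z[of j] room0 unfolding M0 by (intro eqv_PAnd_False) simp
    then have "eqv \<Gamma> (tcost 1 1 K + tcost 1 4 K + 1) (mvec M z 0) PFalse"
      using tM'[of 0] bF unfolding mvec_def by (intro eqv_trans[OF eqv_bx_cong eqv_bx_False])
    from eqv_pxor[OF eqv_refl[of "t 0" 1] this] have
      "eqv \<Gamma> (1 + (tcost 1 1 K + tcost 1 4 K + 1) + 1) (pxor (t 0) (mvec M z 0)) (pxor PTrue PFalse)"
      using tM[of 0] room0 by (simp add: t_def)
    moreover have "eqv \<Gamma> 1 (pxor PTrue PFalse) PTrue"
      using room0 by (intro eqv_pxor_False) simp
    ultimately have "eqv \<Gamma> (L + 1 + (1 + (tcost 1 1 K + tcost 1 4 K + 1) + 1) + 1 + 1 + 1) (z 0) PTrue"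
      using eqv_trans[OF eqv_trans[OF main]] by (simp del: One_nat_def)
    then show ?thesis using tcost_1[of 1 1] tcost_14 by (elim eqv_le) simp
  qed
  moreover have "eqv \<Gamma> (L + 30 * 2 ^ K) (z i) (PAnd (g i) (bs z (S i)))" if i: "0 < i" "i < 2 ^ K" for \<Gamma> i
  proof -
    let ?y = "\<lambda>j. if S i j = 1 then z j else PFalse"
    have ti: "t i = PFalse" using i by (simp add: t_def)
    have 1: "eqv \<Gamma> 1 (pxor (t i) (mvec M z i)) (mvec M z i)"
      using tM[of i] unfolding ti by (intro eqv_pxor_False)
    have "eqv \<Gamma> (1 + (1 + 1) + 1) (PAnd (M i j) (z j)) (PAnd (g i) (?y j))" for j
    proof (cases "S i j = 1")
      case True
      then show ?thesis using z[of j] g'[of i] room0 by (simp add: M_def eqv_refl)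
    next
      case False
      then have "eqv \<Gamma> 1 (PAnd (M i j) (z j)) PFalse" "eqv \<Gamma> 1 (PAnd (g i) (?y j)) PFalse"
        using z[of j] g'[of i] room0 eqv_PAnd_False[of "z j" \<Gamma>] eqv_PAnd_False[of "g i" \<Gamma>]
        by (simp_all add: M_def)
      then show ?thesis by (blast intro: eqv_trans eqv_sym)
    qed
    moreover have s: "psize (bx K (\<lambda>j. PAnd (g i) (?y j))) \<le> m"
    proof (rule bx_small)
      fix j show "psize (PAnd (g i) (?y j)) \<le> 16 * a + 62"
        using g'[of i] z[of j] by simp
    qed
    ultimately have "eqv \<Gamma> (tcost (1 + (1 + 1) + 1) 1 K + tcost 1 4 K + 1) (mvec M z i) (PAnd (g i) (bs z (S i)))"
      unfolding mvec_def bs_def using tM'[of i] unfolding mvec_def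
      by (intro eqv_trans[OF eqv_bx_cong eqv_bx_PAnd_left])
    from eqv_trans[OF eqv_trans[OF main[OF i(2)] 1] this]
    show ?thesis using tcost_1[of "1 + (1 + 1) + 1" 4] tcost_14 by (elim eqv_le) simp
  qed
  ultimately show ?thesis using zb unfolding L_def by blast
qed

lemma tcost_8: "tcost 1 (8 * 2 ^ K + 3) K \<le> 2 ^ K * (8 * 2 ^ K + 4)"
proof -
  have "1 + (8 * 2 ^ K + 3) = (8 * 2 ^ K + 4 :: nat)" by simp
  then show ?thesis using tcost_le[of 1 "8 * 2 ^ K + 3" K] by (simp only: add_leD1)
qed

section \<open>Linear relations between the values of a program\<close>

lemma eqv_bs_zero: "eqv \<Gamma> (5 * 2 ^ K) (bs z (\<lambda>i. 0)) PFalse"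
proof -
  have "psize (bx K (\<lambda>i. PFalse)) \<le> m" by (rule bx_small) simp
  then have "eqv \<Gamma> (tcost 1 4 K) (bs z (\<lambda>i. 0)) PFalse"
    unfolding bs_def by (simp add: eqv_bx_False del: One_nat_def)
  then show ?thesis using tcost_14 by (elim eqv_le) simp
qed

lemma eqv_bs_single:
  assumes "j < 2 ^ K" "psize (z j) \<le> a"
  shows "eqv \<Gamma> (5 * 2 ^ K) (bs z (\<lambda>i. if i = j then 1 else 0)) (z j)"
proof -
  have eq: "bs z (\<lambda>i. if i = j then 1 else 0) = bx K (\<lambda>i. if i = j then z j else PFalse)"
    unfolding bs_def by (rule bx_cong) auto
  have "psize (bx K (\<lambda>i. if i = j then z j else PFalse)) \<le> m"
    by (rule bx_small) (use assms in auto)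
  then have "eqv \<Gamma> (tcost 1 4 K) (bs z (\<lambda>i. if i = j then 1 else 0)) (z j)"
    unfolding eq using assms(1) by (rule eqv_bx_single)
  then show ?thesis using tcost_14 by (elim eqv_le) simp
qed

lemma eqv_bs_plus:
  assumes z: "\<And>i. psize (z i) \<le> a"
  shows "eqv \<Gamma> (8 * 2 ^ K) (bs z (\<lambda>i. u i + v i)) (pxor (bs z u) (bs z v))"
proof -
  let ?f = "\<lambda>w i. if w i = (1::bit) then z i else PFalse"
  have z': "psize (z i) \<le> a" for i by (fact z)
  have p: "eqv \<Gamma> 2 (?f (\<lambda>i. u i + v i) i) (pxor (?f u i) (?f v i))" for i
  proof -
    have "psize (pxor (z i) (z i)) \<le> m" "psize (pxor PFalse (z i)) \<le> m" "psize (pxor PFalse PFalse) \<le> m"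
      using z'[of i] room0 by simp_all
    from eqv_sym[OF eqv_pxor_self[OF this(1), of \<Gamma>]] eqv_sym[OF eqv_pxor_False(1)[OF this(2), of \<Gamma>]]
      eqv_sym[OF eqv_pxor_False(2)[OF this(2), of \<Gamma>]] eqv_sym[OF eqv_pxor_False(1)[OF this(3), of \<Gamma>]]
    show ?thesis by (cases "u i"; cases "v i") (simp_all add: numeral_2_eq_2)
  qed
  have "psize (pxor (?f u i) (?f v i)) \<le> 16 * a + 62" for i
    using z'[of i] by auto
  then have s: "psize (bx K (\<lambda>i. pxor (?f u i) (?f v i))) \<le> m" by (rule bx_small)
  have "eqv \<Gamma> (tcost 2 1 K + tcost 1 4 K + 1) (bs z (\<lambda>i. u i + v i)) (pxor (bs z u) (bs z v))"
    using p s bs_small[OF z] pxor_bs_small[OF z] unfolding bs_def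
    by (intro eqv_trans[OF eqv_bx_cong eqv_bx_pxor]) 
  then show ?thesis using tcost_1[of 2 2] tcost_14 by (elim eqv_le) simp
qed

lemma eqv_bx_bs:
  assumes z: "\<And>i. psize (z i) \<le> a" and s: "psize (bx k (\<lambda>i. bs z (U i))) \<le> m"
  shows "eqv \<Gamma> (tcost 1 (8 * 2 ^ K + 3) k) (bx k (\<lambda>i. bs z (U i))) (bs z (\<lambda>j. \<Sum>i<2 ^ k. U i j))"
  using s
proof (induction k arbitrary: U)
  case 0
  then show ?case using bs_small[OF z] by (simp add: eqv_refl)
next
  case (Suc k)
  let ?u = "\<lambda>j. \<Sum>i<2 ^ k. U i j" and ?v = "\<lambda>j. \<Sum>i<2 ^ k. U (i + 2 ^ k) j"
  have IH: "eqv \<Gamma> (tcost 1 (8 * 2 ^ K + 3) k) (bx k (\<lambda>i. bs z (U i))) (bs z ?u)"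
    "eqv \<Gamma> (tcost 1 (8 * 2 ^ K + 3) k) (bx k (\<lambda>i. bs z (U (i + 2 ^ k)))) (bs z ?v)"
    by (rule Suc.IH; use Suc.prems in simp)+
  have "eqv \<Gamma> (tcost 1 (8 * 2 ^ K + 3) k + tcost 1 (8 * 2 ^ K + 3) k + 1 + (8 * 2 ^ K + 1) + 1)
    (bx (Suc k) (\<lambda>i. bs z (U i))) (bs z (\<lambda>j. ?u j + ?v j))"
    unfolding bx.simps using Suc.prems pxor_bs_small[OF z]
    by (intro eqv_trans[OF eqv_pxor[OF IH] eqv_sym[OF eqv_bs_plus]] z) auto
  then show ?case unfolding sum_lessThan_double by (rule eqv_le) simp
qed

text \<open>The propositional counterpart of \<open>comb_comb\<close>: if the selected
  \<open>y i\<close> are sums of the \<open>z j\<close>, then so is their own sum, with the composed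
  coefficient vector.\<close>

lemma eqv_bs_comb:
  assumes z: "\<And>i. psize (z i) \<le> a" and y: "\<And>i. psize (y i) \<le> a"
    and eq: "\<And>i. i < 2 ^ K \<Longrightarrow> u i = 1 \<Longrightarrow> eqv \<Gamma> (6 * 2 ^ K) (y i) (bs z (U i))"
  shows "eqv \<Gamma> (25 * (2 ^ K * 2 ^ K)) (bs y u) (bs z (\<lambda>j. \<Sum>i<2 ^ K. u i * U i j))"
proof -
  have p: "eqv \<Gamma> (6 * 2 ^ K) (if u i = 1 then y i else PFalse) (bs z (\<lambda>j. u i * U i j))"
    if "i < 2 ^ K" for i
  proof (cases "u i = 1")
    case True
    then show ?thesis using eq[OF that True] by simp
  next
    case False
    then have "eqv \<Gamma> (5 * 2 ^ K + 1) PFalse (bs z (\<lambda>j. u i * U i j))"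
      using eqv_sym[OF eqv_bs_zero] by simp
    then show ?thesis using False by (auto elim!: eqv_le)
  qed
  have "psize (bx K (\<lambda>i. bs z (\<lambda>j. u i * U i j))) \<le> m"
    unfolding bs_def by (rule bx_bx_small) (auto intro!: order_trans[OF z])
  then have "eqv \<Gamma> (tcost (6 * 2 ^ K) 1 K + tcost 1 (8 * 2 ^ K + 3) K + 1)
     (bs y u) (bs z (\<lambda>j. \<Sum>i<2 ^ K. u i * U i j))"
    using p bs_small[of y u, OF y] z unfolding bs_def[of y u]
    by (intro eqv_trans[OF eqv_bx_cong eqv_bx_bs])
  then show ?thesis
  proof (rule eqv_le)
    define D where "D = (2 ^ K :: nat)"
    have D: "1 \<le> D" by (simp add: D_def)
    have "tcost (6 * D) 1 K + 1 \<le> D * (6 * D + 1)"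
      unfolding D_def by (rule tcost_1) simp
    moreover have "tcost 1 (8 * D + 3) K \<le> D * (8 * D + 4)"
      unfolding D_def by (rule tcost_8)
    moreover have "D * (6 * D + 1) + D * (8 * D + 4) \<le> 25 * (D * D)"
      using mult_le_mono2[OF D, of D] by (simp add: algebra_simps)
    ultimately show "tcost (6 * 2 ^ K) 1 K + tcost 1 (8 * 2 ^ K + 3) K + 1 \<le> 25 * (2 ^ K * 2 ^ K)"
      unfolding D_def by linarith
  qed
qed

end

section \<open>Polynomial nodes paired with Boolean values\<close>

fun btr :: "('v \<Rightarrow> pform) \<Rightarrow> 'v ncformula \<Rightarrow> pform" where
  "btr g (NVar v) = g v"
| "btr g (NConst c) = (if c = 1 then PTrue else PFalse)"
| "btr g (NAdd e f) = pxor (btr g e) (btr g f)"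
| "btr g (NMul e f) = PAnd (btr g e) (btr g f)"

context xor_sums
begin

text \<open>Ties polynomials \<open>p\<close> to formulas \<open>z\<close>: wherever a node
  satisfies a recurrence as a polynomial, \<open>\<Gamma>\<close> contains the same recurrence, with
  the same row, for its Boolean value. Rows have the fixed width \<open>2 ^ K\<close> for the sake
  of \<open>bs\<close>, and their vanishing from \<open>i\<close> on keeps the system
  acyclic.\<close>

definition sys :: "('v \<Rightarrow> pform) \<Rightarrow> pform set \<Rightarrow> nat \<Rightarrow> (nat \<Rightarrow> 'v ncpoly) \<Rightarrow> (nat \<Rightarrow> pform) \<Rightarrow> bool" where
  "sys g \<Gamma> n p z \<longleftrightarrow> 1 \<le> n \<and> n \<le> 2 ^ K \<and> p 0 = nc_const 1 \<and> z 0 = PTrue \<and> (\<forall>i. psize (z i) \<le> a) \<and>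
    (\<forall>i. 0 < i \<and> i < n \<longrightarrow> (\<exists>x S. (\<forall>j\<ge>i. S j = 0) \<and>
       p i = nc_mul (nc_var x) (comb (2 ^ K) S p) \<and> piff (z i) (PAnd (g x) (bs z S)) \<in> \<Gamma>))"

text \<open>Relations are derived along increasing support. A relation ending in \<open>b\<close> may be assumed to
  involve only nodes carrying one letter \<open>x\<close>; stripping \<open>x\<close> gives a relation among earlier nodes.
  Only one relation per \<open>b\<close> needs to be kept.\<close>

lemma relations_derivable:
  assumes sys: "sys g \<Gamma> n p z" and g: "\<And>x. psize (g x) \<le> 1"
  shows "b \<le> n \<Longrightarrow> \<exists>\<Gamma>'. grow \<Gamma> (60 * (2 ^ K * 2 ^ K) * b) \<Gamma>' \<and>
    (\<forall>u. (\<forall>i\<ge>b. u i = 0) \<and> comb (2 ^ K) u p = (\<lambda>w. 0) \<longrightarrow>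
      eqv \<Gamma>' (5 * 2 ^ K + 12 * 2 ^ K * b) (bs z u) PFalse)"
proof (induction b)
  case 0
  have "eqv \<Gamma> (5 * 2 ^ K) (bs z u) PFalse" if "\<forall>i. u i = 0" for u
  proof -
    have "u = (\<lambda>i. 0)" using that by auto
    then show ?thesis by (simp add: eqv_bs_zero)
  qed
  then show ?case using grow_refl[of \<Gamma>] by (intro exI[of _ \<Gamma>]) (auto simp del: bit_not_zero_iff)
next
  case (Suc b)
  let ?D = "2 ^ K :: nat"
  have n: "n \<le> ?D" and z: "\<And>i. psize (z i) \<le> a" and p0: "p 0 = nc_const 1"
    using sys by (auto simp: sys_def)
  obtain \<Gamma>' where \<Gamma>': "grow \<Gamma> (60 * (?D * ?D) * b) \<Gamma>'"
    and rel: "\<And>u. \<forall>i\<ge>b. u i = 0 \<Longrightarrow> comb ?D u p = (\<lambda>w. 0) \<Longrightarrow>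
      eqv \<Gamma>' (5 * ?D + 12 * ?D * b) (bs z u) PFalse"
    using Suc by auto
  show ?case
  proof (cases "\<exists>r. (\<forall>i\<ge>Suc b. r i = 0) \<and> comb ?D r p = (\<lambda>w. 0) \<and> r b = 1")
    case False
    have "eqv \<Gamma>' (5 * ?D + 12 * ?D * Suc b) (bs z u) PFalse"
      if u: "\<forall>i\<ge>Suc b. u i = 0" "comb ?D u p = (\<lambda>w. 0)" for u
    proof -
      have "u b = 0" using False u by (metis bit_not_one_iff)
      then have "\<forall>i\<ge>b. u i = 0" using u(1) by (metis le_antisym not_less_eq_eq)
      from rel[OF this u(2)] show ?thesis by (rule eqv_le) simp
    qed
    moreover have "grow \<Gamma> (60 * (?D * ?D) * Suc b) \<Gamma>'"
      using \<Gamma>' by (rule grow_le) simp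
    ultimately show ?thesis by blast
  next
    case True
    then obtain r where r: "\<forall>i\<ge>Suc b. r i = 0" "comb ?D r p = (\<lambda>w. 0)" "r b = 1" by blast
    have "\<forall>i\<in>{0<..<n}. \<exists>x S. (\<forall>j\<ge>i. S j = 0) \<and>
       p i = nc_mul (nc_var x) (comb ?D S p) \<and> piff (z i) (PAnd (g x) (bs z S)) \<in> \<Gamma>"
      using sys by (simp add: sys_def)
    then obtain xx SS where node: "\<And>i. 0 < i \<Longrightarrow> i < n \<Longrightarrow> (\<forall>j\<ge>i. SS i j = 0) \<and>
       p i = nc_mul (nc_var (xx i)) (comb ?D (SS i) p) \<and> piff (z i) (PAnd (g (xx i)) (bs z (SS i))) \<in> \<Gamma>"
      by (metis greaterThanLessThan_iff)
    have p_Nil: "p i [] = 0" if "0 < i" "i < n" for i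
      using node[OF that] by (simp add: nc_mul_var)
    have p_Cons: "p i (v # w) = (if v = xx i then comb ?D (SS i) p w else 0)" if "0 < i" "i < n" for i v w
      using node[OF that] by (simp add: nc_mul_var)
    have rn: "i < n" if "r i \<noteq> 0" for i
      using r(1) that Suc.prems by (metis not_less_eq_eq order_less_le_trans not_le)
    \<comment> \<open>Only node \<open>0\<close> has a nonzero coefficient at the empty word, so it
      cannot take part in a relation.\<close>
    have "comb ?D r p [] = (\<Sum>j<?D. if j = 0 then r 0 else 0)"
      unfolding comb_def
    proof (intro sum.cong refl)
      fix j show "r j * p j [] = (if j = 0 then r 0 else 0)"
        using p_Nil[of j] rn[of j] p0 by (cases "r j") (auto simp: nc_const_def)
    qed
    then have r0: "r 0 = 0" using r(2) by simp
    have b0: "0 < b" using r0 r(3) by (cases b) auto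
    \<comment> \<open>Words starting with \<open>xx b\<close> receive contributions only from nodes
      carrying that letter, and all other words receive none from these nodes; hence the restriction
      is again a relation. The guard \<open>i \<noteq> 0\<close> is there because node
      \<open>0\<close> has no letter and \<open>xx 0\<close> is arbitrary.\<close>
    define r' where "r' i = (if i \<noteq> 0 \<and> xx i = xx b then r i else 0)" for i
    \<comment> \<open>The relation after the common letter is removed, expressed through the rows of
      the nodes. Since row \<open>i\<close> vanishes from \<open>i\<close> on and only
      \<open>i \<le> b\<close> occur, it lives below \<open>b\<close> and the induction hypothesis
      applies.\<close>
    define q where "q j = (\<Sum>i<?D. r' i * SS i j)" for j
    have r'_Cons: "comb ?D r' p (v # w) = (if v = xx b then comb ?D r p (v # w) else 0)" for v w
    proof -
      have "r' i * p i (v # w) = (if v = xx b then r i * p i (v # w) else 0)" for i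
      proof (cases "r i = 0 \<or> i = 0")
        case True
        then show ?thesis using r0 by (auto simp: r'_def)
      next
        case False
        then have "0 < i" "i < n" using rn[of i] by auto
        from p_Cons[OF this] show ?thesis using False by (auto simp: r'_def)
      qed
      then show ?thesis by (simp add: comb_def)
    qed
    have r'_Nil: "comb ?D r' p [] = 0"
      unfolding comb_def
    proof (intro sum.neutral ballI)
      fix j show "r' j * p j [] = 0"
        using p_Nil[of j] rn[of j] by (cases "r j") (auto simp: r'_def)
    qed
    have r': "comb ?D r' p w = 0" for w
      by (cases w) (simp_all add: r'_Nil r'_Cons r(2))
    have r'_nz: "0 < i \<and> i \<le> b \<and> xx i = xx b" if "r' i = 1" for i
      using that r(1) by (metis bit_not_one_iff neq0_conv not_less_eq_eq r'_def)
    have q0: "comb ?D q p = (\<lambda>w. 0)"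
    proof
      fix w
      have "comb ?D q p w = comb ?D r' (\<lambda>i. comb ?D (SS i) p) w"
        by (simp add: comb_comb q_def[abs_def])
      also have "\<dots> = comb ?D r' p (xx b # w)"
        unfolding comb_def[of ?D r']
      proof (intro sum.cong refl)
        fix i show "r' i * comb ?D (SS i) p w = r' i * p i (xx b # w)"
          using r'_nz[of i] p_Cons[of i "xx b" w] Suc.prems by (cases "r' i") auto
      qed
      finally show "comb ?D q p w = 0" by (simp add: r')
    qed
    have qb: "\<forall>j\<ge>b. q j = 0"
    proof (intro allI impI)
      fix j assume j: "b \<le> j"
      show "q j = 0" unfolding q_def
      proof (intro sum.neutral ballI)
        fix i show "r' i * SS i j = 0"
          using r'_nz[of i] node[of i] j Suc.prems by (cases "r' i") auto
      qed
    qed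
    have gs: "psize (g x) \<le> 1" for x by (fact g)
    let ?G = "g (xx b)"
    let ?e = "\<lambda>i. bs z (\<lambda>j. r' i * SS i j)"
    have bsz: "psize (bs z u) + 2 \<le> 4 ^ K * (a + 3)" for u by (rule psize_bs[OF z])
    have Gbs: "psize (PAnd ?G (bs z u)) \<le> 4 ^ K * (a + 3)" for u
      using bsz[of u] gs[of "xx b"] by simp
    have Gbs_m: "psize (PAnd ?G (bs z u)) \<le> m" for u
      using Gbs[of u] mult_le_mono2[of "a + 3" "16 * a + 64" "4 ^ K"] room1 by linarith
    have bxG: "psize (bx K (\<lambda>i. PAnd ?G (?e i))) \<le> m"
    proof -
      have "psize (bx K (\<lambda>i. PAnd ?G (?e i))) + 2 \<le> 4 ^ K * (4 ^ K * (a + 5))"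
      proof (rule psize_bx)
        fix i
        have "psize (PAnd ?G (?e i)) + 2 \<le> 4 ^ K * (a + 3) + 4 ^ K * 2"
          using Gbs[of "\<lambda>j. r' i * SS i j"] le_pow4[of 2] by linarith
        then show "psize (PAnd ?G (?e i)) + 2 \<le> 4 ^ K * (a + 5)" by (simp add: distrib_left)
      qed
      moreover have "4 ^ K * (4 ^ K * (a + 5)) \<le> 4 ^ K * (4 ^ K * (16 * a + 64))"
        by (intro mult_le_mono2) simp
      ultimately show ?thesis using room2 by linarith
    qed
    have bxe: "psize (bx K ?e) \<le> m"
    proof -
      have "psize (bx K ?e) + 2 \<le> 4 ^ K * (4 ^ K * (a + 3))"
        using bsz by (intro psize_bx)
      moreover have "4 ^ K * (4 ^ K * (a + 3)) \<le> 4 ^ K * (4 ^ K * (16 * a + 64))"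
        by (intro mult_le_mono2) simp
      ultimately show ?thesis using room2 by linarith
    qed
    \<comment> \<open>All selected nodes share the factor \<open>?G\<close>. Unselected leaves are
      rewritten as \<open>?G\<close> times an empty sum, so that the factor can be pulled out of the
      whole tree.\<close>
    have pw: "eqv \<Gamma>' (5 * ?D + 5) (if r' i = 1 then z i else PFalse) (PAnd ?G (?e i))" for i
    proof (cases "r' i = 1")
      case True
      then have "piff (z i) (PAnd ?G (bs z (SS i))) \<in> \<Gamma>'"
        using r'_nz[OF True] node[of i] Suc.prems grow_subset[OF \<Gamma>'] by auto
      then have "eqv \<Gamma>' (5 * ?D + 5) (z i) (PAnd ?G (bs z (SS i)))"
        using Gbs_m z[of i] room0 by (intro eqv_member) auto
      then show ?thesis using True by simp
    next
      case False
      then have e: "?e i = bs z (\<lambda>j. 0)" by simp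
      have "eqv \<Gamma>' (1 + 5 * ?D + 1 + 1 + 1) (PAnd ?G (?e i)) PFalse"
        unfolding e using Gbs_m gs[of "xx b"] room0
        by (intro eqv_trans[OF eqv_PAnd[OF eqv_refl eqv_bs_zero] eqv_PAnd_False(2)]) auto
      from eqv_sym[OF this] show ?thesis using False by (auto elim!: eqv_le)
    qed
    have 1: "eqv \<Gamma>' (tcost (5 * ?D + 5) 1 K + tcost 1 4 K + 1) (bs z r') (PAnd ?G (bx K ?e))"
      unfolding bs_def[of z r']
      using bs_small[of z r', OF z, unfolded bs_def] bxG pw
      by (intro eqv_trans[OF eqv_bx_cong eqv_bx_PAnd_left])
    have 2: "eqv \<Gamma>' (tcost 1 (8 * ?D + 3) K) (bx K ?e) (bs z q)"
      unfolding q_def[abs_def] using z bxe by (rule eqv_bx_bs)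
    have 3: "eqv \<Gamma>' (tcost 1 (8 * ?D + 3) K + (5 * ?D + 12 * ?D * b) + 1) (bx K ?e) PFalse"
      by (rule eqv_trans[OF 2 rel[OF qb q0]])
    have Ge: "psize (PAnd ?G (bx K ?e)) \<le> m"
      using eqv_size(2)[OF 1] .
    have "eqv \<Gamma>' (1 + (tcost 1 (8 * ?D + 3) K + (5 * ?D + 12 * ?D * b) + 1) + 1 + 1 + 1)
       (PAnd ?G (bx K ?e)) PFalse"
      using Ge gs[of "xx b"] room0
      by (intro eqv_trans[OF eqv_PAnd[OF eqv_refl 3] eqv_PAnd_False(2)]) auto
    from eqv_trans[OF 1 this] have rr: "eqv \<Gamma>' (60 * (?D * ?D)) (bs z r') PFalse"
    proof (rule eqv_le)
      define D where "D = ?D"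
      have D: "1 \<le> D" by (simp add: D_def)
      have "tcost (5 * D + 5) 1 K + 1 \<le> D * (5 * D + 5 + 1)"
        unfolding D_def by (rule tcost_1) simp
      moreover have "tcost 1 (8 * D + 3) K \<le> D * (8 * D + 4)"
        unfolding D_def by (rule tcost_8)
      moreover have "tcost 1 4 K + 4 \<le> 5 * D" unfolding D_def by (rule tcost_14)
      moreover have "12 * D * b \<le> 12 * (D * D)" using Suc.prems n unfolding D_def by simp
      moreover define E where "E = D * D"
      moreover have "1 \<le> E" "D \<le> E" using D unfolding E_def by simp_all
      moreover have "D * (5 * D + 5 + 1) = 5 * E + 6 * D" "D * (8 * D + 4) = 8 * E + 4 * D"
        unfolding E_def by (simp_all add: algebra_simps)
      ultimately show "tcost (5 * ?D + 5) 1 K + tcost 1 4 K + 1 + (1 + (tcost 1 (8 * ?D + 3) K +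
          (5 * ?D + 12 * ?D * b) + 1) + 1 + 1 + 1) + 1 \<le> 60 * (?D * ?D)"
        unfolding D_def[symmetric] E_def[symmetric] by linarith
    qed
    \<comment> \<open>Only the fact about \<open>r'\<close> is stored. Any other relation ending in
      \<open>b\<close> reduces to a single one ending earlier, so the cost of reaching it grows
      linearly with \<open>b\<close> and does not branch.\<close>
    let ?\<Gamma> = "insert (piff (bs z r') PFalse) \<Gamma>'"
    have "grow \<Gamma> (60 * (?D * ?D) * b + 60 * (?D * ?D)) ?\<Gamma>"
      by (rule grow_trans[OF \<Gamma>' grow_insert[OF rr]])
    moreover have "eqv ?\<Gamma> (5 * ?D + 12 * ?D * Suc b) (bs z u) PFalse"
      if u: "\<forall>i\<ge>Suc b. u i = 0" "comb ?D u p = (\<lambda>w. 0)" for u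
    proof (cases "u b = 0")
      case True
      then have "\<forall>i\<ge>b. u i = 0" using u(1) by (metis le_antisym not_less_eq_eq)
      from eqv_mono[OF rel[OF this u(2)]] show ?thesis by (rule eqv_mono) auto
    next
      case False
      \<comment> \<open>Both vectors have entry 1 at \<open>b\<close>, so their sum is a relation
        supported below \<open>b\<close>.\<close>
      define u' where "u' i = u i + r' i" for i
      have "r' b = 1" using r(3) b0 by (simp add: r'_def)
      then have "u' b = 0" using False by (simp add: u'_def)
      moreover have "u' i = 0" if "Suc b \<le> i" for i
        using that u(1) r(1) by (simp add: u'_def r'_def)
      ultimately have s: "\<forall>i\<ge>b. u' i = 0" by (metis le_antisym not_less_eq_eq)
      have "comb ?D u' p = (\<lambda>w. 0)"
        unfolding u'_def comb_plus by (simp add: nc_add_def u(2) r')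
      from rel[OF s this] have f: "eqv ?\<Gamma> (5 * ?D + 12 * ?D * b) (bs z u') PFalse"
        by (rule eqv_mono) auto
      have "u = (\<lambda>i. u' i + r' i)" by (auto simp: u'_def add.assoc)
      then have "eqv ?\<Gamma> (8 * ?D) (bs z u) (pxor (bs z u') (bs z r'))"
        using eqv_bs_plus[of z ?\<Gamma> u' r', OF z] by simp
      moreover have "eqv ?\<Gamma> (5 * ?D + 12 * ?D * b + 0 + 1) (pxor (bs z u') (bs z r')) (pxor PFalse PFalse)"
      proof (rule eqv_pxor[OF f])
        show "eqv ?\<Gamma> 0 (bs z r') PFalse"
          using eqv_size[OF rr] by (intro eqv_member) auto
      qed (use pxor_bs_small[of z u' r', OF z] room0 in auto)
      moreover have "eqv ?\<Gamma> 1 (pxor PFalse PFalse) PFalse"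
        using room0 by (intro eqv_pxor_False) simp
      ultimately have "eqv ?\<Gamma> (8 * ?D + (5 * ?D + 12 * ?D * b + 0 + 1) + 1 + 1 + 1) (bs z u) PFalse"
        by (blast intro: eqv_trans)
      then show ?thesis
      proof (rule eqv_le)
        have "1 \<le> ?D" by simp
        then show "8 * ?D + (5 * ?D + 12 * ?D * b + 0 + 1) + 1 + 1 + 1 \<le> 5 * ?D + 12 * ?D * Suc b"
          unfolding mult_Suc_right by linarith
      qed
    qed
    ultimately show ?thesis by (intro exI[of _ ?\<Gamma>]) (simp add: add.commute)
  qed
qed

text \<open>The invariant linking both worlds: one coefficient vector expresses \<open>Q\<close>
  through the nodes and, provably, \<open>q\<close> through their Boolean values.\<close>

definition spanned ::
    "pform set \<Rightarrow> nat \<Rightarrow> (nat \<Rightarrow> 'v ncpoly) \<Rightarrow> (nat \<Rightarrow> pform) \<Rightarrow> 'v ncpoly \<Rightarrow> pform \<Rightarrow> bool" where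
  "spanned \<Gamma> n p z Q q \<longleftrightarrow> psize q \<le> a \<and>
    (\<exists>u. (\<forall>j\<ge>n. u j = 0) \<and> Q = comb (2 ^ K) u p \<and> piff q (bs z u) \<in> \<Gamma>)"

lemma comb_agree:
  assumes "\<And>j. n \<le> j \<Longrightarrow> u j = 0" "\<And>i. i < n \<Longrightarrow> p' i = p i"
  shows "comb k u p' = comb k u p"
  unfolding comb_def using assms by (intro ext sum.cong refl) (metis mult_zero_left not_le)

lemma bs_agree:
  assumes "\<And>j. n \<le> j \<Longrightarrow> u j = 0" "\<And>i. i < n \<Longrightarrow> z' i = z i"
  shows "bs z' u = bs z u"
  using assms by (intro bs_cong) (metis bit_not_one_iff not_le)

lemma spanned_mono:
  assumes "spanned \<Gamma> n p z Q q" "\<Gamma> \<subseteq> \<Gamma>'" "n \<le> n'" "\<And>i. i < n \<Longrightarrow> p' i = p i" "\<And>i. i < n \<Longrightarrow> z' i = z i"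
  shows "spanned \<Gamma>' n' p' z' Q q"
proof -
  obtain u where u: "psize q \<le> a" "\<forall>j\<ge>n. u j = 0" "Q = comb (2 ^ K) u p" "piff q (bs z u) \<in> \<Gamma>"
    using assms(1) by (auto simp: spanned_def)
  have "Q = comb (2 ^ K) u p'" using u comb_agree[of n u p' p] assms(4) by auto
  moreover have "piff q (bs z' u) \<in> \<Gamma>'" using u bs_agree[of n u z' z] assms(2,5) by auto
  ultimately show ?thesis using u(1,2) assms(3) unfolding spanned_def by (metis order_trans)
qed

text \<open>Besides multiplication by a constant, the case \<open>c = 1\<close> exchanges the
  formula attached to a polynomial for an equivalent one.\<close>

lemma spanned_scaled:
  assumes sp: "spanned \<Gamma> n p z Q q" and z: "\<And>i. psize (z i) \<le> a"
    and q': "psize q' \<le> a"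
    and eq: "c = 1 \<Longrightarrow> eqv \<Gamma> 5 q' q" "c = 0 \<Longrightarrow> eqv \<Gamma> 5 q' PFalse"
  shows "\<exists>\<Gamma>'. grow \<Gamma> (20 * 2 ^ K) \<Gamma>' \<and> spanned \<Gamma>' n p z (\<lambda>w. c * Q w) q'"
proof -
  obtain u where u: "psize q \<le> a" "\<forall>j\<ge>n. u j = 0" "Q = comb (2 ^ K) u p" "piff q (bs z u) \<in> \<Gamma>"
    using sp by (auto simp: spanned_def)
  have D: "1 \<le> (2 ^ K :: nat)" by simp
  have "eqv \<Gamma> (20 * 2 ^ K) q' (bs z (\<lambda>j. c * u j))"
  proof (cases "c = 1")
    case True
    have "eqv \<Gamma> 0 q (bs z u)"
      using u bs_small[of z u, OF z] room0 by (intro eqv_member) auto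
    from eqv_trans[OF eq(1)[OF True] this] have "eqv \<Gamma> (20 * 2 ^ K) q' (bs z u)"
      by (rule eqv_le) (use D in linarith)
    then show ?thesis using True by simp
  next
    case False
    then have c: "c = 0" by simp
    from eqv_trans[OF eq(2)[OF c] eqv_sym[OF eqv_bs_zero]]
    have "eqv \<Gamma> (20 * 2 ^ K) q' (bs z (\<lambda>j. 0))"
      by (rule eqv_le) (use D in linarith)
    then show ?thesis using c by simp
  qed
  from grow_insert[OF this] show ?thesis
    using u q' by (intro exI[of _ "insert (piff q' (bs z (\<lambda>j. c * u j))) \<Gamma>"])
      (auto simp: spanned_def comb_scale[symmetric] intro!: exI[of _ "\<lambda>j. c * u j"])
qed

text \<open>The construction of \<open>program_extend\<close> repeated with Boolean values
  alongside: \<open>Q\<close> with its formula \<open>q\<close> is the continuation, and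
  multiplication by \<open>f\<close> on the left becomes conjunction with
  \<open>btr g f\<close>.\<close>

lemma spanned_formula:
  assumes g: "\<And>x. psize (g x) \<le> 1"
  shows "sys g \<Gamma> n p z \<Longrightarrow> spanned \<Gamma> n p z Q q \<Longrightarrow> n + nc_size f \<le> 2 ^ K \<Longrightarrow>
    psize (PAnd (btr g f) q) \<le> a \<Longrightarrow>
    \<exists>\<Gamma>' n' p' z'. grow \<Gamma> (40 * 2 ^ K * nc_size f) \<Gamma>' \<and> n \<le> n' \<and> n' \<le> n + nc_size f \<and>
      (\<forall>i<n. p' i = p i \<and> z' i = z i) \<and> sys g \<Gamma>' n' p' z' \<and>
      spanned \<Gamma>' n' p' z' (nc_mul (nc_eval f) Q) (PAnd (btr g f) q)"
proof (induction f arbitrary: \<Gamma> n p z Q q)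
  case (NVar x)
  let ?q = "PAnd (g x) q"
  \<comment> \<open>The new node has letter \<open>x\<close>, and its value is the conjunction
    itself. Its defining equivalence follows by replacing \<open>q\<close> with the sum of nodes it
    is known to equal.\<close>
  define p' where "p' = p(n := nc_mul (nc_var x) Q)"
  define z' where "z' = z(n := ?q)"
  let ?e = "\<lambda>j. if j = n then 1 else 0 :: bit"
  obtain u where u: "psize q \<le> a" "\<forall>j\<ge>n. u j = 0" "Q = comb (2 ^ K) u p" "piff q (bs z u) \<in> \<Gamma>"
    using NVar.prems(2) by (auto simp: spanned_def)
  have agree: "p' i = p i" "z' i = z i" if "i < n" for i using that by (auto simp: p'_def z'_def)
  have qa: "psize ?q \<le> a" using NVar.prems(4) by simp
  have z: "psize (z i) \<le> a" for i using NVar.prems(1) by (simp add: sys_def)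
  have z': "psize (z' i) \<le> a" for i using z qa by (simp add: z'_def)
  have n: "1 \<le> n" "n < 2 ^ K" using NVar.prems(1,3) by (auto simp: sys_def)
  have bsu: "bs z' u = bs z u" using u(2) agree(2) by (intro bs_agree) auto
  have Gbs: "psize (PAnd (g x) (bs z u)) \<le> m"
  proof -
    have "4 ^ K * (a + 3) \<le> 4 ^ K * (16 * a + 64)" by (intro mult_le_mono2) simp
    then show ?thesis using psize_bs[of z a u, OF z] g[of x] room1 unfolding psize.simps by linarith
  qed
  have "eqv \<Gamma> (1 + 0 + 1) ?q (PAnd (g x) (bs z' u))"
    unfolding bsu using Gbs u qa g[of x] room0
    by (intro eqv_PAnd eqv_refl eqv_member) auto
  from grow_insert[OF this] have 1: "grow \<Gamma> 2 (insert (piff ?q (PAnd (g x) (bs z' u))) \<Gamma>)"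
    by (simp add: numeral_2_eq_2)
  let ?\<Gamma> = "insert (piff ?q (PAnd (g x) (bs z' u))) \<Gamma>"
  have "eqv ?\<Gamma> (5 * 2 ^ K + 1) (z' n) (bs z' ?e)"
    using n(2) z' by (intro eqv_sym[OF eqv_bs_single])
  then have 2: "grow ?\<Gamma> (5 * 2 ^ K + 1) (insert (piff ?q (bs z' ?e)) ?\<Gamma>)"
    by (intro grow_insert) (simp add: z'_def)
  let ?\<Delta> = "insert (piff ?q (bs z' ?e)) ?\<Gamma>"
  have "grow \<Gamma> (40 * 2 ^ K * nc_size (NVar x)) ?\<Delta>"
  proof (rule grow_le[OF grow_trans[OF 1 2]])
    have "1 \<le> (2 ^ K :: nat)" by simp
    then show "2 + (5 * 2 ^ K + 1) \<le> 40 * 2 ^ K * nc_size (NVar x)"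
      unfolding nc_size.simps by linarith
  qed
  moreover have "sys g ?\<Delta> (n + 1) p' z'"
    unfolding sys_def
  proof (intro conjI allI impI)
    fix i assume i: "0 < i \<and> i < n + 1"
    show "\<exists>x S. (\<forall>j\<ge>i. S j = 0) \<and> p' i = nc_mul (nc_var x) (comb (2 ^ K) S p') \<and>
        piff (z' i) (PAnd (g x) (bs z' S)) \<in> ?\<Delta>"
    proof (cases "i = n")
      case True
      have "comb (2 ^ K) u p' = Q" using u agree comb_agree[of n u p' p] by auto
      then show ?thesis using True u(2)
        by (intro exI[of _ x] exI[of _ u]) (auto simp: p'_def z'_def)
    next
      case False
      then have i: "0 < i" "i < n" using i by auto
      then obtain y S where S: "\<forall>j\<ge>i. S j = 0" "p i = nc_mul (nc_var y) (comb (2 ^ K) S p)"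
        "piff (z i) (PAnd (g y) (bs z S)) \<in> \<Gamma>"
        using NVar.prems(1) by (auto simp: sys_def)
      have "comb (2 ^ K) S p' = comb (2 ^ K) S p" "bs z' S = bs z S"
        using S(1) i agree by (intro comb_agree[of n] bs_agree[of n]; auto)+
      then show ?thesis using S i agree
        by (intro exI[of _ y] exI[of _ S]) auto
    qed
  qed (use NVar.prems(1) n z' agree in \<open>auto simp: sys_def\<close>)
  moreover have "spanned ?\<Delta> (n + 1) p' z' (nc_mul (nc_eval (NVar x)) Q) (PAnd (btr g (NVar x)) q)"
    unfolding spanned_def
  proof (intro conjI exI[of _ ?e])
    show "nc_mul (nc_eval (NVar x)) Q = comb (2 ^ K) ?e p'"
      using comb_single[OF n(2), of p'] by (simp add: p'_def)
  qed (use qa in auto)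
  ultimately show ?case using agree
    by (intro exI[of _ ?\<Delta>] exI[of _ "n + 1"] exI[of _ p'] exI[of _ z']) auto
next
  case (NConst c)
  have z: "psize (z i) \<le> a" for i using NConst.prems(1) by (simp add: sys_def)
  have qa: "psize (PAnd PTrue q) \<le> a" "psize (PAnd PFalse q) \<le> a"
    using NConst.prems(4) by (simp_all split: if_splits)
  have "\<exists>\<Gamma>'. grow \<Gamma> (20 * 2 ^ K) \<Gamma>' \<and> spanned \<Gamma>' n p z (\<lambda>w. c * Q w) (PAnd (btr g (NConst c)) q)"
  proof (rule spanned_scaled[OF NConst.prems(2) z NConst.prems(4)])
    show "eqv \<Gamma> 5 (PAnd (btr g (NConst c)) q) q" if "c = 1"
      using that qa room0 by (auto intro!: eqv_le[OF eqv_PAnd_True])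
    show "eqv \<Gamma> 5 (PAnd (btr g (NConst c)) q) PFalse" if "c = 0"
      using that qa room0 by (auto intro!: eqv_le[OF eqv_PAnd_False(1)])
  qed
  then obtain \<Gamma>' where \<Gamma>': "grow \<Gamma> (20 * 2 ^ K) \<Gamma>'"
     "spanned \<Gamma>' n p z (\<lambda>w. c * Q w) (PAnd (btr g (NConst c)) q)" by blast
  have "sys g \<Gamma>' n p z" using NConst.prems(1) grow_subset[OF \<Gamma>'(1)] unfolding sys_def by blast
  moreover have "grow \<Gamma> (40 * 2 ^ K * nc_size (NConst c)) \<Gamma>'"
    by (rule grow_le[OF \<Gamma>'(1)]) simp
  ultimately show ?case using \<Gamma>'(2)
    by (intro exI[of _ \<Gamma>'] exI[of _ n] exI[of _ p] exI[of _ z]) (auto simp: nc_mul_const)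
next
  case (NAdd e f)
  have sz: "n + nc_size e \<le> 2 ^ K" "psize (PAnd (btr g e) q) \<le> a" "psize (PAnd (btr g f) q) \<le> a"
    using NAdd.prems(3,4) by simp_all
  from NAdd.IH(1)[OF NAdd.prems(1,2) sz(1,2)] obtain \<Gamma>1 n1 p1 z1 where
    1: "grow \<Gamma> (40 * 2 ^ K * nc_size e) \<Gamma>1" "n \<le> n1" "n1 \<le> n + nc_size e"
      "\<forall>i<n. p1 i = p i \<and> z1 i = z i" "sys g \<Gamma>1 n1 p1 z1"
      "spanned \<Gamma>1 n1 p1 z1 (nc_mul (nc_eval e) Q) (PAnd (btr g e) q)" by blast
  have "spanned \<Gamma>1 n1 p1 z1 Q q"
    using spanned_mono[OF NAdd.prems(2) grow_subset[OF 1(1)] 1(2)] 1(4) by blast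
  moreover have "n1 + nc_size f \<le> 2 ^ K" using 1(3) NAdd.prems(3) by simp
  ultimately obtain \<Gamma>2 n2 p2 z2 where
    2: "grow \<Gamma>1 (40 * 2 ^ K * nc_size f) \<Gamma>2" "n1 \<le> n2" "n2 \<le> n1 + nc_size f"
      "\<forall>i<n1. p2 i = p1 i \<and> z2 i = z1 i" "sys g \<Gamma>2 n2 p2 z2"
      "spanned \<Gamma>2 n2 p2 z2 (nc_mul (nc_eval f) Q) (PAnd (btr g f) q)"
    using NAdd.IH(2)[OF 1(5) _ _ sz(3)] by blast
  have s1: "spanned \<Gamma>2 n2 p2 z2 (nc_mul (nc_eval e) Q) (PAnd (btr g e) q)"
    using spanned_mono[OF 1(6) grow_subset[OF 2(1)] 2(2)] 2(4) by blast
  obtain u where u: "\<forall>j\<ge>n2. u j = 0" "nc_mul (nc_eval e) Q = comb (2 ^ K) u p2"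
    "piff (PAnd (btr g e) q) (bs z2 u) \<in> \<Gamma>2" using s1 by (auto simp: spanned_def)
  obtain v where v: "\<forall>j\<ge>n2. v j = 0" "nc_mul (nc_eval f) Q = comb (2 ^ K) v p2"
    "piff (PAnd (btr g f) q) (bs z2 v) \<in> \<Gamma>2" using 2(6) by (auto simp: spanned_def)
  have z2: "psize (z2 i) \<le> a" for i using 2(5) by (simp add: sys_def)
  have big: "psize (pxor (PAnd (btr g e) q) (PAnd (btr g f) q)) \<le> m"
    using sz room0 by simp
  have "eqv \<Gamma>2 1 (PAnd (btr g (NAdd e f)) q) (pxor (PAnd (btr g e) q) (PAnd (btr g f) q))"
    unfolding btr.simps by (rule eqv_distrib_right[OF big])
  moreover have "eqv \<Gamma>2 (0 + 0 + 1) (pxor (PAnd (btr g e) q) (PAnd (btr g f) q)) (pxor (bs z2 u) (bs z2 v))"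
    using u v big pxor_bs_small[of z2 u v, OF z2] by (intro eqv_pxor eqv_member) auto
  ultimately have "eqv \<Gamma>2 (1 + (0 + 0 + 1) + 1 + (8 * 2 ^ K + 1) + 1) (PAnd (btr g (NAdd e f)) q)
     (bs z2 (\<lambda>j. u j + v j))"
    by (blast intro: eqv_trans eqv_sym[OF eqv_bs_plus] z2)
  then have "grow \<Gamma>2 (40 * 2 ^ K) (insert (piff (PAnd (btr g (NAdd e f)) q) (bs z2 (\<lambda>j. u j + v j))) \<Gamma>2)"
  proof (intro grow_insert, elim eqv_le)
    have "1 \<le> (2 ^ K :: nat)" by simp
    then show "1 + (0 + 0 + 1) + 1 + (8 * 2 ^ K + 1) + 1 \<le> 40 * (2 ^ K :: nat)" by linarith
  qed
  from grow_trans[OF grow_trans[OF 1(1) 2(1)] this]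
  have gr: "grow \<Gamma> (40 * 2 ^ K * nc_size (NAdd e f))
      (insert (piff (PAnd (btr g (NAdd e f)) q) (bs z2 (\<lambda>j. u j + v j))) \<Gamma>2)"
    by (rule grow_le) (simp add: algebra_simps)
  have "nc_mul (nc_eval (NAdd e f)) Q = comb (2 ^ K) (\<lambda>j. u j + v j) p2"
    unfolding comb_plus u(2)[symmetric] v(2)[symmetric]
    by (auto simp: nc_add_def nc_mul_plus_left)
  then have "spanned (insert (piff (PAnd (btr g (NAdd e f)) q) (bs z2 (\<lambda>j. u j + v j))) \<Gamma>2) n2 p2 z2
      (nc_mul (nc_eval (NAdd e f)) Q) (PAnd (btr g (NAdd e f)) q)"
    using NAdd.prems(4) u(1) v(1) unfolding spanned_def
    by (intro conjI exI[of _ "\<lambda>j. u j + v j"]) auto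
  moreover have "sys g (insert (piff (PAnd (btr g (NAdd e f)) q) (bs z2 (\<lambda>j. u j + v j))) \<Gamma>2) n2 p2 z2"
    using 2(5) unfolding sys_def by blast
  moreover have "n2 \<le> n + nc_size (NAdd e f)" "n \<le> n2" using 1 2 by simp_all
  moreover have "\<forall>i<n. p2 i = p i \<and> z2 i = z i" using 1 2 by simp
  ultimately show ?case using gr by blast
next
  case (NMul e f)
  have sz: "n + nc_size f \<le> 2 ^ K" "psize (PAnd (btr g f) q) \<le> a"
    "psize (PAnd (btr g e) (PAnd (btr g f) q)) \<le> a"
    using NMul.prems(3,4) by simp_all
  from NMul.IH(2)[OF NMul.prems(1,2) sz(1,2)] obtain \<Gamma>1 n1 p1 z1 where
    1: "grow \<Gamma> (40 * 2 ^ K * nc_size f) \<Gamma>1" "n \<le> n1" "n1 \<le> n + nc_size f"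
      "\<forall>i<n. p1 i = p i \<and> z1 i = z i" "sys g \<Gamma>1 n1 p1 z1"
      "spanned \<Gamma>1 n1 p1 z1 (nc_mul (nc_eval f) Q) (PAnd (btr g f) q)" by blast
  have "n1 + nc_size e \<le> 2 ^ K" using 1(3) NMul.prems(3) by simp
  then obtain \<Gamma>2 n2 p2 z2 where
    2: "grow \<Gamma>1 (40 * 2 ^ K * nc_size e) \<Gamma>2" "n1 \<le> n2" "n2 \<le> n1 + nc_size e"
      "\<forall>i<n1. p2 i = p1 i \<and> z2 i = z1 i" "sys g \<Gamma>2 n2 p2 z2"
      "spanned \<Gamma>2 n2 p2 z2 (nc_mul (nc_eval e) (nc_mul (nc_eval f) Q)) (PAnd (btr g e) (PAnd (btr g f) q))"
    using NMul.IH(1)[OF 1(5,6) _ sz(3)] by blast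
  have z2: "psize (z2 i) \<le> a" for i using 2(5) by (simp add: sys_def)
  have "eqv \<Gamma>2 (1 + 1) (PAnd (btr g (NMul e f)) q) (PAnd (btr g e) (PAnd (btr g f) q))"
    unfolding btr.simps using sz(3) room0 by (intro eqv_sym[OF eqv_PAnd_assoc]) simp
  then have "eqv \<Gamma>2 5 (PAnd (btr g (NMul e f)) q) (PAnd (btr g e) (PAnd (btr g f) q))"
    by (rule eqv_le) simp
  then obtain \<Gamma>3 where 3: "grow \<Gamma>2 (20 * 2 ^ K) \<Gamma>3"
    "spanned \<Gamma>3 n2 p2 z2 (nc_mul (nc_eval e) (nc_mul (nc_eval f) Q)) (PAnd (btr g (NMul e f)) q)"
    using spanned_scaled[OF 2(6) z2 NMul.prems(4), of 1] by auto
  from grow_trans[OF grow_trans[OF 1(1) 2(1)] 3(1)]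
  have "grow \<Gamma> (40 * 2 ^ K * nc_size (NMul e f)) \<Gamma>3"
    by (rule grow_le) (simp add: algebra_simps)
  moreover have "sys g \<Gamma>3 n2 p2 z2"
    using 2(5) grow_subset[OF 3(1)] unfolding sys_def by blast
  moreover have "n2 \<le> n + nc_size (NMul e f)" "n \<le> n2" using 1 2 by simp_all
  moreover have "\<forall>i<n. p2 i = p i \<and> z2 i = z i" using 1 2 by simp
  ultimately show ?case using 3(2) by (simp only: nc_eval.simps nc_mul_assoc) blast
qed

text \<open>Representability is required only where \<open>w\<close> selects, because the program
  being simulated has so far been handled only for smaller indices.\<close>

lemma spanned_comb:
  assumes z: "\<And>i. psize (z i) \<le> a" and y: "\<And>i. psize (y i) \<le> a"
    and sp: "\<And>j. w j = 1 \<Longrightarrow> j < 2 ^ K \<and> spanned \<Gamma> n p z (P j) (y j)"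
    and wa: "psize (bs y w) \<le> a"
  shows "\<exists>\<Gamma>'. grow \<Gamma> (25 * (2 ^ K * 2 ^ K)) \<Gamma>' \<and> spanned \<Gamma>' n p z (comb (2 ^ K) w P) (bs y w)"
proof -
  have "\<forall>j. \<exists>u. w j = 1 \<longrightarrow> (\<forall>i\<ge>n. u i = 0) \<and> P j = comb (2 ^ K) u p \<and> piff (y j) (bs z u) \<in> \<Gamma>"
    using sp by (auto simp: spanned_def)
  then obtain U where U: "\<And>j. w j = 1 \<Longrightarrow> (\<forall>i\<ge>n. U j i = 0) \<and> P j = comb (2 ^ K) (U j) p \<and>
      piff (y j) (bs z (U j)) \<in> \<Gamma>" by metis
  let ?u = "\<lambda>i. \<Sum>j<2 ^ K. w j * U j i"
  have y': "psize (y i) \<le> m" for i using y[of i] room0 by linarith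
  have "eqv \<Gamma> (6 * 2 ^ K) (y i) (bs z (U i))" if "w i = 1" for i
    using U[OF that] y' bs_small[of z "U i", OF z] by (intro eqv_member) auto
  then have "eqv \<Gamma> (25 * (2 ^ K * 2 ^ K)) (bs y w) (bs z ?u)"
    by (intro eqv_bs_comb z y)
  then have gr: "grow \<Gamma> (25 * (2 ^ K * 2 ^ K)) (insert (piff (bs y w) (bs z ?u)) \<Gamma>)"
    by (rule grow_insert)
  have "comb (2 ^ K) w P = comb (2 ^ K) ?u p"
    unfolding comb_comb[symmetric]
  proof
    fix x
    have "w j * P j x = w j * comb (2 ^ K) (U j) p x" for j
      using U[of j] by (cases "w j") auto
    then show "comb (2 ^ K) w P x = comb (2 ^ K) w (\<lambda>j. comb (2 ^ K) (U j) p) x"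
      unfolding comb_def[of _ w] by (rule sum.cong[OF refl])
  qed
  moreover have "?u i = 0" if "n \<le> i" for i
  proof (intro sum.neutral ballI)
    fix j show "w j * U j i = 0" using U[of j] that by (cases "w j") auto
  qed
  ultimately have "spanned (insert (piff (bs y w) (bs z ?u)) \<Gamma>) n p z (comb (2 ^ K) w P) (bs y w)"
    using wa unfolding spanned_def by (intro conjI exI[of _ ?u]) auto
  then show ?thesis using gr by blast
qed

text \<open>Substituting formulas for letters again gives a linear program, in which node
  \<open>i\<close> is replaced by the nodes of \<open>G (v i)\<close>. The Boolean values
  \<open>y\<close> stay unchanged: since \<open>\<Gamma>\<close> equates
  \<open>btr gg (G (v i))\<close> with \<open>g (v i)\<close>, they also represent the substituted
  polynomials. At most \<open>s\<close> nodes are added per step, and \<open>e\<close> reserves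
  space for the Boolean form of one substituted formula.\<close>

lemma spanned_program:
  fixes v :: "nat \<Rightarrow> 'v" and G :: "'v \<Rightarrow> 'u ncformula" and \<sigma> :: "'v \<Rightarrow> 'u ncpoly"
  assumes len: "len \<le> 2 ^ K" and S: "\<And>i j. i \<le> j \<Longrightarrow> S i j = 0"
    and y: "\<And>i. psize (y i) \<le> b" and b: "4 ^ K * (b + 3) + e \<le> a"
    and y0: "piff (y 0) PTrue \<in> \<Gamma>"
    and yi: "\<And>i. 0 < i \<Longrightarrow> i < len \<Longrightarrow> piff (y i) (PAnd (g (v i)) (bs y (S i))) \<in> \<Gamma>"
    and g: "\<And>x. psize (g x) \<le> 1" and gg: "\<And>x. psize (gg x) \<le> 1"
    and G: "\<And>x. nc_eval (G x) = \<sigma> x" "\<And>x. nc_size (G x) \<le> s" "\<And>x. psize (btr gg (G x)) + 1 \<le> e"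
    and Gg: "\<And>i. 0 < i \<Longrightarrow> i < len \<Longrightarrow> piff (btr gg (G (v i))) (g (v i)) \<in> \<Gamma>"
    and room: "1 + len * s \<le> 2 ^ K" and i: "1 \<le> i" "i \<le> len"
  shows "\<exists>\<Gamma>' n p z. grow \<Gamma> ((50 * (2 ^ K * 2 ^ K) + 40 * 2 ^ K * s) * i) \<Gamma>' \<and> n \<le> 1 + i * s \<and>
    sys gg \<Gamma>' n p z \<and> (\<forall>j<i. spanned \<Gamma>' n p z (prog \<sigma> v S j) (y j))"
  using i
proof (induction i rule: dec_induct)
  case base
  let ?D = "2 ^ K :: nat"
  have E: "?D \<le> ?D * ?D" "1 \<le> ?D" by simp_all
  have ya: "psize (y i) \<le> a" for i
    using y[of i] b le_pow4[of "b + 3"] by linarith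
  have a1: "1 \<le> a" using ya[of 0] psize_pos[of "y 0"] by linarith
  let ?z = "\<lambda>_ :: nat. PTrue" and ?p = "\<lambda>_ :: nat. nc_const 1 :: 'u ncpoly"
  let ?e = "\<lambda>i. if i = 0 then 1 else 0 :: bit"
  have "eqv \<Gamma> (0 + (5 * ?D + 1) + 1) (y 0) (bs ?z ?e)"
    using y0 ya[of 0] room0 a1 by (intro eqv_trans[OF eqv_member eqv_sym[OF eqv_bs_single]]) auto
  note 1 = grow_insert[OF this]
  have "0 + (5 * ?D + 1) + 1 \<le> 50 * (?D * ?D)" using E by linarith
  also have "\<dots> \<le> (50 * (?D * ?D) + 40 * ?D * s) * 1"
    by (simp only: mult_1_right le_add1)
  finally have "grow \<Gamma> ((50 * (?D * ?D) + 40 * ?D * s) * 1) (insert (piff (y 0) (bs ?z ?e)) \<Gamma>)"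
    by (rule grow_le[OF 1])
  moreover have "sys gg (insert (piff (y 0) (bs ?z ?e)) \<Gamma>) 1 ?p ?z"
    using a1 by (simp add: sys_def)
  moreover have "spanned (insert (piff (y 0) (bs ?z ?e)) \<Gamma>) 1 ?p ?z (prog \<sigma> v S 0) (y 0)"
    unfolding spanned_def using ya comb_single[of 0 ?D ?p]
    by (intro conjI exI[of _ ?e]) auto
  ultimately show ?case
    by (intro exI[of _ "insert (piff (y 0) (bs ?z ?e)) \<Gamma>"] exI[of _ 1] exI[of _ ?p] exI[of _ ?z]) simp
next
  case (step i)
  let ?D = "2 ^ K :: nat"
  have E: "?D \<le> ?D * ?D" "1 \<le> ?D" by simp_all
  have i: "0 < i" "i < len" using step by auto
  have ya: "psize (y i) \<le> a" for i
    using y[of i] b le_pow4[of "b + 3"] by linarith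
  obtain \<Gamma>1 n p z where 1: "grow \<Gamma> ((50 * (?D * ?D) + 40 * ?D * s) * i) \<Gamma>1" "n \<le> 1 + i * s"
    "sys gg \<Gamma>1 n p z" and sp1: "\<And>j. j < i \<Longrightarrow> spanned \<Gamma>1 n p z (prog \<sigma> v S j) (y j)"
    using step by auto
  have z: "psize (z i) \<le> a" for i using 1(3) by (simp add: sys_def)
  have Si: "j < i" if "S i j = 1" for j using S[of i j] that by (metis not_le zero_neq_one)
  have bsS: "psize (bs y (S i)) + 2 \<le> 4 ^ K * (b + 3)" by (rule psize_bs[OF y])
  have Ssp: "j < ?D \<and> spanned \<Gamma>1 n p z (prog \<sigma> v S j) (y j)" if "S i j = 1" for j
    using sp1[OF Si[OF that]] Si[OF that] i len by linarith
  have bsa: "psize (bs y (S i)) \<le> a" using bsS b by linarith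
  obtain \<Gamma>2 where 2: "grow \<Gamma>1 (25 * (?D * ?D)) \<Gamma>2"
    and sp2: "spanned \<Gamma>2 n p z (comb ?D (S i) (prog \<sigma> v S)) (bs y (S i))"
    using spanned_comb[of z y "S i" \<Gamma>1 n p "prog \<sigma> v S", OF z ya Ssp bsa] by blast
  have s2: "sys gg \<Gamma>2 n p z" using 1(3) grow_subset[OF 2] unfolding sys_def by blast
  have "n + nc_size (G (v i)) \<le> 1 + Suc i * s" using 1(2) G(2)[of "v i"] by simp
  moreover have "Suc i * s \<le> len * s" using i by (intro mult_le_mono1) simp
  ultimately have n: "n + nc_size (G (v i)) \<le> ?D" "n + nc_size (G (v i)) \<le> 1 + Suc i * s"
    using room by linarith+
  have ba: "psize (PAnd (btr gg (G (v i))) (bs y (S i))) \<le> a"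
    using G(3)[of "v i"] bsS b by simp
  obtain \<Gamma>3 n' p' z' where 3: "grow \<Gamma>2 (40 * ?D * nc_size (G (v i))) \<Gamma>3" "n \<le> n'"
      "n' \<le> n + nc_size (G (v i))" "\<forall>i<n. p' i = p i \<and> z' i = z i" "sys gg \<Gamma>3 n' p' z'"
      and sp3: "spanned \<Gamma>3 n' p' z' (nc_mul (nc_eval (G (v i))) (comb ?D (S i) (prog \<sigma> v S)))
        (PAnd (btr gg (G (v i))) (bs y (S i)))"
    using spanned_formula[OF gg s2 sp2 n(1) ba] by blast
  have z': "psize (z' i) \<le> a" for i using 3(5) by (simp add: sys_def)
  have \<Gamma>3: "\<Gamma> \<subseteq> \<Gamma>3" "\<Gamma>1 \<subseteq> \<Gamma>3"
    using grow_subset[OF 1(1)] grow_subset[OF 2] grow_subset[OF 3(1)] by blast+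
  have am: "psize x \<le> m" if "psize x \<le> a" for x using that room0 by linarith
  have g1: "psize (g (v i)) \<le> 1" by (rule g)
  have gbs: "psize (PAnd (g (v i)) (bs y (S i))) \<le> a"
    using g1 bsS b by simp
  note gbsm = am[OF gbs] and bam = am[OF ba]
  \<comment> \<open>Here the value assumed for the letter is exchanged for the value of the formula
    substituted for it.\<close>
  have "eqv \<Gamma>3 5 (y i) (PAnd (btr gg (G (v i))) (bs y (S i)))"
  proof -
    have 1: "eqv \<Gamma>3 0 (y i) (PAnd (g (v i)) (bs y (S i)))"
      using yi[OF i] \<Gamma>3 by (intro eqv_member am[OF ya] gbsm) auto
    have 2: "eqv \<Gamma>3 (0 + 1) (g (v i)) (btr gg (G (v i)))"
      using Gg[OF i] \<Gamma>3 gbsm bam by (intro eqv_sym[OF eqv_member]) auto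
    have 3: "eqv \<Gamma>3 1 (bs y (S i)) (bs y (S i))" using am[OF bsa] by (simp add: eqv_refl)
    show ?thesis by (rule eqv_le[OF eqv_trans[OF 1 eqv_PAnd[OF 2 3 gbsm bam]]]) simp
  qed
  then obtain \<Gamma>4 where 4: "grow \<Gamma>3 (20 * ?D) \<Gamma>4"
    "spanned \<Gamma>4 n' p' z' (nc_mul (nc_eval (G (v i))) (comb ?D (S i) (prog \<sigma> v S))) (y i)"
    using spanned_scaled[OF sp3 z' ya, of 1 i] by auto
  have "comb ?D (S i) (prog \<sigma> v S) = comb i (S i) (prog \<sigma> v S)"
    using S i len by (intro comb_extend) auto
  then have sp4: "spanned \<Gamma>4 n' p' z' (prog \<sigma> v S i) (y i)"
    using 4(2) i by (simp add: prog_pos G(1))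
  have "spanned \<Gamma>4 n' p' z' (prog \<sigma> v S j) (y j)" if "j < Suc i" for j
  proof (cases "j = i")
    case True
    then show ?thesis using sp4 by simp
  next
    case False
    then have "spanned \<Gamma>1 n p z (prog \<sigma> v S j) (y j)" using sp1 that by simp
    then show ?thesis
      using 3(2,4) \<Gamma>3(2) grow_subset[OF 4(1)] by (elim spanned_mono) auto
  qed
  moreover have "sys gg \<Gamma>4 n' p' z'"
    using 3(5) grow_subset[OF 4(1)] unfolding sys_def by blast
  moreover have "grow \<Gamma> ((50 * (?D * ?D) + 40 * ?D * s) * Suc i) \<Gamma>4"
  proof (rule grow_le[OF grow_trans[OF grow_trans[OF grow_trans[OF 1(1) 2] 3(1)] 4(1)]])
    have "40 * ?D * nc_size (G (v i)) \<le> 40 * ?D * s" using G(2) by (intro mult_le_mono2)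
    then have "25 * (?D * ?D) + 40 * ?D * nc_size (G (v i)) + 20 * ?D \<le> 50 * (?D * ?D) + 40 * ?D * s"
      using E by linarith
    then show "(50 * (?D * ?D) + 40 * ?D * s) * i + 25 * (?D * ?D) + 40 * ?D * nc_size (G (v i)) + 20 * ?D
       \<le> (50 * (?D * ?D) + 40 * ?D * s) * Suc i"
      unfolding mult_Suc_right by simp
  qed
  moreover have "n' \<le> 1 + Suc i * s" using 3(3) n(2) by linarith
  ultimately show ?case by blast
qed

text \<open>A constant output is a linear relation among the nodes of the substituted program, and
  those are derivable. Hence the formal identity turns into a proof about the original formula
  \<open>bs y u\<close>.\<close>

lemma program_value:
  fixes v :: "nat \<Rightarrow> 'v" and G :: "'v \<Rightarrow> 'u ncformula" and \<sigma> :: "'v \<Rightarrow> 'u ncpoly"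
  assumes len: "1 \<le> len" "len \<le> 2 ^ K" and S: "\<And>i j. i \<le> j \<Longrightarrow> S i j = 0"
    and y: "\<And>i. psize (y i) \<le> b" and b: "4 ^ K * (b + 3) + e \<le> a"
    and y0: "piff (y 0) PTrue \<in> \<Gamma>"
    and yi: "\<And>i. 0 < i \<Longrightarrow> i < len \<Longrightarrow> piff (y i) (PAnd (g (v i)) (bs y (S i))) \<in> \<Gamma>"
    and g: "\<And>x. psize (g x) \<le> 1" and gg: "\<And>x. psize (gg x) \<le> 1"
    and G: "\<And>x. nc_eval (G x) = \<sigma> x" "\<And>x. nc_size (G x) \<le> s" "\<And>x. psize (btr gg (G x)) + 1 \<le> e"
    and Gg: "\<And>i. 0 < i \<Longrightarrow> i < len \<Longrightarrow> piff (btr gg (G (v i))) (g (v i)) \<in> \<Gamma>"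
    and room: "1 + len * s \<le> 2 ^ K"
    and u: "\<And>j. len \<le> j \<Longrightarrow> u j = 0" "comb (2 ^ K) u (prog \<sigma> v S) = nc_const c"
  shows "eqv \<Gamma> (250 * (2 ^ K * (2 ^ K * 2 ^ K))) (bs y u) (if c = 1 then PTrue else PFalse)"
proof -
  let ?D = "2 ^ K :: nat"
  obtain \<Gamma>1 n p z where 1: "grow \<Gamma> ((50 * (?D * ?D) + 40 * ?D * s) * len) \<Gamma>1" "n \<le> 1 + len * s"
    "sys gg \<Gamma>1 n p z" and sp1: "\<And>j. j < len \<Longrightarrow> spanned \<Gamma>1 n p z (prog \<sigma> v S j) (y j)"
    using spanned_program[where len = len and S = S and y = y and b = b and e = e and \<Gamma> = \<Gamma>
      and g = g and v = v and gg = gg and G = G and \<sigma> = \<sigma> and s = s, OF len(2) S y b y0 yi g gg G Gg room len(1) order_refl] by blast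
  have ya: "psize (y i) \<le> a" for i
    using y[of i] b le_pow4[of "b + 3"] by linarith
  have z: "psize (z i) \<le> a" for i using 1(3) by (simp add: sys_def)
  have n: "1 \<le> n" "n \<le> ?D" and z0: "z 0 = PTrue" and p0: "p 0 = nc_const 1"
    using 1(3) by (auto simp: sys_def)
  have ui: "j < len" if "u j = 1" for j using u(1)[of j] that by (metis not_le zero_neq_one)
  have D: "1 \<le> ?D" by simp
  have bsu: "psize (bs y u) \<le> a" using psize_bs[of y b u, OF y] b by linarith
  have usp: "j < ?D \<and> spanned \<Gamma>1 n p z (prog \<sigma> v S j) (y j)" if "u j = 1" for j
    using sp1[OF ui[OF that]] ui[OF that] len by linarith
  obtain \<Gamma>2 where 2: "grow \<Gamma>1 (25 * (?D * ?D)) \<Gamma>2"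
    and sp2: "spanned \<Gamma>2 n p z (nc_const c) (bs y u)"
    using spanned_comb[of z y u \<Gamma>1 n p "prog \<sigma> v S", OF z ya usp bsu] u(2) by auto
  then obtain w where w: "\<forall>j\<ge>n. w j = 0" "nc_const c = comb ?D w p" "piff (bs y u) (bs z w) \<in> \<Gamma>2"
    by (auto simp: spanned_def)
  have s2: "sys gg \<Gamma>2 n p z" using 1(3) grow_subset[OF 2] unfolding sys_def by blast
  obtain \<Gamma>3 where 3: "grow \<Gamma>2 (60 * (?D * ?D) * n) \<Gamma>3"
    and rel: "\<And>u. (\<forall>i\<ge>n. u i = 0) \<Longrightarrow> comb ?D u p = (\<lambda>w. 0) \<Longrightarrow>
      eqv \<Gamma>3 (5 * ?D + 12 * ?D * n) (bs z u) PFalse"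
    using relations_derivable[OF s2 gg order_refl] by blast
  have yw: "eqv \<Gamma>3 0 (bs y u) (bs z w)"
    using w(3) grow_subset[OF 3] bs_small[of z w, OF z] bsu room0 by (intro eqv_member) auto
  have "eqv \<Gamma>3 (30 * ?D + 12 * ?D * n) (bs y u) (if c = 1 then PTrue else PFalse)"
  proof (cases "c = 1")
    case False
    then have "comb ?D w p = (\<lambda>w. 0)" using w(2) by (auto simp: nc_const_def)
    from eqv_trans[OF yw rel[OF w(1) this]] have "eqv \<Gamma>3 (30 * ?D + 12 * ?D * n) (bs y u) PFalse"
      by (rule eqv_le) (use D in linarith)
    then show ?thesis using False by simp
  next
    case True
    let ?e = "\<lambda>i. if i = 0 then 1 else 0 :: bit"
    \<comment> \<open>Node \<open>0\<close> has value 1, so adding its unit vector turns the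
      identity with right side 1 into one with right side 0.\<close>
    let ?w = "\<lambda>i. w i + ?e i"
    have "comb ?D ?w p = nc_add (nc_const c) (nc_const 1)"
      unfolding comb_plus using w(2) p0 comb_single[of 0 ?D p] by simp
    also have "\<dots> = (\<lambda>w. 0)" using True by (auto simp: nc_add_def nc_const_def)
    finally have c0: "comb ?D ?w p = (\<lambda>w. 0)" .
    have ws: "\<forall>i\<ge>n. ?w i = 0" using w(1) n by auto
    have e: "psize (pxor PFalse (bs z ?e)) \<le> m"
      using pxor_bs_small[of z ?e ?e, OF z] psize_pos[of "bs z ?e"] by simp
    have "eqv \<Gamma>3 (8 * ?D + 1 + (5 * ?D + 12 * ?D * n) + 1) (pxor (bs z w) (bs z ?e)) PFalse"
      by (rule eqv_trans[OF eqv_sym[OF eqv_bs_plus[OF z]] rel[OF ws c0]])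
    note eqv_pxor_move[OF this e]
    from eqv_trans[OF this eqv_pxor_False(1)[OF e]]
    have "eqv \<Gamma>3 (8 * ?D + 1 + (5 * ?D + 12 * ?D * n) + 1 + 1 + 1 + 1) (bs z w) (bs z ?e)" .
    moreover have "eqv \<Gamma>3 (5 * ?D) (bs z ?e) PTrue"
      using eqv_bs_single[of 0 z \<Gamma>3, OF _ z] z0 by simp
    ultimately have "eqv \<Gamma>3 (0 + (8 * ?D + 1 + (5 * ?D + 12 * ?D * n) + 1 + 1 + 1 + 1 + 5 * ?D + 1) + 1)
        (bs y u) PTrue"
      using eqv_trans[OF yw eqv_trans] by blast
    then have "eqv \<Gamma>3 (30 * ?D + 12 * ?D * n) (bs y u) PTrue"
      by (rule eqv_le) (use D in linarith)
    then show ?thesis using True by simp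
  qed
  from grow_eqv[OF grow_trans[OF grow_trans[OF 1(1) 2] 3] this]
  show ?thesis
  proof (rule eqv_le)
    show "(50 * (?D * ?D) + 40 * ?D * s) * len + 25 * (?D * ?D) + 60 * (?D * ?D) * n
       + (30 * ?D + 12 * ?D * n) \<le> 250 * (?D * (?D * ?D))"
    proof -
      define E where "E = ?D * ?D"
      have "?D \<le> E" "E \<le> ?D * E" by (simp_all add: E_def)
      moreover have "(50 * E + 40 * ?D * s) * len = 50 * (len * E) + 40 * (?D * (len * s))"
        by (simp add: algebra_simps)
      moreover have "len * E \<le> ?D * E" using len(2) by (rule mult_le_mono1)
      moreover have "?D * (len * s) \<le> E" unfolding E_def using room by (intro mult_le_mono2) simp
      moreover have "60 * E * n = 60 * (n * E)" by simp
      moreover have "n * E \<le> ?D * E" using n(2) by (rule mult_le_mono1)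
      moreover have "12 * ?D * n = 12 * (?D * n)" by simp
      moreover have "?D * n \<le> E" unfolding E_def using n(2) by (rule mult_le_mono2)
      ultimately show ?thesis unfolding E_def[symmetric] by linarith
    qed
  qed
qed

end

section \<open>The axioms of the system\<close>

context short_derivations
begin

lemma eqv_clause_axioms:
  "psize (PAnd (pxor PTrue a) a) \<le> m \<Longrightarrow> eqv \<Gamma> 1 (PAnd (pxor PTrue a) a) PFalse"
  "psize (PAnd a (PNot a)) \<le> m \<Longrightarrow> eqv \<Gamma> 1 (PAnd a (PNot a)) PFalse"
  "psize (PAnd a (pxor PTrue a)) \<le> m \<Longrightarrow> eqv \<Gamma> 1 (PAnd a (pxor PTrue a)) PFalse"
  "psize (pxor (PAnd a b) (PAnd b a)) \<le> m \<Longrightarrow> eqv \<Gamma> 1 (pxor (PAnd a b) (PAnd b a)) PFalse"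
  unfolding eqv_def
  using pr_rule0[of "piff (PAnd (pxor PTrue (mv 1)) (mv 1)) PFalse" "[a]" \<Gamma>]
    pr_rule0[of "piff (PAnd (mv 1) (PNot (mv 1))) PFalse" "[a]" \<Gamma>]
    pr_rule0[of "piff (PAnd (mv 1) (pxor PTrue (mv 1))) PFalse" "[a]" \<Gamma>]
    pr_rule0[of "piff (pxor (PAnd (mv 1) (mv 2)) (PAnd (mv 2) (mv 1))) PFalse" "[a, b]" \<Gamma>]
  by (auto simp: clause_rules_def vals_def)

lemma eqv_PAnd_False_left:
  assumes "eqv \<Gamma> L (PAnd a c) PFalse" "psize (PAnd (PAnd a b) c) \<le> m"
  shows "eqv \<Gamma> (L + 1) (PAnd (PAnd a b) c) PFalse"
  using assms unfolding eqv_def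
  using pr_rule1[of "piff (PAnd (mv 1) (mv 3)) PFalse" "piff (PAnd (PAnd (mv 1) (mv 2)) (mv 3)) PFalse"
      "[a, b, c]" \<Gamma> L]
  by (auto simp: clause_rules_def vals_def)

lemma eqv_PAnd_False_right:
  assumes "eqv \<Gamma> L (PAnd b c) PFalse" "psize (PAnd (PAnd a b) c) \<le> m"
  shows "eqv \<Gamma> (L + 1) (PAnd (PAnd a b) c) PFalse"
  using assms unfolding eqv_def
  using pr_rule1[of "piff (PAnd (mv 2) (mv 3)) PFalse" "piff (PAnd (PAnd (mv 1) (mv 2)) (mv 3)) PFalse"
      "[a, b, c]" \<Gamma> L]
  by (auto simp: clause_rules_def vals_def)

lemma eqv_PAnd_POr:
  assumes "eqv \<Gamma> L (PAnd a b) PFalse" "eqv \<Gamma> L' (PAnd a c) PFalse" "psize (PAnd a (POr b c)) \<le> m"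
  shows "eqv \<Gamma> (L + L' + 1) (PAnd a (POr b c)) PFalse"
  using assms unfolding eqv_def
  using pr_rule2[of "piff (PAnd (mv 1) (mv 2)) PFalse" "piff (PAnd (mv 1) (mv 3)) PFalse"
      "piff (PAnd (mv 1) (POr (mv 2) (mv 3))) PFalse" "[a, b, c]" \<Gamma> L L']
  by (auto simp: clause_rules_def vals_def)

lemma eqv_False_if_PAnd_False:
  assumes "eqv \<Gamma> L (PAnd a b) PFalse" "pr \<Gamma> L' b"
  shows "eqv \<Gamma> (L + L' + 1) a PFalse"
  using assms unfolding eqv_def
  using pr_rule2[of "piff (PAnd (mv 1) (mv 2)) PFalse" "mv 2" "piff (mv 1) PFalse" "[a, b]" \<Gamma> L L']
  by (auto simp: clause_rules_def vals_def)

lemma pr_PAnd: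
  assumes "pr \<Gamma> L (PAnd a b)" "psize (PAnd a b) \<le> m"
  shows "pr \<Gamma> (L + 1) a" "pr \<Gamma> (L + 1) b"
  using assms
    pr_rule1[of "PAnd (mv 1) (mv 2)" "mv 1" "[a, b]" \<Gamma> L]
    pr_rule1[of "PAnd (mv 1) (mv 2)" "mv 2" "[a, b]" \<Gamma> L]
  by (auto simp: clause_rules_def vals_def)

lemma pr_hypothesis: "pr \<Gamma> 1 h"
  using pr_rule0[of "mv 0" "[]" \<Gamma>] by (auto simp: clause_rules_def vals_def)

end

text \<open>The system lists its axioms as coefficient functions, whereas the Boolean translation
  \<open>btr\<close> and node counts need syntax; these formulas compute the same
  polynomials.\<close>

fun lit_nc :: "literal \<Rightarrow> ipsvar ncformula" where
  "lit_nc (i, True) = NAdd (NConst 1) (NVar (X i))"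
| "lit_nc (i, False) = NVar (X i)"

definition clause_nc :: "clause \<Rightarrow> ipsvar ncformula" where
  "clause_nc k = foldr (\<lambda>l f. NMul (lit_nc l) f) k (NConst 1)"

lemma clause_nc_simps [simp]:
  "clause_nc [] = NConst 1" "clause_nc (l # k) = NMul (lit_nc l) (clause_nc k)"
  by (simp_all add: clause_nc_def)

lemma nc_eval_lit_nc: "nc_eval (lit_nc l) = tr_lit l"
  by (cases l rule: lit_nc.cases) simp_all

lemma nc_eval_clause_nc: "nc_eval (clause_nc k) = tr_clause k"
  by (induction k) (simp_all add: tr_clause_def nc_prod_list_def nc_eval_lit_nc)

lemma nc_size_clause_nc: "nc_size (clause_nc k) \<le> 4 * length k + 1"
proof (induction k)
  case (Cons l k)
  have "nc_size (lit_nc l) \<le> 3" by (cases l rule: lit_nc.cases) simp_all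
  then show ?case using Cons by simp
qed simp

text \<open>False for the placeholders is right for both substitutions: the constant 0 is false, and
  so is every axiom under the hypothesis.\<close>

fun ips_val :: "ipsvar \<Rightarrow> pform" where
  "ips_val (X i) = PVar i"
| "ips_val (Y j) = PFalse"

lemma psize_ips_val: "psize (ips_val x) \<le> 1"
  by (cases x) simp_all

lemma psize_lit_form: "psize (lit_form l) \<le> 2"
  by (cases l rule: lit_form.cases) simp_all

lemma psize_btr_clause_nc: "psize (btr ips_val (clause_nc k)) \<le> 10 * length k + 1"
proof (induction k)
  case (Cons l k)
  have "psize (btr ips_val (lit_nc l)) \<le> 9" by (cases l rule: lit_nc.cases) simp_all
  then show ?case using Cons by simp
qed simp

lemma length_le_psize_foldl:
  assumes "\<And>f x. psize f + 1 \<le> psize (F f x)"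
  shows "psize f + length xs \<le> psize (foldl F f xs)"
proof (induction xs arbitrary: f)
  case (Cons x xs)
  show ?case using Cons.IH[of "F f x"] assms[of f x] by simp
qed simp

lemma length_le_clause_form: "length k \<le> psize (clause_form k)"
proof (cases k)
  case (Cons l ls)
  have "psize (lit_form l) + length ls \<le> psize (clause_form k)"
    unfolding clause_form_def Cons list.case by (rule length_le_psize_foldl) simp
  then show ?thesis using Cons psize_pos[of "lit_form l"] by simp
qed simp

lemma foldl_PAnd_size:
  "psize f0 + length ks \<le> psize (foldl (\<lambda>f k. PAnd f (F k)) f0 ks) \<and>
   (\<forall>k\<in>set ks. psize (F k) \<le> psize (foldl (\<lambda>f k. PAnd f (F k)) f0 ks))"
proof (induction ks arbitrary: f0)
  case (Cons k ks)
  have "psize (PAnd f0 (F k)) + length ks \<le> psize (foldl (\<lambda>f k. PAnd f (F k)) (PAnd f0 (F k)) ks)"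
    "\<forall>k'\<in>set ks. psize (F k') \<le> psize (foldl (\<lambda>f k. PAnd f (F k)) (PAnd f0 (F k)) ks)"
    using Cons[of "PAnd f0 (F k)"] by blast+
  then show ?case by auto
qed simp

lemma cnf_form_size:
  shows "length \<phi> \<le> psize (cnf_form \<phi>)" "k \<in> set \<phi> \<Longrightarrow> psize (clause_form k) \<le> psize (cnf_form \<phi>)"
proof -
  have "length \<phi> \<le> psize (cnf_form \<phi>) \<and> (\<forall>k\<in>set \<phi>. psize (clause_form k) \<le> psize (cnf_form \<phi>))"
  proof (cases \<phi>)
    case (Cons k ks)
    then show ?thesis
      using foldl_PAnd_size[of "clause_form k" ks clause_form] psize_pos[of "clause_form k"]
      by (auto simp: cnf_form_def)
  qed simp
  then show "length \<phi> \<le> psize (cnf_form \<phi>)" "k \<in> set \<phi> \<Longrightarrow> psize (clause_form k) \<le> psize (cnf_form \<phi>)"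
    by auto
qed

context short_derivations
begin

text \<open>The translated clause has a factor for each literal that is true exactly when the
  literal is false, so it contradicts each literal separately.\<close>

lemma eqv_clause_literal:
  assumes "l \<in> set k" "psize (PAnd (btr ips_val (clause_nc k)) (lit_form l)) \<le> m"
  shows "eqv \<Gamma> (length k + 1) (PAnd (btr ips_val (clause_nc k)) (lit_form l)) PFalse"
  using assms
proof (induction k)
  case (Cons l' k)
  show ?case
  proof (cases "l = l'")
    case True
    have s: "psize (PAnd (btr ips_val (lit_nc l)) (lit_form l)) \<le> m"
      using Cons.prems(2) True by simp
    have "eqv \<Gamma> 1 (PAnd (btr ips_val (lit_nc l)) (lit_form l)) PFalse"
      using s eqv_clause_axioms(1,2)[of "PVar (fst l)" \<Gamma>]
      by (cases l rule: lit_nc.cases) (simp_all del: One_nat_def)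
    then have "eqv \<Gamma> (1 + 1) (PAnd (btr ips_val (clause_nc (l' # k))) (lit_form l)) PFalse"
      using Cons.prems(2) True unfolding clause_nc_simps btr.simps by (intro eqv_PAnd_False_left) simp_all
    then show ?thesis by (rule eqv_le) simp
  next
    case False
    then have "eqv \<Gamma> (length k + 1) (PAnd (btr ips_val (clause_nc k)) (lit_form l)) PFalse"
      using Cons by simp
    then have "eqv \<Gamma> (length k + 1 + 1) (PAnd (btr ips_val (clause_nc (l' # k))) (lit_form l)) PFalse"
      using Cons.prems(2) unfolding clause_nc_simps btr.simps by (intro eqv_PAnd_False_right) simp_all
    then show ?thesis by simp
  qed
qed simp

lemma eqv_foldl_POr:
  assumes "eqv \<Gamma> L (PAnd B f0) PFalse" "\<And>l. l \<in> set ls \<Longrightarrow> eqv \<Gamma> L' (PAnd B (lit_form l)) PFalse"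
    and "psize (PAnd B (foldl (\<lambda>f l. POr f (lit_form l)) f0 ls)) \<le> m"
  shows "eqv \<Gamma> (L + (L' + 1) * length ls) (PAnd B (foldl (\<lambda>f l. POr f (lit_form l)) f0 ls)) PFalse"
  using assms
proof (induction ls arbitrary: f0 L)
  case (Cons l ls)
  have "psize (POr f0 (lit_form l)) + length ls \<le> psize (foldl (\<lambda>f l. POr f (lit_form l)) (POr f0 (lit_form l)) ls)"
    by (rule length_le_psize_foldl) simp
  then have "psize (PAnd B (POr f0 (lit_form l))) \<le> m" using Cons.prems(3) by simp
  then have "eqv \<Gamma> (L + L' + 1) (PAnd B (POr f0 (lit_form l))) PFalse"
    using Cons.prems by (intro eqv_PAnd_POr) auto
  from Cons.IH[OF this] Cons.prems have
    "eqv \<Gamma> (L + L' + 1 + (L' + 1) * length ls) (PAnd B (foldl (\<lambda>f l. POr f (lit_form l)) (POr f0 (lit_form l)) ls)) PFalse"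
    by simp
  then show ?case by (simp add: algebra_simps)
qed simp

text \<open>Contradicting every literal, the translated clause contradicts their disjunction. Since
  the clause is given, the translation must be false.\<close>

lemma eqv_clause:
  assumes pr: "pr \<Gamma> L (clause_form k)" and m: "11 * psize (clause_form k) + 5 \<le> m"
  shows "eqv \<Gamma> (L + (length k + 2) * (length k + 2)) (btr ips_val (clause_nc k)) PFalse"
proof -
  let ?B = "btr ips_val (clause_nc k)"
  have B: "psize ?B \<le> 10 * psize (clause_form k) + 1"
    using psize_btr_clause_nc[of k] length_le_clause_form[of k] by linarith
  have s: "psize (PAnd ?B (clause_form k)) \<le> m" using B m by simp
  have lit: "eqv \<Gamma> (length k + 1) (PAnd ?B (lit_form l)) PFalse" if "l \<in> set k" for l
    using B m psize_lit_form[of l] by (intro eqv_clause_literal that) simp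
  have "eqv \<Gamma> ((length k + 2) * (length k + 1)) (PAnd ?B (clause_form k)) PFalse"
  proof (cases k)
    case Nil
    then show ?thesis using s by (auto simp: clause_form_def intro!: eqv_le[OF eqv_PAnd_False(2)])
  next
    case (Cons l ls)
    have "eqv \<Gamma> (length k + 1 + (length k + 1 + 1) * length ls)
        (PAnd ?B (foldl (\<lambda>f l. POr f (lit_form l)) (lit_form l) ls)) PFalse"
      using lit s Cons by (intro eqv_foldl_POr) (auto simp: clause_form_def)
    then have "eqv \<Gamma> (length k + 1 + (length k + 1 + 1) * length ls) (PAnd ?B (clause_form k)) PFalse"
      using Cons by (simp add: clause_form_def)
    then show ?thesis by (rule eqv_le) (simp add: Cons)
  qed
  from eqv_False_if_PAnd_False[OF this pr] show ?thesis
    by (rule eqv_le) simp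
qed

text \<open>Conjunctions are nested to the left, so the last conjunct is split off first and each
  further one costs one more application.\<close>

lemma pr_foldl_PAnd:
  assumes "pr \<Gamma> L (foldl (\<lambda>f k. PAnd f (F k)) f0 ks)" "psize (foldl (\<lambda>f k. PAnd f (F k)) f0 ks) \<le> m"
  shows "pr \<Gamma> (L + length ks) f0 \<and> (\<forall>k\<in>set ks. pr \<Gamma> (L + length ks) (F k))"
  using assms
proof (induction ks arbitrary: f0)
  case Nil
  then show ?case by simp
next
  case (Cons k ks)
  then have IH: "pr \<Gamma> (L + length ks) (PAnd f0 (F k)) \<and> (\<forall>k\<in>set ks. pr \<Gamma> (L + length ks) (F k))"
    by simp
  have "psize (PAnd f0 (F k)) \<le> m"
    using foldl_PAnd_size[of "PAnd f0 (F k)" ks F] Cons.prems(2) by simp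
  from pr_PAnd[OF conjunct1[OF IH] this] IH show ?case
    by (auto elim!: pr_mono)
qed

lemma pr_clause:
  assumes "h = cnf_form \<phi>" "k \<in> set \<phi>"
  shows "pr \<Gamma> (length \<phi> + 1) (clause_form k)"
proof (cases \<phi>)
  case (Cons k' ks)
  have "pr \<Gamma> 1 (foldl (\<lambda>f k. PAnd f (clause_form k)) (clause_form k') ks)"
    using pr_hypothesis[of \<Gamma>] assms(1) Cons by (simp add: cnf_form_def)
  moreover have "psize (foldl (\<lambda>f k. PAnd f (clause_form k)) (clause_form k') ks) \<le> m"
    using h_size assms(1) Cons by (simp add: cnf_form_def)
  ultimately have "pr \<Gamma> (1 + length ks) (clause_form k)"
    using pr_foldl_PAnd[of \<Gamma> 1 clause_form "clause_form k'" ks] assms(2) Cons by auto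
  then show ?thesis by (rule pr_mono) (use Cons in auto)
qed (use assms in simp)

text \<open>Boolean and commutator axioms are false as propositional formulas; only clauses use the
  hypothesis. The factor 7 is the number of nodes of a commutator, and 20 covers its Boolean form of
  size 17 plus one.\<close>

lemma ips_axiom_refutable:
  assumes h: "h = cnf_form \<phi>" and N: "psize (cnf_form \<phi>) \<le> N" and m: "20 * N \<le> m"
    and F: "F \<in> set (ips_system n (map tr_clause \<phi>))"
  shows "\<exists>f. nc_eval f = F \<and> nc_size f \<le> 7 * N \<and> psize (btr ips_val f) + 1 \<le> 20 * N \<and>
     eqv \<Gamma> (12 * (N * N)) (btr ips_val f) PFalse"
proof -
  have N1: "1 \<le> N" using N psize_pos[of "cnf_form \<phi>"] by linarith
  then have NN: "N \<le> N * N" "1 \<le> N * N" by simp_all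
  consider k where "k \<in> set \<phi>" "F = tr_clause k"
    | i where "F = nc_mul (nc_var (X i)) (nc_add (nc_const 1) (nc_var (X i)))"
    | i j where "F = nc_add (nc_mul (nc_var (X i)) (nc_var (X j))) (nc_mul (nc_var (X j)) (nc_var (X i)))"
    using F by (auto simp: ips_system_def bool_axioms_def comm_axioms_def)
  then show ?thesis
  proof cases
    case (1 k)
    have kN: "psize (clause_form k) \<le> N" using cnf_form_size(2)[OF 1(1)] N by linarith
    have lk: "length k \<le> N" using length_le_clause_form[of k] kN by linarith
    have "11 * psize (clause_form k) + 5 \<le> m" using kN N1 m by linarith
    from eqv_clause[OF pr_clause[OF h 1(1)] this]
    have "eqv \<Gamma> (length \<phi> + 1 + (length k + 2) * (length k + 2)) (btr ips_val (clause_nc k)) PFalse" .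
    moreover have "length \<phi> + 1 + (length k + 2) * (length k + 2) \<le> 12 * (N * N)"
    proof -
      have "(length k + 2) * (length k + 2) \<le> (3 * N) * (3 * N)"
        using lk N1 by (intro mult_le_mono) linarith+
      also have "\<dots> = 9 * (N * N)" by simp
      finally show ?thesis using cnf_form_size(1)[of \<phi>] N NN by linarith
    qed
    ultimately have "eqv \<Gamma> (12 * (N * N)) (btr ips_val (clause_nc k)) PFalse" by (rule eqv_le)
    moreover have "nc_size (clause_nc k) \<le> 7 * N"
      using nc_size_clause_nc[of k] lk N1 by linarith
    moreover have "psize (btr ips_val (clause_nc k)) + 1 \<le> 20 * N"
      using psize_btr_clause_nc[of k] lk N1 by linarith
    ultimately show ?thesis using 1(2) nc_eval_clause_nc by blast
  next
    case (2 i)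
    let ?f = "NMul (NVar (X i)) (NAdd (NConst 1) (NVar (X i)))"
    have "eqv \<Gamma> 1 (btr ips_val ?f) PFalse"
      using eqv_clause_axioms(3)[of "PVar i" \<Gamma>] m N1 by simp
    then have "eqv \<Gamma> (12 * (N * N)) (btr ips_val ?f) PFalse"
      by (rule eqv_le) (use NN in linarith)
    then show ?thesis using 2 N1 by (intro exI[of _ ?f]) simp
  next
    case (3 i j)
    let ?f = "NAdd (NMul (NVar (X i)) (NVar (X j))) (NMul (NVar (X j)) (NVar (X i)))"
    have "eqv \<Gamma> 1 (btr ips_val ?f) PFalse"
      using eqv_clause_axioms(4)[of "PVar i" "PVar j" \<Gamma>] m N1 by simp
    then have "eqv \<Gamma> (12 * (N * N)) (btr ips_val ?f) PFalse"
      by (rule eqv_le) (use NN in linarith)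
    then show ?thesis using 3 N1 by (intro exI[of _ ?f]) simp
  qed
qed

end

context xor_sums
begin

text \<open>The program has at most \<open>N\<close> nodes and each is replaced by at most
  \<open>7 * N\<close> nodes, plus the initial one: this is where
  \<open>8 * (N * N) \<le> 2 ^ K\<close> comes from.\<close>

lemma refutation_contradiction:
  assumes h: "h = cnf_form \<phi>"
    and ref: "nc_ips_refutation (ips_system n (map tr_clause \<phi>)) (nc_eval \<Phi>)"
    and N: "nc_size \<Phi> + psize (cnf_form \<phi>) \<le> N" and K: "8 * (N * N) \<le> 2 ^ K"
    and a: "4 ^ K * ((32 * 4 ^ K) ^ (2 * K) + 3) + 20 * N \<le> a"
  shows "eqv {} (3 * (2 ^ K * (12 * 2 ^ K * (12 * 2 ^ K) ^ K + 60 * (2 ^ K * 2 ^ K) * K + 30 * 2 ^ K + 12 * 2 ^ K))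
     + 502 * (2 ^ K * (2 ^ K * 2 ^ K))) PTrue PFalse"
proof -
  let ?D = "2 ^ K :: nat"
  let ?b = "(32 * 4 ^ K) ^ (2 * K) :: nat"
  define L0 where "L0 = 12 * ?D * (12 * ?D) ^ K + 60 * (?D * ?D) * K + 30 * ?D"
  \<comment> \<open>The second summand covers the \<open>12 * (N * N)\<close> steps that refute an
    axiom, so one cost serves all basic facts.\<close>
  define L where "L = L0 + 12 * ?D"
  let ?Fs = "ips_system n (map tr_clause \<phi>)"
  have N1: "1 \<le> N" using N psize_pos[of "cnf_form \<phi>"] by linarith
  then have NN: "1 \<le> N * N" "N \<le> N * N" by simp_all
  have b: "?b \<le> a" using a le_pow4[of "?b + 3"] by linarith
  have Na: "20 * N \<le> a" using a by linarith
  have "\<exists>f. nc_eval f = F \<and> nc_size f \<le> 7 * N \<and> psize (btr ips_val f) + 1 \<le> 20 * N \<and>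
     (\<forall>\<Gamma>. eqv \<Gamma> (12 * (N * N)) (btr ips_val f) PFalse)" if "F \<in> set ?Fs" for F
  proof -
    have "psize (cnf_form \<phi>) \<le> N" "20 * N \<le> m" using N Na room0 by linarith+
    from ips_axiom_refutable[OF h this that, of "{}"] show ?thesis
      by (metis eqv_mono empty_subsetI order_refl)
  qed
  then have "\<forall>F. \<exists>f. F \<in> set ?Fs \<longrightarrow> nc_eval f = F \<and> nc_size f \<le> 7 * N \<and>
      psize (btr ips_val f) + 1 \<le> 20 * N \<and> (\<forall>\<Gamma>. eqv \<Gamma> (12 * (N * N)) (btr ips_val f) PFalse)"
    by blast
  then obtain A where A: "\<And>F. F \<in> set ?Fs \<Longrightarrow> nc_eval (A F) = F \<and> nc_size (A F) \<le> 7 * N \<and>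
      psize (btr ips_val (A F)) + 1 \<le> 20 * N \<and> (\<forall>\<Gamma>. eqv \<Gamma> (12 * (N * N)) (btr ips_val (A F)) PFalse)"
    by metis
  \<comment> \<open>The condition on indices concerns words that survive in the polynomial, while
    leaves of \<open>\<Phi>\<close> may carry other placeholders that cancel. The program can
    contain them too, and \<open>NConst 0\<close> gives them the value \<open>PFalse\<close> used by
    \<open>ips_val\<close>.\<close>
  define G1 where "G1 x = (case x of X i \<Rightarrow> NVar (X i)
     | Y j \<Rightarrow> if j < length ?Fs then A (?Fs ! j) else NConst 0)" for x
  define G0 where "G0 x = (case x of X i \<Rightarrow> NVar (X i) | Y j \<Rightarrow> NConst 0)" for x
  have G1: "nc_size (G1 x) \<le> 7 * N" "psize (btr ips_val (G1 x)) + 1 \<le> 20 * N"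
    "eqv \<Gamma> L (btr ips_val (G1 x)) (ips_val x)" for x \<Gamma>
  proof -
    have L: "12 * (N * N) \<le> L" "1 \<le> L" using K NN unfolding L_def by linarith+
    show "nc_size (G1 x) \<le> 7 * N" "psize (btr ips_val (G1 x)) + 1 \<le> 20 * N"
      using A N1 by (auto simp: G1_def split: ipsvar.split)
    show "eqv \<Gamma> L (btr ips_val (G1 x)) (ips_val x)"
    proof (cases "\<exists>j. x = Y j \<and> j < length ?Fs")
      case True
      then obtain j where j: "x = Y j" "j < length ?Fs" by blast
      then have "eqv \<Gamma> (12 * (N * N)) (btr ips_val (A (?Fs ! j))) PFalse" using A by simp
      from eqv_le[OF this L(1)] show ?thesis using j by (simp add: G1_def)
    next
      case False
      then have "btr ips_val (G1 x) = ips_val x" by (cases x) (simp_all add: G1_def)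
      then show ?thesis using L(2) psize_ips_val[of x] room0 by (simp add: eqv_refl)
    qed
  qed
  have G0: "nc_size (G0 x) \<le> 7 * N" "psize (btr ips_val (G0 x)) + 1 \<le> 20 * N"
    "eqv \<Gamma> L (btr ips_val (G0 x)) (ips_val x)" for x \<Gamma>
  proof -
    have L: "1 \<le> L" using K NN unfolding L_def by linarith
    show "nc_size (G0 x) \<le> 7 * N" "psize (btr ips_val (G0 x)) + 1 \<le> 20 * N"
      using N1 by (auto simp: G0_def split: ipsvar.split)
    show "eqv \<Gamma> L (btr ips_val (G0 x)) (ips_val x)"
      using L room0 by (auto simp: G0_def eqv_refl split: ipsvar.split)
  qed
  obtain len v S u where prog: "1 \<le> len" "len \<le> nc_size \<Phi> + 1" "\<And>j. len \<le> j \<Longrightarrow> u j = 0"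
    "\<And>i j. i \<le> j \<Longrightarrow> S i j = 0"
    "\<And>\<sigma> :: ipsvar \<Rightarrow> ipsvar ncpoly. nc_subst (nc_eval \<Phi>) \<sigma> = comb len u (prog \<sigma> v S)"
    using program_exists[of \<Phi>, where 'u = ipsvar] by blast
  have lenN: "len \<le> N" using prog(2) N psize_pos[of "cnf_form \<phi>"] by linarith
  have lenD: "len \<le> ?D" using lenN NN K by linarith
  have room': "1 + len * (7 * N) \<le> ?D"
  proof -
    have "len * (7 * N) = 7 * (len * N)" by simp
    then show ?thesis using mult_le_mono1[OF lenN, of N] NN K by linarith
  qed
  have comb: "comb ?D u (prog \<sigma> v S) = nc_subst (nc_eval \<Phi>) \<sigma>" for \<sigma> :: "ipsvar \<Rightarrow> ipsvar ncpoly"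
    unfolding prog(5) using prog(3) lenD by (rule comb_extend)
  have val1: "comb ?D u (prog (\<lambda>x. nc_eval (G1 x)) v S) = nc_const 1"
  proof -
    have "nc_subst (nc_eval \<Phi>) (\<lambda>x. nc_eval (G1 x)) =
        nc_subst (nc_eval \<Phi>) (\<lambda>v. case v of X i \<Rightarrow> nc_var (X i) | Y j \<Rightarrow> ?Fs ! j)"
    proof (rule nc_subst_cong)
      fix w x assume "nc_eval \<Phi> w \<noteq> 0" "x \<in> set w"
      then have "\<And>j. x = Y j \<Longrightarrow> j < length ?Fs" using ref unfolding nc_ips_refutation_def by blast
      then show "nc_eval (G1 x) = (case x of X i \<Rightarrow> nc_var (X i) | Y j \<Rightarrow> ?Fs ! j)"
        using A by (cases x) (auto simp: G1_def)
    qed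
    then show ?thesis using ref by (simp add: comb nc_ips_refutation_def)
  qed
  have val0: "comb ?D u (prog (\<lambda>x. nc_eval (G0 x)) v S) = nc_const 0"
  proof -
    have "(\<lambda>x. nc_eval (G0 x)) = (\<lambda>v. case v of X i \<Rightarrow> nc_var (X i) | Y j \<Rightarrow> nc_const 0)"
      by (auto simp: G0_def split: ipsvar.split)
    then show ?thesis using ref by (simp add: comb nc_ips_refutation_def)
  qed
  \<comment> \<open>One choice of \<open>y\<close>, made independently of \<open>G0\<close> and
    \<open>G1\<close>: the contradiction needs both evaluations to concern the very same
    formula.\<close>
  obtain y where y: "\<And>i. psize (y i) \<le> ?b" "\<And>\<Gamma>. eqv \<Gamma> L (y 0) PTrue"
    "\<And>\<Gamma> i. 0 < i \<Longrightarrow> i < ?D \<Longrightarrow> eqv \<Gamma> L (y i) (PAnd (ips_val (v i)) (bs y (S i)))"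
  proof -
    have "psize (ips_val (v i)) \<le> 1" for i by (rule psize_ips_val)
    from boolean_program[of S "\<lambda>i. ips_val (v i)", OF prog(4) this b] obtain y where
      *: "\<forall>i. psize (y i) \<le> ?b" "\<forall>\<Gamma>. eqv \<Gamma> L0 (y 0) PTrue"
      "\<forall>\<Gamma> i. 0 < i \<and> i < ?D \<longrightarrow> eqv \<Gamma> L0 (y i) (PAnd (ips_val (v i)) (bs y (S i)))"
      unfolding L0_def[symmetric] by blast
    have "L0 \<le> L" by (simp add: L_def)
    show ?thesis by (rule that[of y]) (use * \<open>L0 \<le> L\<close> in \<open>blast intro: eqv_le\<close>)+
  qed
  define f0 where "f0 i = (if i = 0 then piff (y 0) PTrue
     else piff (y i) (PAnd (ips_val (v i)) (bs y (S i))))" for i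
  let ?\<Gamma>1 = "f0 ` {..<len}"
  let ?\<Gamma>2 = "?\<Gamma>1 \<union> (\<lambda>i. piff (btr ips_val (G1 (v i))) (ips_val (v i))) ` {..<len}"
  let ?\<Gamma> = "?\<Gamma>2 \<union> (\<lambda>i. piff (btr ips_val (G0 (v i))) (ips_val (v i))) ` {..<len}"
  have "ext {} L {f0 i}" if "i < len" for i
    using y(2)[of "{}"] y(3)[of i "{}"] that lenD by (auto simp: f0_def eqv_def pr_def)
  from ext_family[OF finite_lessThan this, of len] have 1: "grow {} (len * L) ?\<Gamma>1"
    by (simp add: grow_def)
  have "ext ?\<Gamma>1 L {piff (btr ips_val (G1 (v i))) (ips_val (v i))}" for i
    using G1(3)[of ?\<Gamma>1 "v i"] by (simp add: eqv_def pr_def)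
  from ext_family[OF finite_lessThan this, of len] have 2: "grow ?\<Gamma>1 (len * L) ?\<Gamma>2"
    by (intro grow_Un) simp
  have "ext ?\<Gamma>2 L {piff (btr ips_val (G0 (v i))) (ips_val (v i))}" for i
    using G0(3)[of ?\<Gamma>2 "v i"] by (simp add: eqv_def pr_def)
  from ext_family[OF finite_lessThan this, of len] have 3: "grow ?\<Gamma>2 (len * L) ?\<Gamma>"
    by (intro grow_Un) simp
  have "f0 0 \<in> ?\<Gamma>" using prog(1) by auto
  then have y0: "piff (y 0) PTrue \<in> ?\<Gamma>" by (simp add: f0_def)
  have yi: "piff (y i) (PAnd (ips_val (v i)) (bs y (S i))) \<in> ?\<Gamma>" if "0 < i" "i < len" for i
  proof -
    have "f0 i \<in> ?\<Gamma>" using that by auto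
    then show ?thesis using that by (simp add: f0_def)
  qed
  have Gg1: "piff (btr ips_val (G1 (v i))) (ips_val (v i)) \<in> ?\<Gamma>"
    and Gg0: "piff (btr ips_val (G0 (v i))) (ips_val (v i)) \<in> ?\<Gamma>" if "0 < i" "i < len" for i
    using that by auto
  let ?T = "250 * (?D * (?D * ?D))"
  \<comment> \<open>Substituting the axioms makes \<open>bs y u\<close> provably true; substituting
    zero below makes it provably false.\<close>
  have t: "eqv ?\<Gamma> ?T (bs y u) (if (1::bit) = 1 then PTrue else PFalse)"
    by (rule program_value[where G = G1 and \<sigma> = "\<lambda>x. nc_eval (G1 x)" and gg = ips_val and g = ips_val
          and s = "7 * N" and e = "20 * N" and v = v and S = S and len = len and b = ?b and c = 1,
          OF prog(1) lenD prog(4) y(1) a y0 yi psize_ips_val psize_ips_val refl G1(1,2) Gg1 room' prog(3) val1])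
  have f: "eqv ?\<Gamma> ?T (bs y u) (if (0::bit) = 1 then PTrue else PFalse)"
    by (rule program_value[where G = G0 and \<sigma> = "\<lambda>x. nc_eval (G0 x)" and gg = ips_val and g = ips_val
          and s = "7 * N" and e = "20 * N" and v = v and S = S and len = len and b = ?b and c = 0,
          OF prog(1) lenD prog(4) y(1) a y0 yi psize_ips_val psize_ips_val refl G0(1,2) Gg0 room' prog(3) val0])
  have "eqv ?\<Gamma> (?T + 1 + ?T + 1) PTrue PFalse"
    using eqv_trans[OF eqv_sym[OF t] f] by simp
  from grow_eqv[OF grow_trans[OF grow_trans[OF 1 2] 3] this] show ?thesis
  proof (rule eqv_le)
    have "len * L \<le> ?D * L" using lenD by (rule mult_le_mono1)
    moreover have "1 \<le> ?D * (?D * ?D)" by simp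
    ultimately show "len * L + len * L + len * L + (?T + 1 + ?T + 1)
      \<le> 3 * (?D * (12 * ?D * (12 * ?D) ^ K + 60 * (?D * ?D) * K + 30 * ?D + 12 * ?D)) + 502 * (?D * (?D * ?D))"
      unfolding L0_def[symmetric] L_def[symmetric] by linarith
  qed
qed

end

section \<open>Size estimate\<close>

lemma le_pow2_add:
  assumes "x \<le> 2 ^ p" "y \<le> 2 ^ q"
  shows "x + y \<le> (2::nat) ^ (p + q + 1)"
proof -
  have "x + y \<le> 2 ^ p + 2 ^ q" using assms by (rule add_mono)
  also have "\<dots> \<le> 2 ^ (p + q) + 2 ^ (p + q)" by (intro add_mono power_increasing) auto
  finally show ?thesis by simp
qed

lemma le_pow2_mult:
  assumes "x \<le> 2 ^ p" "y \<le> 2 ^ q"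
  shows "x * y \<le> (2::nat) ^ (p + q)"
  unfolding power_add using assms by (rule mult_le_mono)

lemma le_pow2_power:
  assumes "x \<le> 2 ^ p"
  shows "x ^ n \<le> (2::nat) ^ (p * n)"
  unfolding power_mult using assms by (rule power_mono) simp

lemma le_pow2_self: "n \<le> (2::nat) ^ n"
  using less_exp[of n] by simp

text \<open>Every factor is rounded up to a power of two, which leaves an inequality between
  exponents. Their quadratic part stems from the two powers with exponents \<open>K\<close> and
  \<open>2 * K\<close> and bases \<open>2 ^ O(K)\<close>.\<close>

lemma proof_size_estimate:
  assumes N: "N \<le> 2 ^ K" and K: "1 \<le> K"
    and L: "L = 3 * (2 ^ K * (12 * 2 ^ K * (12 * 2 ^ K) ^ K + 60 * (2 ^ K * 2 ^ K) * K + 30 * 2 ^ K + 12 * 2 ^ K))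
     + 502 * (2 ^ K * (2 ^ K * 2 ^ K))"
    and a: "a = 4 ^ K * ((32 * 4 ^ K) ^ (2 * K) + 3) + 20 * N"
    and m: "m = 4 ^ K * (4 ^ K * (32 * a + 128))"
  shows "(C * L + C) * (C * m) \<le> 2 ^ ((200 + 10 * C) * (K * K))"
proof -
  have num: "3 \<le> (2::nat) ^ 2" "12 \<le> (2::nat) ^ 4" "60 \<le> (2::nat) ^ 6" "30 \<le> (2::nat) ^ 5"
    "502 \<le> (2::nat) ^ 9" "32 \<le> (2::nat) ^ 5" "20 \<le> (2::nat) ^ 5" "128 \<le> (2::nat) ^ 7" by simp_all
  have p: "(4::nat) ^ K \<le> 2 ^ (2 * K)" by (simp add: power_mult)
  have q: "(2::nat) ^ K \<le> 2 ^ K" by simp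
  note L' = le_pow2_add[OF le_pow2_mult[OF num(1) le_pow2_mult[OF q
      le_pow2_add[OF le_pow2_add[OF le_pow2_add[OF
        le_pow2_mult[OF le_pow2_mult[OF num(2) q] le_pow2_power[OF le_pow2_mult[OF num(2) q], of K]]
        le_pow2_mult[OF le_pow2_mult[OF num(3) le_pow2_mult[OF q q]] le_pow2_self[of K]]]
        le_pow2_mult[OF num(4) q]] le_pow2_mult[OF num(2) q]]]]
      le_pow2_mult[OF num(5) le_pow2_mult[OF q le_pow2_mult[OF q q]]]]
  note a' = le_pow2_add[OF le_pow2_mult[OF p le_pow2_add[OF
      le_pow2_power[OF le_pow2_mult[OF num(6) p], of "2 * K"] num(1)]] le_pow2_mult[OF num(7) N]]
  note m' = le_pow2_mult[OF p le_pow2_mult[OF p le_pow2_add[OF le_pow2_mult[OF num(6) a'] num(8)]]]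
  note C = le_pow2_self[of C]
  note all = le_pow2_mult[OF le_pow2_add[OF le_pow2_mult[OF C L'] C] le_pow2_mult[OF C m']]
  show ?thesis
    unfolding L a m
  proof (rule order_trans[OF all power_increasing])
    \<comment> \<open>The left side is the exponent assembled by the nested facts above; the nesting
      mirrors the expressions for \<open>L\<close>, \<open>a\<close> and \<open>m\<close>.\<close>
    have "C + (2 + (K + (4 + K + (4 + K) * K + (6 + (K + K) + K) + 1 + (5 + K) + 1 + (4 + K) + 1)) +
      (9 + (K + (K + K))) + 1) + C + 1 + (C + (2 * K + (2 * K + (5 + (2 * K + ((5 + 2 * K) * (2 * K) + 2 + 1) + (5 + K) + 1) + 7 + 1))))
      = 5 * (K * K) + 31 * K + 3 * C + 57"
      by (simp add: algebra_simps)
    moreover have "(200 + 10 * C) * (K * K) = 200 * (K * K) + 10 * (C * (K * K))"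
      by (simp add: algebra_simps)
    moreover have "K \<le> K * K" "1 \<le> K * K" "C \<le> C * (K * K)" using K by simp_all
    ultimately show "C + (2 + (K + (4 + K + (4 + K) * K + (6 + (K + K) + K) + 1 + (5 + K) + 1 + (4 + K) + 1)) +
      (9 + (K + (K + K))) + 1) + C + 1 + (C + (2 * K + (2 * K + (5 + (2 * K + ((5 + 2 * K) * (2 * K) + 2 + 1) + (5 + K) + 1) + 7 + 1))))
      \<le> (200 + 10 * C) * (K * K)"
      by linarith
  qed simp
qed

text \<open>The bound is in the combined size of refutation and CNF: the proof must write down
  \<open>\<phi>\<close> in its last line, whereas a refutation need not mention every clause. The
  constant is chosen after \<open>R\<close> only.\<close>

theorem theorem1p7:
  fixes R :: "frule set"
  assumes "frege_system R"
  shows "\<exists>c::real. c > 0 \<and>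
    (\<forall>(n::nat) (\<phi>::cnf) (\<Phi>::ipsvar ncformula).
       cnf_vars \<phi> \<subseteq> {..<n} \<longrightarrow>
       nc_ips_refutation (ips_system n (map tr_clause \<phi>)) (nc_eval \<Phi>) \<longrightarrow>
       (let N = real (nc_size \<Phi> + psize (cnf_form \<phi>)) in
        \<exists>ls. frege_proof R ls (PNot (cnf_form \<phi>)) \<and>
             real (proof_size ls) \<le> N powr (c * log 2 N)))"
proof -
  \<comment> \<open>All other lines carry the hypothesis as antecedent; this schema turns the
    contradiction under it into its negation.\<close>
  let ?final = "([PImp (PVar 0) (piff PTrue PFalse)], PNot (PVar 0)) :: frule"
  have "sound_rule r" if "r \<in> insert ?final (lift_rule ` set (ring_rules @ clause_rules))" for r
  proof (cases "r = ?final")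
    case True
    then show ?thesis by (simp add: sound_rule_def)
  next
    case False
    then show ?thesis using that sound_lifted_rules by blast
  qed
  from rule_simulation[OF assms _ this, of "insert ?final (lift_rule ` set (ring_rules @ clause_rules))"]
  obtain C where C: "C > 0" and sim:
    "\<And>r \<sigma> m. r \<in> insert ?final (lift_rule ` set (ring_rules @ clause_rules)) \<Longrightarrow>
      \<forall>i. psize (\<sigma> i) \<le> m \<Longrightarrow>
      \<exists>ls. derivation R (psubst \<sigma> ` set (fst r)) ls \<and> psubst \<sigma> (snd r) \<in> set ls \<and>
          length ls \<le> C \<and> (\<forall>l\<in>set ls. psize l \<le> C * m)"
    by blast
  \<comment> \<open>The factor 100 is the square of 10 in \<open>K \<le> 10 * log 2 N\<close>, which
    holds because \<open>K \<le> 2 * log 2 N + 5\<close> and the logarithm is at least 1.\<close>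
  define c where "c = real (200 + 10 * C) * 100"
  have "\<exists>ls. frege_proof R ls (PNot (cnf_form \<phi>)) \<and>
      real (proof_size ls) \<le> real N powr (c * log 2 (real N))"
    if ref: "nc_ips_refutation (ips_system n (map tr_clause \<phi>)) (nc_eval \<Phi>)"
      and N: "N = nc_size \<Phi> + psize (cnf_form \<phi>)" for n \<phi> \<Phi> N
  proof -
    define k where "k = nat \<lceil>log 2 (real N)\<rceil>"
    \<comment> \<open>Thus \<open>2 ^ K = 8 * (2 ^ k) ^ 2\<close>, which dominates
      \<open>8 * (N * N)\<close> and is still quadratic in \<open>N\<close>.\<close>
    define K where "K = 2 * k + 3"
    define a where "a = 4 ^ K * ((32 * 4 ^ K) ^ (2 * K) + 3) + 20 * N"
    define m where "m = 4 ^ K * (4 ^ K * (32 * a + 128))"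
    define L :: nat where "L = 3 * (2 ^ K * (12 * 2 ^ K * (12 * 2 ^ K) ^ K + 60 * (2 ^ K * 2 ^ K) * K + 30 * 2 ^ K + 12 * 2 ^ K))
     + 502 * (2 ^ K * (2 ^ K * 2 ^ K))"
    have "1 \<le> nc_size \<Phi>" by (cases \<Phi>) simp_all
    then have N2: "2 \<le> N" using psize_pos[of "cnf_form \<phi>"] unfolding N by linarith
    have log1: "1 \<le> log 2 (real N)" using N2 by (simp add: le_log_iff)
    have k: "log 2 (real N) \<le> real k" "real k \<le> log 2 (real N) + 1"
    proof -
      have "real k = of_int \<lceil>log 2 (real N)\<rceil>" using log1 by (simp add: k_def)
      then show "log 2 (real N) \<le> real k" "real k \<le> log 2 (real N) + 1"
        using le_of_int_ceiling[of "log 2 (real N)"] of_int_ceiling_le_add_one[of "log 2 (real N)"]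
        by linarith+
    qed
    have "real N = 2 powr log 2 (real N)" using N2 by simp
    also have "\<dots> \<le> 2 powr real k" using k(1) by (intro powr_mono) auto
    also have "\<dots> = real (2 ^ k)" by (simp add: powr_realpow)
    finally have Nk: "N \<le> 2 ^ k" by (simp only: of_nat_le_iff)
    have "N * N \<le> 2 ^ k * 2 ^ k" using Nk by (intro mult_le_mono)
    moreover have "(2::nat) ^ K = 8 * (2 ^ k * 2 ^ k)"
      unfolding K_def power_add mult_2 by simp
    ultimately have NK: "8 * (N * N) \<le> 2 ^ K" by linarith
    have "1 * N \<le> N * N" using N2 by (intro mult_le_mono1) simp
    then have NK': "N \<le> 2 ^ K" using NK by linarith
    have hm: "psize (cnf_form \<phi>) \<le> m"
    proof -
      have "psize (cnf_form \<phi>) \<le> N" "N \<le> a" by (simp_all add: N a_def)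
      moreover have "1 * (1 * (32 * a + 128)) \<le> m"
        unfolding m_def by (intro mult_le_mono order_refl) simp_all
      then have "32 * a + 128 \<le> m" by simp
      ultimately show ?thesis by linarith
    qed
    interpret xor_sums R C m "cnf_form \<phi>" K a
      by unfold_locales (fact C, rule sim, erule insertI2, assumption, fact hm, simp add: m_def)
    have "eqv {} L PTrue PFalse"
      unfolding L_def by (rule refutation_contradiction[OF refl ref _ NK]) (simp_all add: a_def N)
    then obtain ls where ls: "derivation R {} ls" "length ls \<le> C * L" "\<forall>l\<in>set ls. psize l \<le> C * m"
      "PImp (cnf_form \<phi>) (piff PTrue PFalse) \<in> set ls"
      unfolding eqv_def pr_def ext_def by auto
    let ?\<sigma> = "vals [cnf_form \<phi>]"
    have "\<forall>i. psize (?\<sigma> i) \<le> m" using hm m_pos by (auto simp: vals_def)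
    from sim[OF insertI1 this] obtain ls' where
      ls': "derivation R {PImp (cnf_form \<phi>) (piff PTrue PFalse)} ls'" "PNot (cnf_form \<phi>) \<in> set ls'"
        "length ls' \<le> C" "\<forall>l\<in>set ls'. psize l \<le> C * m"
      by (auto simp: vals_def)
    have "derivation R (set ls) ls'" using ls'(1) by (rule derivation_mono) (use ls(4) in simp)
    then have d: "derivation R {} (ls @ ls')" using ls(1) by (intro derivation_append) simp_all
    obtain xs ys where xs: "ls' = xs @ PNot (cnf_form \<phi>) # ys"
      using ls'(2) by (auto simp: in_set_conv_decomp)
    \<comment> \<open>A proof must end with the formula proved, so the list is cut after the target
      line; a prefix of a derivation is a derivation.\<close>
    define qs where "qs = ls @ xs @ [PNot (cnf_form \<phi>)]"
    have "derivation R {} (qs @ ys)" using d by (simp add: xs qs_def)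
    then have "derivation R {} qs"
      by (induction ys rule: rev_induct) (simp_all add: derivation_snoc flip: append_assoc)
    then have fp: "frege_proof R qs (PNot (cnf_form \<phi>))" by (simp add: frege_proof_def qs_def)
    have "proof_size qs \<le> length qs * (C * m)"
    proof -
      have "\<forall>l\<in>set qs. psize l \<le> C * m" using ls(3) ls'(4) by (auto simp: qs_def xs)
      then show ?thesis
        unfolding proof_size_def by (induction qs) auto
    qed
    also have "\<dots> \<le> (C * L + C) * (C * m)"
      using ls(2) ls'(3) by (intro mult_le_mono1) (simp add: qs_def xs)
    also have "\<dots> \<le> 2 ^ ((200 + 10 * C) * (K * K))"
      by (rule proof_size_estimate[OF NK' _ L_def a_def m_def]) (simp add: K_def)
    finally have "real (proof_size qs) \<le> real (2 ^ ((200 + 10 * C) * (K * K)))"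
      by (simp only: of_nat_le_iff)
    also have "\<dots> = 2 powr real ((200 + 10 * C) * (K * K))"
      by (subst powr_realpow) simp_all
    also have "\<dots> \<le> 2 powr (c * log 2 (real N) * log 2 (real N))"
    proof (rule powr_mono)
      have "real K \<le> 10 * log 2 (real N)" using k log1 by (simp add: K_def)
      then have "real K * real K \<le> (10 * log 2 (real N)) * (10 * log 2 (real N))"
        by (intro mult_mono) auto
      then have "real (200 + 10 * C) * (real K * real K) \<le> real (200 + 10 * C) * (100 * (log 2 (real N) * log 2 (real N)))"
        by (intro mult_left_mono) auto
      then show "real ((200 + 10 * C) * (K * K)) \<le> c * log 2 (real N) * log 2 (real N)"
        by (simp add: c_def algebra_simps)
    qed simp
    also have "\<dots> = (2 powr log 2 (real N)) powr (c * log 2 (real N))"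
      by (simp add: powr_powr algebra_simps)
    also have "\<dots> = real N powr (c * log 2 (real N))" using N2 by simp
    finally show ?thesis using fp by blast
  qed
  moreover have "c > 0" by (simp add: c_def)
  ultimately show ?thesis unfolding Let_def by blast
qed

end
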